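(* (i) If $\mathfrak{A}$ is a W$^\star$-algebra with predual $\mathfrak{A}_*$ and $(T(t))_{t\geq0}$ is a positive $C_0$-semigroup on $\mathfrak{A}_*$ with generator $A$, spectral bound $\mathrm{s}(A)$ and growth bound $\omega_0$, then $\mathrm{s}(A)=\omega_0$. (ii) If $\mathfrak{A}$ is a C$^\star$-algebra and $(T(t))_{t\geq0}$ is a positive $C_0$-semigroup on the dual $\mathfrak{A}^*$ of $\mathfrak{A}$ with generator $A$, spectral bound $\mathrm{s}(A)$ and growth bound $\omega_0$, then $\mathrm{s}(A)=\omega_0$.
   Context: Algebras are complex. A $C_0$-semigroup is a strongly continuous one-parameter semigroup $(T(t))_{t\ge0}$ of bounded linear operators with $T(0)=I$; it is positive if each $T(t)$ maps the positive cone into itself. The positive cone of $\mathfrak{A}^*$ is the set of positive linear functionals on $\mathfrak{A}$; the positive cone of $\mathfrak{A}_*$ is the set of normal positive linear functionals on $\mathfrak{A}$. The spectral bound is $\mathrm{s}(A)=\sup\{\operatorname{Re}\lambda:\lambda\in\sigma(A)\}\in[-\infty,\infty)$, with $\mathrm{s}(A)=-\infty$ if the spectrum $\sigma(A)$ is empty. The growth bound $\omega_0\in[-\infty,\infty)$ is determined by $r(T(t))=e^{\omega_0 t}$ for $t>0$, where $r(\cdot)$ is the spectral radius (with $e^{-\infty}=0$). *)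

theory Defs
  imports "HOL-Analysis.Analysis"
begin

section \<open>Complex Banach spaces and C*-algebras\<close>

class complex_normed_vector = real_normed_vector +
  fixes scaleC :: "complex \<Rightarrow> 'a \<Rightarrow> 'a"  (infixr \<open>*\<^sub>C\<close> 75)
  assumes scaleC_add_right: "c *\<^sub>C (x + y) = c *\<^sub>C x + c *\<^sub>C y"
    and scaleC_add_left: "(c + d) *\<^sub>C x = c *\<^sub>C x + d *\<^sub>C x"
    and scaleC_scaleC: "c *\<^sub>C (d *\<^sub>C x) = (c * d) *\<^sub>C x"
    and scaleC_of_real: "complex_of_real r *\<^sub>C x = r *\<^sub>R x"
    and norm_scaleC: "norm (c *\<^sub>C x) = cmod c * norm x"

class complex_banach = complex_normed_vector + complete_space

subclass (in complex_banach) banach ..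

text \<open>A C*-algebra is not required to have a unit.\<close>

class cstar_algebra = real_normed_algebra + complex_banach +
  fixes star :: "'a \<Rightarrow> 'a"
  assumes scaleC_mult_left: "(c *\<^sub>C x) * y = c *\<^sub>C (x * y)"
    and scaleC_mult_right: "x * (c *\<^sub>C y) = c *\<^sub>C (x * y)"
    and star_add: "star (x + y) = star x + star y"
    and star_scaleC: "star (c *\<^sub>C x) = cnj c *\<^sub>C star x"
    and star_mult: "star (x * y) = star y * star x"
    and star_star: "star (star x) = x"
    and cstar_identity: "norm (star x * x) = (norm x)\<^sup>2"

instantiation complex :: complex_banach
begin

definition scaleC_complex :: "complex \<Rightarrow> complex \<Rightarrow> complex"
  where "scaleC_complex c x = c * x"

instance
  by standard (auto simp: scaleC_complex_def algebra_simps scaleR_conv_of_real norm_mult)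

end

definition clinear :: "('a::complex_normed_vector \<Rightarrow> 'b::complex_normed_vector) \<Rightarrow> bool"
  where "clinear f \<longleftrightarrow> (\<forall>x y. f (x + y) = f x + f y) \<and> (\<forall>c x. f (c *\<^sub>C x) = c *\<^sub>C f x)"

definition bounded_clinear :: "('a::complex_normed_vector \<Rightarrow> 'b::complex_normed_vector) \<Rightarrow> bool"
  where "bounded_clinear f \<longleftrightarrow> clinear f \<and> (\<exists>K. \<forall>x. norm (f x) \<le> norm x * K)"

lemma bounded_clinear_iff:
  "bounded_clinear f \<longleftrightarrow> bounded_linear f \<and> (\<forall>c x. f (c *\<^sub>C x) = c *\<^sub>C f x)"
proof
  assume f: "bounded_clinear f"
  then have "\<forall>c x. f (c *\<^sub>C x) = c *\<^sub>C f x"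
    by (simp add: bounded_clinear_def clinear_def)
  moreover from f have "bounded_linear f"
    by (intro bounded_linear.intro linearI bounded_linear_axioms.intro)
      (auto simp: bounded_clinear_def clinear_def simp flip: scaleC_of_real)
  ultimately show "bounded_linear f \<and> (\<forall>c x. f (c *\<^sub>C x) = c *\<^sub>C f x)" by blast
next
  assume "bounded_linear f \<and> (\<forall>c x. f (c *\<^sub>C x) = c *\<^sub>C f x)"
  then show "bounded_clinear f"
    by (auto simp: bounded_clinear_def clinear_def linear_add bounded_linear.linear
        dest: bounded_linear.bounded)
qed


section \<open>The dual of a complex normed space\<close>

typedef (overloaded) 'a cdual = "{f :: 'a::complex_normed_vector \<Rightarrow> complex. bounded_clinear f}"
  morphisms cdual_apply Cdual
  by (rule exI[of _ "\<lambda>_. 0"]) (auto simp: bounded_clinear_iff scaleC_complex_def)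

setup_lifting type_definition_cdual

instantiation cdual :: (complex_normed_vector) complex_normed_vector
begin

lift_definition norm_cdual :: "'a cdual \<Rightarrow> real" is onorm .

lift_definition zero_cdual :: "'a cdual" is "\<lambda>_. 0"
  by (simp add: bounded_clinear_iff scaleC_complex_def)

lift_definition plus_cdual :: "'a cdual \<Rightarrow> 'a cdual \<Rightarrow> 'a cdual" is "\<lambda>f g x. f x + g x"
  by (auto simp: bounded_clinear_iff scaleC_add_right intro: bounded_linear_add)

lift_definition minus_cdual :: "'a cdual \<Rightarrow> 'a cdual \<Rightarrow> 'a cdual" is "\<lambda>f g x. f x - g x"
  by (auto simp: bounded_clinear_iff scaleC_complex_def algebra_simps intro: bounded_linear_sub)

lift_definition uminus_cdual :: "'a cdual \<Rightarrow> 'a cdual" is "\<lambda>f x. - f x"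
  by (auto simp: bounded_clinear_iff scaleC_complex_def intro: bounded_linear_minus)

lift_definition scaleC_cdual :: "complex \<Rightarrow> 'a cdual \<Rightarrow> 'a cdual" is "\<lambda>c f x. c * f x"
  by (auto simp: bounded_clinear_iff scaleC_complex_def intro: bounded_linear_const_mult)

definition scaleR_cdual :: "real \<Rightarrow> 'a cdual \<Rightarrow> 'a cdual"
  where "scaleR_cdual r f = complex_of_real r *\<^sub>C f"

definition dist_cdual :: "'a cdual \<Rightarrow> 'a cdual \<Rightarrow> real"
  where "dist_cdual f g = norm (f - g)"

definition uniformity_cdual :: "('a cdual \<times> 'a cdual) filter"
  where "uniformity_cdual = (INF e\<in>{0 <..}. principal {(f, g). dist f g < e})"

definition open_cdual :: "'a cdual set \<Rightarrow> bool"
  where "open_cdual S \<longleftrightarrow> (\<forall>f\<in>S. \<forall>\<^sub>F (f', g) in uniformity. f' = f \<longrightarrow> g \<in> S)"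

definition sgn_cdual :: "'a cdual \<Rightarrow> 'a cdual"
  where "sgn_cdual f = inverse (norm f) *\<^sub>R f"

lemma onorm_const_mult_complex:
  fixes f :: "'a \<Rightarrow> complex"
  assumes f: "bounded_linear f"
  shows "onorm (\<lambda>x. c * f x) = cmod c * onorm f"
proof (cases "c = 0")
  case True
  then show ?thesis by (simp add: onorm_zero)
next
  case False
  have le: "onorm (\<lambda>x. c * f x) \<le> cmod c * onorm f" if "bounded_linear f"
    for c and f :: "'a \<Rightarrow> complex"
    by (rule onorm_bound)
      (auto simp: norm_mult mult.assoc onorm_pos_le[OF that] intro!: mult_left_mono onorm[OF that])
  have "onorm f \<le> cmod (inverse c) * onorm (\<lambda>x. c * f x)"
    using le[of "\<lambda>x. c * f x" "inverse c"] f False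
    by (simp add: bounded_linear_const_mult flip: mult.assoc)
  then show ?thesis
    using le[OF f, of c] False by (simp add: norm_inverse norm_divide field_simps)
qed

instance
proof
  fix f g h :: "'a cdual" and a b :: real and c d :: complex
  show "f + g + h = f + (g + h)" "f + g = g + f" "0 + f = f" "- f + f = 0" "f - g = f + - g"
    by (transfer, simp add: algebra_simps)+
  show "a *\<^sub>R (f + g) = a *\<^sub>R f + a *\<^sub>R g" "(a + b) *\<^sub>R f = a *\<^sub>R f + b *\<^sub>R f"
    "a *\<^sub>R b *\<^sub>R f = (a * b) *\<^sub>R f" "1 *\<^sub>R f = f"
    unfolding scaleR_cdual_def by (transfer, simp add: algebra_simps)+
  show "c *\<^sub>C (f + g) = c *\<^sub>C f + c *\<^sub>C g" "(c + d) *\<^sub>C f = c *\<^sub>C f + d *\<^sub>C f"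
    "c *\<^sub>C d *\<^sub>C f = (c * d) *\<^sub>C f"
    by (transfer, simp add: algebra_simps)+
  show "complex_of_real a *\<^sub>C f = a *\<^sub>R f"
    by (simp add: scaleR_cdual_def)
  show nC: "norm (c *\<^sub>C f) = cmod c * norm f" for c
    by transfer (simp add: onorm_const_mult_complex bounded_clinear_iff)
  show "norm (a *\<^sub>R f) = \<bar>a\<bar> * norm f"
    by (simp add: scaleR_cdual_def nC)
  show "(norm f = 0) = (f = 0)"
    by transfer (auto simp: bounded_clinear_iff onorm_eq_0)
  show "norm (f + g) \<le> norm f + norm g"
    by transfer (auto simp: bounded_clinear_iff onorm_triangle)
qed (simp_all add: dist_cdual_def uniformity_cdual_def open_cdual_def sgn_cdual_def)

end

lemma cdual_apply_bounded_linear: "bounded_linear (cdual_apply f)"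
  using cdual_apply[of f] by (simp add: bounded_clinear_iff)

instance cdual :: (complex_normed_vector) complex_banach
proof
  fix X :: "nat \<Rightarrow> 'a cdual"
  assume X: "Cauchy X"
  define B where "B f = Blinfun (cdual_apply f)" for f :: "'a cdual"
  have B_apply: "blinfun_apply (B f) = cdual_apply f" for f
    by (simp add: B_def bounded_linear_Blinfun_apply cdual_apply_bounded_linear)
  have dist_B: "dist (B f) (B g) = dist f g" for f g
  proof -
    have "blinfun_apply (B f - B g) = cdual_apply (f - g)"
      by (auto simp: B_apply minus_blinfun.rep_eq minus_cdual.rep_eq)
    then show ?thesis
      by (simp add: dist_norm norm_blinfun.rep_eq norm_cdual.rep_eq)
  qed
  from X have "Cauchy (\<lambda>n. B (X n))"
    by (simp add: Cauchy_def dist_B)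
  then obtain L where L: "(\<lambda>n. B (X n)) \<longlonglongrightarrow> L"
    by (auto simp: Cauchy_convergent_iff convergent_def)
  have lim: "(\<lambda>n. cdual_apply (X n) x) \<longlonglongrightarrow> blinfun_apply L x" for x
    using blinfun.tendsto[OF L tendsto_const[of x]] by (simp add: B_apply)
  have "blinfun_apply L (c *\<^sub>C x) = c * blinfun_apply L x" for c x
  proof (rule LIMSEQ_unique[OF lim])
    have "cdual_apply (X n) (c *\<^sub>C x) = c * cdual_apply (X n) x" for n
      using cdual_apply[of "X n"] by (simp add: bounded_clinear_iff scaleC_complex_def)
    then show "(\<lambda>n. cdual_apply (X n) (c *\<^sub>C x)) \<longlonglongrightarrow> c * blinfun_apply L x"
      by (simp add: tendsto_mult_left lim)
  qed
  then have "bounded_clinear (blinfun_apply L)"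
    by (simp add: bounded_clinear_iff scaleC_complex_def blinfun.bounded_linear_right)
  then have "L = B (Cdual (blinfun_apply L))"
    by (simp add: B_def Cdual_inverse blinfun_apply_inverse)
  with L have "X \<longlonglongrightarrow> Cdual (blinfun_apply L)"
    by (metis (no_types, lifting) dist_B lim_sequentially)
  then show "convergent X"
    by (auto simp: convergent_def)
qed


section \<open>Preduals and positive cones\<close>

definition positive_functional :: "('a::cstar_algebra \<Rightarrow> complex) \<Rightarrow> bool"
  where "positive_functional \<phi> \<longleftrightarrow> clinear \<phi> \<and> (\<forall>a. \<phi> (star a * a) \<in> \<real>\<^sub>\<ge>\<^sub>0)"

definition dual_cone :: "'a::cstar_algebra cdual set"
  where "dual_cone = {\<phi>. positive_functional (cdual_apply \<phi>)}"

text \<open>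
  Following Sakai, a W*-algebra is a C*-algebra that is, as a Banach space, the dual of some
  Banach space.  Thus \<open>is_predual \<iota>\<close> says that \<^typ>\<open>'a\<close> is a W*-algebra with predual
  \<^typ>\<open>'p\<close>, where \<open>\<iota>\<close> identifies \<^typ>\<open>'a\<close> with the dual of \<^typ>\<open>'p\<close>; an element \<open>x\<close> of the
  predual is identified with the functional \<open>predual_functional \<iota> x\<close> on \<^typ>\<open>'a\<close>.
\<close>

definition is_predual :: "('a::cstar_algebra \<Rightarrow> 'p::complex_banach cdual) \<Rightarrow> bool"
  where "is_predual \<iota> \<longleftrightarrow> clinear \<iota> \<and> (\<forall>a. norm (\<iota> a) = norm a) \<and> surj \<iota>"

definition predual_functional ::
    "('a::cstar_algebra \<Rightarrow> 'p::complex_banach cdual) \<Rightarrow> 'p \<Rightarrow> 'a \<Rightarrow> complex"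
  where "predual_functional \<iota> x = (\<lambda>a. cdual_apply (\<iota> a) x)"

text \<open>The weak* topology of the W*-algebra: pointwise convergence on the predual.\<close>

definition weak_star_topology ::
    "('a::cstar_algebra \<Rightarrow> 'p::complex_banach cdual) \<Rightarrow> 'a topology"
  where "weak_star_topology \<iota> =
    pullback_topology UNIV (\<lambda>a. cdual_apply (\<iota> a)) (product_topology (\<lambda>_. euclidean) UNIV)"

definition normal_functional ::
    "('a::cstar_algebra \<Rightarrow> 'p::complex_banach cdual) \<Rightarrow> ('a \<Rightarrow> complex) \<Rightarrow> bool"
  where "normal_functional \<iota> \<phi> \<longleftrightarrow>
    clinear \<phi> \<and> continuous_map (weak_star_topology \<iota>) euclidean \<phi>"

lemma normal_predual_functional:
  assumes "is_predual \<iota>"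
  shows "normal_functional \<iota> (predual_functional \<iota> x)"
proof -
  have "continuous_map (product_topology (\<lambda>_. euclidean) UNIV) euclidean (\<lambda>f. f x)"
    by (rule continuous_map_product_projection) simp
  then have "continuous_map (weak_star_topology \<iota>) euclidean ((\<lambda>f. f x) \<circ> (\<lambda>a. cdual_apply (\<iota> a)))"
    unfolding weak_star_topology_def by (rule continuous_map_pullback)
  moreover have "clinear (predual_functional \<iota> x)"
    using assms
    by (simp add: is_predual_def clinear_def predual_functional_def scaleC_complex_def
        plus_cdual.rep_eq scaleC_cdual.rep_eq)
  ultimately show ?thesis
    by (simp add: normal_functional_def predual_functional_def o_def)
qed

definition predual_cone :: "('a::cstar_algebra \<Rightarrow> 'p::complex_banach cdual) \<Rightarrow> 'p set"
  where "predual_cone \<iota> =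
    {x. normal_functional \<iota> (predual_functional \<iota> x) \<and>
        positive_functional (predual_functional \<iota> x)}"


section \<open>Spectrum of (possibly unbounded) operators\<close>

text \<open>An operator is a pair of its domain and a map; the values of the map off the domain are
  irrelevant.  Bounded operators have domain \<^term>\<open>UNIV\<close>.\<close>

type_synonym 'x partial_operator = "'x set \<times> ('x \<Rightarrow> 'x)"

definition resolvent_set :: "'x::complex_banach partial_operator \<Rightarrow> complex set"
  where "resolvent_set = (\<lambda>(D, A). {l.
    bij_betw (\<lambda>x. l *\<^sub>C x - A x) D UNIV \<and>
    bounded_clinear (inv_into D (\<lambda>x. l *\<^sub>C x - A x))})"

definition spectrum :: "'x::complex_banach partial_operator \<Rightarrow> complex set"
  where "spectrum A = - resolvent_set A"

text \<open>The supremum of the empty set is \<^term>\<open>- \<infinity> :: ereal\<close> here.\<close>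

definition spectral_bound :: "'x::complex_banach partial_operator \<Rightarrow> ereal"
  where "spectral_bound A = (SUP l\<in>spectrum A. ereal (Re l))"

text \<open>The spectrum of a bounded operator is empty only on the zero space, where the supremum in
  \<^typ>\<open>ennreal\<close> gives spectral radius \<open>0\<close>.\<close>

definition spectral_radius :: "('x::complex_banach \<Rightarrow> 'x) \<Rightarrow> ennreal"
  where "spectral_radius B = (SUP l\<in>spectrum (UNIV, B). ennreal (cmod l))"


section \<open>Strongly continuous semigroups\<close>

text \<open>Only the values \<open>T t\<close> with \<open>t \<ge> 0\<close> matter.\<close>

definition C0_semigroup :: "(real \<Rightarrow> 'x::complex_banach \<Rightarrow> 'x) \<Rightarrow> bool"
  where "C0_semigroup T \<longleftrightarrow>
    (\<forall>t\<ge>0. bounded_clinear (T t)) \<and>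
    T 0 = id \<and>
    (\<forall>s\<ge>0. \<forall>t\<ge>0. T (s + t) = T s \<circ> T t) \<and>
    (\<forall>x. continuous_on {0..} (\<lambda>t. T t x))"

definition positive_semigroup :: "'x set \<Rightarrow> (real \<Rightarrow> 'x \<Rightarrow> 'x) \<Rightarrow> bool"
  where "positive_semigroup C T \<longleftrightarrow> (\<forall>t\<ge>0. T t ` C \<subseteq> C)"

definition generator :: "(real \<Rightarrow> 'x::complex_banach \<Rightarrow> 'x) \<Rightarrow> 'x partial_operator"
  where "generator T =
    ({x. \<exists>y. ((\<lambda>h. (T h x - x) /\<^sub>R h) \<longlongrightarrow> y) (at_right 0)},
     \<lambda>x. Lim (at_right 0) (\<lambda>h. (T h x - x) /\<^sub>R h))"

definition exp_ereal :: "ereal \<Rightarrow> ennreal"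
  where "exp_ereal w = (case w of ereal r \<Rightarrow> ennreal (exp r) | PInfty \<Rightarrow> \<infinity> | MInfty \<Rightarrow> 0)"

definition growth_bound :: "(real \<Rightarrow> 'x::complex_banach \<Rightarrow> 'x) \<Rightarrow> ereal"
  where "growth_bound T =
    (THE w. w < \<infinity> \<and> (\<forall>t>0. spectral_radius (T t) = exp_ereal (w * ereal t)))"

lemma growth_bound_eqI:
  assumes "w < \<infinity>" and "\<And>t. t > 0 \<Longrightarrow> spectral_radius (T t) = exp_ereal (w * ereal t)"
  shows "growth_bound T = w"
  unfolding growth_bound_def
proof (rule the_equality)
  fix v assume v: "v < \<infinity> \<and> (\<forall>t>0. spectral_radius (T t) = exp_ereal (v * ereal t))"
  then have "exp_ereal (v * ereal 1) = exp_ereal (w * ereal 1)"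
    using assms(2)[of 1] by (metis zero_less_one)
  then have "exp_ereal v = exp_ereal w"
    by (simp flip: one_ereal_def)
  with v assms(1) show "v = w"
    by (cases v; cases w) (auto simp: exp_ereal_def)
qed (use assms in auto)

end

theory Submission
  imports Defs
begin

text \<open>
  Both preduals of W*-algebras and duals of C*-algebras are ordered by a closed cone \<open>C\<close> with two
  properties: the norm is additive on \<open>C\<close>, and every element is a combination
  \<open>(a - b) + \<i> (c - d)\<close> of elements of \<open>C\<close>.  For a positive semigroup on any complex Banach space
  with such a cone the equality of spectral bound and growth bound follows from these properties
  alone (\<open>spectral_bound_eq_growth_bound\<close>).

  The inequality \<open>s(A) \<le> \<omega>\<^sub>0\<close> holds for every semigroup: beyond the growth bound the resolvent is
  given by a finite Laplace integral times a Neumann series (\<open>resolvent_from_laplace\<close>).  Conversely,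
  let \<open>m > s(A)\<close> be real.  The resolvent is positive far to the right, and by its Neumann series it
  stays positive on its way down to \<open>m\<close> (\<open>pos_op_resolvent\<close>).  If \<open>v\<close> denotes the integral of
  \<open>exp (- m s) T(s) x\<close> over \<open>[0, t]\<close>, then \<open>R(m) x = v + R(m) exp (- m t) T(t) x\<close>; so for positive
  \<open>x\<close> all these integrals are bounded by \<open>R(m) x\<close> in order, hence in norm.  As the norm is additive
  on \<open>C\<close>, it can be pulled under the integral, and the scalar functions \<open>exp (- m s) \<parallel>T(s) x\<parallel>\<close> have
  bounded integrals.  This bounds the orbits of \<open>exp (- m t) T(t)\<close>, first for positive and then for
  all vectors, and uniform boundedness gives \<open>\<omega>\<^sub>0 \<le> m\<close>.  That the growth bound determines the
  spectral radius of each \<open>T(t)\<close> is the spectral radius formula, obtained here by averaging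
  resolvents over roots of unity (\<open>spectral_radius_attained\<close>).

  The two properties of the cone are theorems about C*-algebras.  In the unitization the elements
  of the form \<open>a* a\<close> are exactly the selfadjoint ones with spectrum in \<open>[0, \<infinity>)\<close>, and the order that
  they define is tied to the norm (\<open>norm_le_iff_pos_elt\<close>, \<open>pos_elt_star_mult\<close>).  An approximate unit
  that serves two functionals at once shows that the norm is additive on positive functionals
  (\<open>norm_additive_on_dual_cone\<close>).  On the dual, the Hahn--Banach theorem produces for every hermitian functional a positive one above it
  (\<open>hermitian_functional_decomposition\<close>).

  In the predual such a functional must be found among the normal ones, and nothing is assumed
  about weak* continuity of the algebraic operations.  Weak* compactness of the unit ball first
  yields a unit (\<open>exists_unit\<close>).  With the unit, the accretive elements of the unit ball are cut out
  by norm inequalities, so they form a weak* compact set (\<open>compact_ev_accretive_ball\<close>).  By duality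
  every element of the predual that is nearly nonnegative on this set can be corrected to a positive
  one (\<open>near_predual_cone\<close>), so the accretive elements are exactly the dual cone of the normal
  positive functionals, and a second duality argument shows that these functionals span the predual
  (\<open>predual_cone_generating\<close>).
\<close>

section \<open>Hahn--Banach, duals and uniform boundedness\<close>

subsection \<open>Sublinear functionals\<close>

definition sublinear :: "('a::real_vector \<Rightarrow> real) \<Rightarrow> bool"
  where "sublinear q \<longleftrightarrow>
    (\<forall>x y. q (x + y) \<le> q x + q y) \<and> (\<forall>c\<ge>0. \<forall>x. q (c *\<^sub>R x) = c * q x)"

lemma sublinear_add: "sublinear q \<Longrightarrow> q (x + y) \<le> q x + q y"
  and sublinear_scale: "sublinear q \<Longrightarrow> 0 \<le> c \<Longrightarrow> q (c *\<^sub>R x) = c * q x"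
  by (auto simp: sublinear_def)

lemma sublinear_zero: "sublinear q \<Longrightarrow> q 0 = 0"
  using sublinear_scale[of q 0 0] by simp

lemma sublinear_minus: "sublinear q \<Longrightarrow> - q (- x) \<le> q x"
  using sublinear_add[of q x "- x"] sublinear_zero[of q] by simp

text \<open>
  Apart from the norm, all functionals to which the Hahn--Banach theorem is applied below are infima of
  this kind: a jointly sublinear expression minimized over a convex cone of auxiliary vectors.
\<close>

lemma sublinear_INF:
  fixes F :: "'a::real_vector \<Rightarrow> 'b::real_vector \<Rightarrow> real"
  assumes K: "0 \<in> K" "\<And>k l. k \<in> K \<Longrightarrow> l \<in> K \<Longrightarrow> k + l \<in> K"
      "\<And>c k. 0 < c \<Longrightarrow> k \<in> K \<Longrightarrow> c *\<^sub>R k \<in> K"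
    and bdd: "\<And>x. bdd_below (F x ` K)"
    and add: "\<And>x y k l. k \<in> K \<Longrightarrow> l \<in> K \<Longrightarrow> F (x + y) (k + l) \<le> F x k + F y l"
    and scale: "\<And>c x k. 0 \<le> c \<Longrightarrow> k \<in> K \<Longrightarrow> F (c *\<^sub>R x) (c *\<^sub>R k) = c * F x k"
  shows "sublinear (\<lambda>x. INF k\<in>K. F x k)"
proof -
  define q where "q x = (INF k\<in>K. F x k)" for x
  have lower: "q x \<le> F x k" if "k \<in> K" for x k
    unfolding q_def by (rule cINF_lower[OF bdd that])
  have greatest: "b \<le> q x" if "\<And>k. k \<in> K \<Longrightarrow> b \<le> F x k" for b x
    unfolding q_def by (rule cINF_greatest[OF _ that]) (use K in auto)
  have "sublinear q"
    unfolding sublinear_def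
  proof (intro conjI allI impI)
    fix x y
    have "q (x + y) - F x k \<le> q y" if k: "k \<in> K" for k
      by (rule greatest) (use lower[OF K(2)[OF k]] add[OF k] order_trans in \<open>fastforce simp: algebra_simps\<close>)
    then have "q (x + y) - q y \<le> q x"
      by (intro greatest) (simp add: algebra_simps)
    then show "q (x + y) \<le> q x + q y" by simp
  next
    have *: "c * q x \<le> q (c *\<^sub>R x)" if c: "0 < c" for c x
    proof (rule greatest)
      fix k assume k: "k \<in> K"
      have "c * q x \<le> c * F x (inverse c *\<^sub>R k)"
        using c k by (intro mult_left_mono lower K(3)) auto
      also have "\<dots> = F (c *\<^sub>R x) k"
        using scale[of c "inverse c *\<^sub>R k" x] c K(3)[OF _ k] by simp
      finally show "c * q x \<le> F (c *\<^sub>R x) k" .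
    qed
    fix c :: real and x assume c: "0 \<le> c"
    show "q (c *\<^sub>R x) = c * q x"
    proof (cases "c = 0")
      case True
      have "2 * q 0 \<le> q 0" using *[of 2 0] by simp
      moreover have "inverse 2 * q 0 \<le> q 0" using *[of "inverse 2" 0] by simp
      ultimately have "q 0 = 0" by simp
      with True show ?thesis by simp
    next
      case False
      then show ?thesis using c *[of c x] *[of "inverse c" "c *\<^sub>R x"] by (simp add: field_simps)
    qed
  qed
  then show ?thesis by (simp add: q_def[abs_def])
qed

text \<open>
  The device behind the Hahn--Banach theorem: replacing \<open>q\<close> by this functional makes it affine
  along the ray through \<open>x0\<close> without losing sublinearity.
\<close>

definition ray_reduction :: "('a::real_vector \<Rightarrow> real) \<Rightarrow> 'a \<Rightarrow> 'a \<Rightarrow> real"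
  where "ray_reduction q x0 x = (INF t\<in>{0..}. q (x + t *\<^sub>R x0) - t * q x0)"

lemma ray_reduction_bdd:
  assumes "sublinear q"
  shows "bdd_below ((\<lambda>t. q (x + t *\<^sub>R x0) - t * q x0) ` {0..})"
proof (rule bdd_belowI2)
  fix t :: real assume "t \<in> {0..}"
  then have "t * q x0 = q (t *\<^sub>R x0)"
    using assms by (simp add: sublinear_scale)
  also have "\<dots> \<le> q (x + t *\<^sub>R x0) + q (- x)"
    using sublinear_add[OF assms, of "x + t *\<^sub>R x0" "- x"] by simp
  finally show "- q (- x) \<le> q (x + t *\<^sub>R x0) - t * q x0" by simp
qed

lemma ray_reduction_le:
  assumes "sublinear q" "0 \<le> t"
  shows "ray_reduction q x0 x \<le> q (x + t *\<^sub>R x0) - t * q x0"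
  unfolding ray_reduction_def by (rule cINF_lower[OF ray_reduction_bdd]) (use assms in auto)

lemma sublinear_ray_reduction:
  assumes q: "sublinear q"
  shows "sublinear (ray_reduction q x0)"
  unfolding ray_reduction_def[abs_def]
proof (rule sublinear_INF[OF _ _ _ ray_reduction_bdd[OF q]])
  fix x y and s t :: real assume "s \<in> {0..}" "t \<in> {0..}"
  have "q ((x + y) + (s + t) *\<^sub>R x0) \<le> q (x + s *\<^sub>R x0) + q (y + t *\<^sub>R x0)"
    using sublinear_add[OF q, of "x + s *\<^sub>R x0" "y + t *\<^sub>R x0"] by (simp add: algebra_simps)
  then show "q (x + y + (s + t) *\<^sub>R x0) - (s + t) * q x0
      \<le> q (x + s *\<^sub>R x0) - s * q x0 + (q (y + t *\<^sub>R x0) - t * q x0)"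
    by (simp add: algebra_simps)
next
  fix c t :: real and x assume "0 \<le> c"
  then show "q (c *\<^sub>R x + (c *\<^sub>R t) *\<^sub>R x0) - c *\<^sub>R t * q x0 = c * (q (x + t *\<^sub>R x0) - t * q x0)"
    using sublinear_scale[OF q, of c "x + t *\<^sub>R x0"] by (simp add: algebra_simps)
qed auto

text \<open>
  A minimal sublinear functional coincides with all of its ray reductions, which forces it to be
  odd and hence linear; Zorn's lemma provides a minimal one below \<open>p\<close>.
\<close>

lemma sublinear_dominates_linear:
  fixes p :: "'a::real_vector \<Rightarrow> real"
  assumes p: "sublinear p"
  shows "\<exists>g. linear g \<and> (\<forall>x. g x \<le> p x)"
proof -
  define A where "A = {q. sublinear q \<and> q \<le> p}"
  define P where "P = (\<lambda>q r :: 'a \<Rightarrow> real. r \<le> q)"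
  have "\<exists>m\<in>A. \<forall>a\<in>A. P m a \<longrightarrow> a = m"
  proof (rule predicate_Zorn)
    show "partial_order_on A (relation_of P A)"
      by (rule partial_order_on_relation_ofI) (auto simp: P_def)
  next
    fix C assume C: "C \<in> Chains (relation_of P A)"
    then have CA: "C \<subseteq> A" and tot: "\<And>q r. q \<in> C \<Longrightarrow> r \<in> C \<Longrightarrow> q \<le> r \<or> r \<le> q"
      by (auto simp: Chains_def relation_of_def P_def)
    show "\<exists>u\<in>A. \<forall>a\<in>C. P a u"
    proof (cases "C = {}")
      case True
      then show ?thesis using p by (auto simp: A_def)
    next
      case False
      have bdd: "bdd_below ((\<lambda>q. q x) ` C)" for x
      proof (rule bdd_belowI2)
        fix q assume "q \<in> C"
        then have q: "sublinear q" "q \<le> p" using CA by (auto simp: A_def)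
        then show "- p (- x) \<le> q x"
          using sublinear_minus[OF q(1), of x] le_funD[OF q(2), of "- x"] by linarith
      qed
      define u where "u x = (INF q\<in>C. q x)" for x
      have ul: "u x \<le> q x" if "q \<in> C" for q x
        unfolding u_def by (rule cINF_lower[OF bdd that])
      have ug: "b \<le> u x" if "\<And>q. q \<in> C \<Longrightarrow> b \<le> q x" for b x
        unfolding u_def by (rule cINF_greatest[OF False that])
      have "sublinear u"
        unfolding sublinear_def
      proof (intro conjI allI impI)
        fix x y
        have "u (x + y) - q x \<le> u y" if q: "q \<in> C" for q
        proof (rule ug)
          fix r assume r: "r \<in> C"
          have sl: "sublinear q" "sublinear r" using q r CA by (auto simp: A_def)
          consider "q \<le> r" | "r \<le> q" using tot[OF q r] by blast
          then show "u (x + y) - q x \<le> r y"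
          proof cases
            case 1
            then show ?thesis
              using ul[OF q, of "x+y"] sublinear_add[OF sl(1), of x y] le_funD[OF 1, of y] by linarith
          next
            case 2
            then show ?thesis
              using ul[OF r, of "x+y"] sublinear_add[OF sl(2), of x y] le_funD[OF 2, of x] by linarith
          qed
        qed
        then have "u (x + y) - u y \<le> u x"
          by (intro ug) (simp add: algebra_simps)
        then show "u (x + y) \<le> u x + u y" by simp
      next
        have *: "c * u x \<le> u (c *\<^sub>R x)" if "c \<ge> 0" for c x
        proof (rule ug)
          fix q assume q: "q \<in> C"
          then have "q (c *\<^sub>R x) = c * q x"
            using CA that by (auto simp: A_def intro: sublinear_scale)
          then show "c * u x \<le> q (c *\<^sub>R x)" using ul[OF q, of x] that by (simp add: mult_left_mono)
        qed
        fix c :: real and x assume c: "0 \<le> c"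
        show "u (c *\<^sub>R x) = c * u x"
        proof (cases "c = 0")
          case True
          have "q 0 = 0" if "q \<in> C" for q using that CA by (auto simp: A_def sublinear_zero)
          then have "u 0 = (INF q\<in>C. 0)" unfolding u_def by (intro INF_cong) auto
          then have "u 0 = 0" using \<open>C \<noteq> {}\<close> by simp
          then show ?thesis using True by simp
        next
          case False
          then show ?thesis using c *[of c x] *[of "inverse c" "c *\<^sub>R x"] by (simp add: field_simps)
        qed
      qed
      moreover have "u \<le> p"
        using False CA ul unfolding A_def le_fun_def by (metis (mono_tags, lifting) all_not_in_conv
            le_funD mem_Collect_eq order_trans subsetD)
      ultimately show ?thesis
        using ul by (intro bexI[of _ u]) (auto simp: A_def P_def le_fun_def)
    qed
  qed
  then obtain g where g: "sublinear g" "g \<le> p" and min: "\<And>q. sublinear q \<Longrightarrow> q \<le> g \<Longrightarrow> q = g"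
    unfolding A_def P_def by auto
  have odd: "g (- x) = - g x" for x
  proof -
    have "ray_reduction g x \<le> g"
      using ray_reduction_le[OF g(1), of 0 x] by (simp add: le_fun_def)
    then have "ray_reduction g x = g"
      by (rule min[OF sublinear_ray_reduction[OF g(1)]])
    then have "g (- x) \<le> g (- x + 1 *\<^sub>R x) - 1 * g x"
      using ray_reduction_le[OF g(1), of 1 x "- x"] by simp
    then show ?thesis
      using sublinear_zero[OF g(1)] sublinear_minus[OF g(1), of x] by simp
  qed
  have "linear g"
  proof (rule linearI)
    fix x y
    show "g (x + y) = g x + g y"
      using sublinear_add[OF g(1), of x y] sublinear_add[OF g(1), of "- x" "- y"]
        odd[of x] odd[of y] odd[of "x + y"] by (simp add: algebra_simps)
  next
    fix c :: real and x
    show "g (c *\<^sub>R x) = c *\<^sub>R g x"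
      using sublinear_scale[OF g(1), of c x] sublinear_scale[OF g(1), of "- c" x] odd[of "c *\<^sub>R x"]
      by (cases "c \<ge> 0") auto
  qed
  then show ?thesis using g(2) by (auto simp: le_fun_def)
qed

text \<open>
  Applying the previous lemma to the ray reduction at \<open>x0\<close> pins the value at \<open>x0\<close>, because the ray
  reduction at \<open>- x0\<close> is at most \<open>- p x0\<close>.
\<close>

theorem Hahn_Banach_dominated:
  fixes p :: "'a::real_vector \<Rightarrow> real"
  assumes p: "sublinear p"
  obtains g where "linear g" "\<And>x. g x \<le> p x" "g x0 = p x0"
proof -
  obtain g where g: "linear g" "\<And>x. g x \<le> ray_reduction p x0 x"
    using sublinear_dominates_linear[OF sublinear_ray_reduction[OF p]] by blast
  have le: "g x \<le> p x" for x
    using g(2)[of x] ray_reduction_le[OF p, of 0 x0 x] by simp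
  have "g (- x0) \<le> p (- x0 + 1 *\<^sub>R x0) - 1 * p x0"
    using g(2)[of "- x0"] ray_reduction_le[OF p, of 1 x0 "- x0"] by linarith
  then have "p x0 \<le> g x0"
    using sublinear_zero[OF p] linear_neg[OF g(1), of x0] by simp
  with le[of x0] have "g x0 = p x0" by simp
  with g(1) le show ?thesis by (rule that)
qed

subsection \<open>Complex scalars and complex functionals\<close>

lemma complex_normed_scaleR: "r *\<^sub>R (x::'a::complex_normed_vector) = complex_of_real r *\<^sub>C x"
  by (simp add: scaleC_of_real)

lemma scaleC_one [simp]: "1 *\<^sub>C (x::'a::complex_normed_vector) = x"
  using scaleC_of_real[of 1 x] by simp

lemma scaleC_zero_left [simp]: "0 *\<^sub>C (x::'a::complex_normed_vector) = 0"
  using scaleC_of_real[of 0 x] by simp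

lemma scaleC_zero_right [simp]: "c *\<^sub>C (0::'a::complex_normed_vector) = 0"
  using scaleC_scaleC[of c 0 "0::'a"] by simp

lemma scaleC_minus_left [simp]: "(- c) *\<^sub>C (x::'a::complex_normed_vector) = - (c *\<^sub>C x)"
  using scaleC_add_left[of "- c" c x] by (simp add: eq_neg_iff_add_eq_0)

lemma scaleC_minus_right [simp]: "c *\<^sub>C (- x::'a::complex_normed_vector) = - (c *\<^sub>C x)"
  using scaleC_add_right[of c "- x" x] by (simp add: eq_neg_iff_add_eq_0)

lemma scaleC_diff_right: "c *\<^sub>C (x - y::'a::complex_normed_vector) = c *\<^sub>C x - c *\<^sub>C y"
  using scaleC_add_right[of c x "- y"] by simp

lemma scaleC_diff_left: "(c - d) *\<^sub>C (x::'a::complex_normed_vector) = c *\<^sub>C x - d *\<^sub>C x"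
  using scaleC_add_left[of c "- d" x] by simp

lemma scaleC_scaleR_commute: "c *\<^sub>C (r *\<^sub>R x) = r *\<^sub>R (c *\<^sub>C (x::'a::complex_normed_vector))"
  by (simp add: complex_normed_scaleR scaleC_scaleC mult.commute)

lemma bounded_bilinear_scaleC:
  "bounded_bilinear (scaleC :: complex \<Rightarrow> 'a \<Rightarrow> 'a::complex_normed_vector)"
proof
  fix a a' :: complex and b b' :: 'a and r :: real
  show "(a + a') *\<^sub>C b = a *\<^sub>C b + a' *\<^sub>C b" by (rule scaleC_add_left)
  show "a *\<^sub>C (b + b') = a *\<^sub>C b + a *\<^sub>C b'" by (rule scaleC_add_right)
  show "(r *\<^sub>R a) *\<^sub>C b = r *\<^sub>R a *\<^sub>C b"
    by (simp add: complex_normed_scaleR scaleC_scaleC scaleC_complex_def)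
  show "a *\<^sub>C (r *\<^sub>R b) = r *\<^sub>R a *\<^sub>C b" by (rule scaleC_scaleR_commute)
  show "\<exists>K. \<forall>a b. norm (a *\<^sub>C b :: 'a) \<le> norm a * norm b * K"
    by (rule exI[of _ 1]) (simp add: norm_scaleC)
qed

lemmas tendsto_scaleC = bounded_bilinear.tendsto[OF bounded_bilinear_scaleC]
lemmas bounded_linear_scaleC_right = bounded_bilinear.bounded_linear_right[OF bounded_bilinear_scaleC]

lemma bounded_clinearI:
  assumes "\<And>x y. f (x + y) = f x + f y" "\<And>c x. f (c *\<^sub>C x) = c *\<^sub>C f x" "\<And>x. norm (f x) \<le> norm x * K"
  shows "bounded_clinear f"
  using assms by (auto simp: bounded_clinear_def clinear_def)

text \<open>
  The complex functional is \<open>g x - \<i> g (\<i> x)\<close>; a phase factor on \<open>x\<close> compares its modulus with \<open>g\<close>.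
\<close>

lemma complexify_functional:
  fixes g :: "'a::complex_normed_vector \<Rightarrow> real"
  assumes g: "linear g" and K0: "0 \<le> K" and K: "\<And>x. g x \<le> K * norm x"
  obtains f :: "'a cdual" where "\<And>x. Re (cdual_apply f x) = g x" "norm f \<le> K"
proof -
  define F where "F x = Complex (g x) (- g (\<i> *\<^sub>C x))" for x
  have ab: "\<bar>g x\<bar> \<le> K * norm x" for x
    using K[of x] K[of "- x"] linear_neg[OF g, of x] by auto
  have add: "F (x + y) = F x + F y" for x y
    by (simp add: F_def linear_add[OF g] scaleC_add_right complex_eq_iff)
  have re: "F (r *\<^sub>R x) = r * F x" for r x
    by (simp add: F_def linear_scale[OF g] scaleC_scaleR_commute complex_eq_iff)
  have im: "F (\<i> *\<^sub>C x) = \<i> * F x" for x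
    by (simp add: F_def scaleC_scaleC complex_eq_iff linear_neg[OF g])
  have sc: "F (c *\<^sub>C x) = c * F x" for c x
  proof -
    have "c *\<^sub>C x = Re c *\<^sub>R x + Im c *\<^sub>R (\<i> *\<^sub>C x)"
      unfolding complex_normed_scaleR scaleC_scaleC scaleC_add_left[symmetric]
      by (metis complex_eq mult.commute)
    then have "F (c *\<^sub>C x) = Re c * F x + Im c * (\<i> * F x)" by (simp only: add re im)
    also have "\<dots> = (Re c + \<i> * Im c) * F x" by (simp add: algebra_simps)
    also have "\<dots> = c * F x" by (simp only: complex_eq[symmetric])
    finally show ?thesis .
  qed
  have nF: "norm (F x) \<le> K * norm x" for x
  proof (cases "F x = 0")
    case True
    then show ?thesis using order_trans[OF abs_ge_zero ab[of x]] by simp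
  next
    case False
    define u where "u = cnj (F x) / norm (F x)"
    have nu: "norm u = 1" using False by (simp add: u_def norm_divide)
    have "u * F x = norm (F x)"
      using False by (simp add: u_def complex_norm_square[symmetric] mult.commute power2_eq_square)
    then have "norm (F x) = Re (F (u *\<^sub>C x))" by (simp add: sc)
    also have "\<dots> \<le> K * norm (u *\<^sub>C x)" using K by (simp add: F_def)
    finally show ?thesis by (simp add: norm_scaleC nu)
  qed
  have bc: "bounded_clinear F"
    using nF by (intro bounded_clinearI[of _ K] add) (auto simp: sc scaleC_complex_def mult.commute)
  have "norm (Cdual F) \<le> K"
    unfolding norm_cdual.rep_eq by (subst Cdual_inverse) (auto simp: bc nF K0 intro: onorm_bound)
  moreover have "Re (cdual_apply (Cdual F) x) = g x" for x
    by (subst Cdual_inverse) (auto simp: bc F_def)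
  ultimately show ?thesis by (intro that)
qed

lemma sublinear_norm: "sublinear (norm :: 'a::real_normed_vector \<Rightarrow> real)"
  by (simp add: sublinear_def norm_triangle_ineq)

lemma norming_functional:
  fixes x :: "'a::complex_normed_vector"
  obtains f :: "'a cdual" where "Re (cdual_apply f x) = norm x" "norm f \<le> 1"
proof -
  obtain g where g: "linear g" "\<And>x::'a. g x \<le> norm x" "g x = norm x"
    using Hahn_Banach_dominated[OF sublinear_norm] by blast
  obtain f :: "'a cdual" where "\<And>x. Re (cdual_apply f x) = g x" "norm f \<le> 1"
    using complexify_functional[OF g(1), of 1] g(2) by auto
  with g(3) show ?thesis by (intro that) auto
qed

lemma norm_cdual_apply: "norm (cdual_apply f x) \<le> norm f * norm x"
  unfolding norm_cdual.rep_eq by (rule onorm) (rule cdual_apply_bounded_linear)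

lemma cdual_scaleC: "cdual_apply f (c *\<^sub>C x) = c * cdual_apply f x"
  using cdual_apply[of f] by (auto simp: bounded_clinear_iff scaleC_complex_def)

lemmas cdual_add = linear_add[OF bounded_linear.linear[OF cdual_apply_bounded_linear]]
lemmas cdual_diff = linear_diff[OF bounded_linear.linear[OF cdual_apply_bounded_linear]]
lemmas cdual_neg = linear_neg[OF bounded_linear.linear[OF cdual_apply_bounded_linear]]
lemmas cdual_zero = linear_0[OF bounded_linear.linear[OF cdual_apply_bounded_linear]]
lemmas cdual_scaleR = linear_scale[OF bounded_linear.linear[OF cdual_apply_bounded_linear]]

lemma norm_cdual_le: "0 \<le> K \<Longrightarrow> (\<And>x. norm (cdual_apply f x) \<le> K * norm x) \<Longrightarrow> norm f \<le> K"
  unfolding norm_cdual.rep_eq by (rule onorm_bound)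

lemma cdual_eqI: "(\<And>x. cdual_apply f x = cdual_apply g x) \<Longrightarrow> f = g"
  by (metis cdual_apply_inject ext)

subsection \<open>Uniform boundedness\<close>

text \<open>
  The gliding hump without Baire's theorem: on every ball of radius \<open>r\<close> a bounded operator
  attains norms close to \<open>r\<close> times its operator norm, whatever the centre.
\<close>

lemma bounded_linear_large_on_ball:
  fixes f :: "'a::real_normed_vector \<Rightarrow> 'b::real_normed_vector"
  assumes f: "bounded_linear f" and r: "0 < r" and c: "0 \<le> c" "c < onorm f"
  shows "\<exists>y. norm (y - x) \<le> r \<and> r * c \<le> norm (f y)"
proof (rule ccontr)
  assume "\<not> ?thesis"
  then have lt: "norm (f y) < r * c" if "norm (y - x) \<le> r" for y using that by force
  have "norm (f z) \<le> c * norm z" for z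
  proof (cases "z = 0")
    case True
    then show ?thesis using linear_0[OF bounded_linear.linear[OF f]] by simp
  next
    case False
    define w where "w = (r / norm z) *\<^sub>R z"
    have w: "norm w = r" using False r by (simp add: w_def)
    have "2 *\<^sub>R f w = f (x + w) - f (x - w)"
      by (simp add: linear_add[OF bounded_linear.linear[OF f]] linear_diff[OF bounded_linear.linear[OF f]]
          scaleR_2)
    then have "2 * norm (f w) \<le> norm (f (x + w)) + norm (f (x - w))"
      by (metis norm_scaleR norm_triangle_ineq4 abs_numeral)
    also have "\<dots> \<le> 2 * (r * c)"
      using lt[of "x + w"] lt[of "x - w"] w by simp
    finally have "norm (f w) \<le> r * c" by simp
    then show ?thesis
      using False r by (simp add: w_def linear_scale[OF bounded_linear.linear[OF f]] field_simps)
  qed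
  then have "onorm f \<le> c" using c(1) by (intro onorm_bound)
  with c(2) show False by simp
qed

text \<open>
  Norms growing like \<open>4\<^sup>n\<close> beat steps of length \<open>3\<^sup>-\<^sup>n\<close>: the limit of the steps stays within
  \<open>1/2 \<cdot> 3\<^sup>-\<^sup>n\<close> of the point at which the \<open>n\<close>-th operator is large.
\<close>

theorem uniform_boundedness:
  fixes F :: "('a::banach \<Rightarrow> 'b::real_normed_vector) set"
  assumes F: "\<And>f. f \<in> F \<Longrightarrow> bounded_linear f"
    and pt: "\<And>x. \<exists>B. \<forall>f\<in>F. norm (f x) \<le> B"
  shows "\<exists>M. \<forall>f\<in>F. onorm f \<le> M"
proof (rule ccontr)
  assume "\<not> ?thesis"
  then have "\<forall>n::nat. \<exists>f\<in>F. 4 ^ n < onorm f" by (meson not_le)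
  then obtain f where f: "\<And>n. f n \<in> F" "\<And>n::nat. 4 ^ n < onorm (f n)" by metis
  have "\<exists>x. \<forall>n. norm (x (Suc n) - x n) \<le> (1/3)^n \<and> (1/3)^n * (3/4 * onorm (f n)) \<le> norm (f n (x (Suc n)))"
  proof (rule dependent_nat_choice[where P = "\<lambda>_ _. True", simplified])
    fix x n
    have "(0::real) < 4 ^ n" by simp
    then have "0 < onorm (f n)" using f(2)[of n] by linarith
    then have "3/4 * onorm (f n) < onorm (f n)" by simp
    then show "\<exists>y. norm (y - x) \<le> (1/3)^n \<and> (1/3)^n * (3/4 * onorm (f n)) \<le> norm (f n y)"
      by (intro bounded_linear_large_on_ball F f(1)) auto
  qed
  then obtain x where step: "\<And>n. norm (x (Suc n) - x n) \<le> (1/3)^n"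
    and big: "\<And>n. (1/3)^n * (3/4 * onorm (f n)) \<le> norm (f n (x (Suc n)))" by blast
  have dist: "norm (x (n + m) - x n) \<le> 3/2 * (1/3)^n" for n m
  proof -
    have "norm (x (n + m) - x n) \<le> (3/2) * ((1/3)^n - (1/3)^(n+m))"
    proof (induction m)
      case (Suc m)
      have "norm (x (n + Suc m) - x n) \<le> norm (x (Suc (n+m)) - x (n+m)) + norm (x (n+m) - x n)"
        by (metis add_Suc_right norm_triangle_ineq diff_add_cancel add_diff_eq)
      also have "\<dots> \<le> (1/3)^(n+m) + 3/2 * ((1/3)^n - (1/3)^(n+m))"
        by (rule add_mono[OF step Suc.IH])
      also have "\<dots> = 3/2 * ((1/3)^n - (1/3)^(n + Suc m))" by (simp add: right_diff_distrib)
      finally show ?case .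
    qed simp
    also have "3/2 * ((1/3)^n - (1/3)^(n+m)) \<le> 3/2 * (1/3::real)^n"
      by (intro mult_left_mono) auto
    finally show ?thesis .
  qed
  have lim0: "(\<lambda>n. 3/2 * (1/3::real)^n) \<longlonglongrightarrow> 0"
    by (intro tendsto_mult_right_zero LIMSEQ_power_zero) auto
  have "Cauchy x"
  proof (rule metric_CauchyI)
    fix e :: real assume "0 < e"
    then obtain N where N: "3/2 * (1/3::real)^N < e / 2"
      using order_tendstoD(2)[OF lim0, of "e/2"] by (auto simp: eventually_sequentially)
    have "dist (x m) (x n) < e" if "m \<ge> N" "n \<ge> N" for m n
    proof -
      have "norm (x m - x N) < e/2" "norm (x n - x N) < e/2"
        using dist[of N "m - N"] dist[of N "n - N"] N that by auto
      then show ?thesis unfolding dist_norm using norm_diff_triangle_less[of "x m" "x N" "e/2" "x n" "e/2"]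
        by (simp add: norm_minus_commute)
    qed
    then show "\<exists>M. \<forall>m\<ge>M. \<forall>n\<ge>M. dist (x m) (x n) < e" by blast
  qed
  then obtain z where z: "x \<longlonglongrightarrow> z" by (auto simp: Cauchy_convergent_iff convergent_def)
  have zn: "norm (z - x n) \<le> 3/2 * (1/3)^n" for n
  proof (rule Lim_bounded)
    show "(\<lambda>m. norm (x m - x n)) \<longlonglongrightarrow> norm (z - x n)"
      by (intro tendsto_intros z)
    show "\<forall>m\<ge>n. norm (x m - x n) \<le> 3/2 * (1/3)^n"
      using dist[of n] by (metis le_iff_add)
  qed
  obtain B where B: "\<And>n. norm (f n z) \<le> B" using pt[of z] f(1) by blast
  have "(4/3)^n \<le> 4 * B" for n
  proof -
    have lin: "linear (f n)" using F[OF f(1)] by (rule bounded_linear.linear)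
    have "norm (f n (z - x (Suc n))) \<le> onorm (f n) * norm (z - x (Suc n))"
      by (rule onorm[OF F[OF f(1)]])
    also have "\<dots> \<le> onorm (f n) * (3/2 * (1/3)^Suc n)"
      by (intro mult_left_mono zn onorm_pos_le F f(1))
    finally have "norm (f n z - f n (x (Suc n))) \<le> onorm (f n) * (1/2 * (1/3)^n)"
      by (simp add: linear_diff[OF lin])
    moreover have "norm (f n (x (Suc n))) \<le> norm (f n z) + norm (f n z - f n (x (Suc n)))"
      by (metis norm_triangle_sub norm_minus_commute)
    ultimately have "(1/3)^n * (1/4 * onorm (f n)) \<le> B"
      using big[of n] B[of n] by (simp add: algebra_simps)
    moreover have "(1/3)^n * (1/4 * 4^n) \<le> (1/3)^n * (1/4 * onorm (f n))"
      using f(2)[of n] by (intro mult_left_mono) auto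
    ultimately show ?thesis by (simp add: power_divide)
  qed
  moreover obtain n where "4 * B < (4/3::real)^n" using real_arch_pow[of "4/3" "4*B"] by auto
  ultimately show False by (meson not_le)
qed

section \<open>Complex Banach algebras\<close>

text \<open>
  The condition \<open>0 \<noteq> 1\<close> is left out, so that the bounded operators on the zero space are covered.
\<close>

class complex_banach_algebra = real_normed_algebra + complex_banach + monoid_mult +
  assumes mult_scaleC_left: "(c *\<^sub>C x) * y = c *\<^sub>C (x * y)"
    and mult_scaleC_right: "x * (c *\<^sub>C y) = c *\<^sub>C (x * y)"

definition inverses :: "'a::complex_banach_algebra \<Rightarrow> 'a \<Rightarrow> bool"
  where "inverses a b \<longleftrightarrow> a * b = 1 \<and> b * a = 1"

definition has_inverse :: "'a::complex_banach_algebra \<Rightarrow> bool"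
  where "has_inverse a \<longleftrightarrow> (\<exists>b. inverses a b)"

lemma inverses_unique: "inverses a b \<Longrightarrow> inverses a c \<Longrightarrow> b = c"
  unfolding inverses_def by (metis mult.assoc mult_1_left mult_1_right)

lemma inverses_mult:
  assumes "inverses a b" "inverses c d"
  shows "inverses (a * c) (d * b)"
proof -
  have "a * c * (d * b) = a * (c * d) * b" "d * b * (a * c) = d * (b * a) * c"
    by (simp_all only: mult.assoc)
  then show ?thesis using assms by (simp add: inverses_def)
qed

lemma has_inverse_mult: "has_inverse a \<Longrightarrow> has_inverse b \<Longrightarrow> has_inverse (a * b)"
  unfolding has_inverse_def using inverses_mult by blast

lemma inverses_commute:
  assumes "inverses a b" "a * c = c * a"
  shows "b * c = c * b"
proof -
  have "b * c = b * c * (a * b)" using assms(1) by (simp add: inverses_def)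
  also have "\<dots> = b * (a * c) * b" using assms(2) by (simp add: mult.assoc)
  also have "\<dots> = (b * a) * c * b" by (simp only: mult.assoc)
  also have "\<dots> = c * b" using assms(1) by (simp add: inverses_def)
  finally show ?thesis .
qed

lemma has_inverse_commuting_factor:
  assumes "has_inverse (a * b)" "a * b = b * a"
  shows "has_inverse a"
proof -
  obtain c where c: "inverses (a * b) c" using assms(1) by (auto simp: has_inverse_def)
  have "inverses a (b * c)"
    unfolding inverses_def
  proof
    show "a * (b * c) = 1" using c by (simp add: inverses_def mult.assoc)
    have "a * b * a = a * (a * b)"
      using arg_cong[OF assms(2), of "(*) a"] by (simp only: mult.assoc)
    then have "c * a = a * c" by (rule inverses_commute[OF c])
    then have "b * c * a = b * a * c" by (simp add: mult.assoc)
    also have "\<dots> = 1" using c assms(2) by (simp add: inverses_def)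
    finally show "b * c * a = 1" .
  qed
  then show ?thesis by (auto simp: has_inverse_def)
qed

lemma inverses_scaleC:
  "inverses a b \<Longrightarrow> c \<noteq> 0 \<Longrightarrow> inverses (c *\<^sub>C a) (inverse c *\<^sub>C b)"
  by (simp add: inverses_def mult_scaleC_left mult_scaleC_right scaleC_scaleC)

lemma has_inverse_scaleC_iff:
  assumes "c \<noteq> 0"
  shows "has_inverse (c *\<^sub>C a) \<longleftrightarrow> has_inverse a"
proof
  assume "has_inverse (c *\<^sub>C a)"
  then obtain b where "inverses (c *\<^sub>C a) b" by (auto simp: has_inverse_def)
  from inverses_scaleC[OF this, of "inverse c"] assms show "has_inverse a"
    by (auto simp: has_inverse_def scaleC_scaleC)
qed (use assms inverses_scaleC in \<open>unfold has_inverse_def, blast\<close>)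

lemma scaleC_power: "(c *\<^sub>C (a::'a::complex_banach_algebra)) ^ n = c ^ n *\<^sub>C a ^ n"
  by (induction n) (auto simp: mult_scaleC_left mult_scaleC_right scaleC_scaleC mult.commute)

lemma norm_power_Suc_le: "norm ((a::'a::complex_banach_algebra) ^ Suc n) \<le> norm a ^ Suc n"
proof (induction n)
  case (Suc n)
  have "norm (a ^ Suc (Suc n)) \<le> norm a * norm (a ^ Suc n)"
    by (simp only: power_Suc[of a "Suc n"] norm_mult_ineq)
  also have "\<dots> \<le> norm a * norm a ^ Suc n" by (intro mult_left_mono Suc) auto
  finally show ?case by simp
qed simp

lemma one_minus_power:
  "(\<Sum>j<n. x ^ j) * (1 - x) = 1 - (x::'a::complex_banach_algebra) ^ n"
proof (induction n)
  case (Suc n)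
  have "(\<Sum>j<Suc n. x ^ j) * (1 - x) = (1 - x ^ n) + x ^ n * (1 - x)"
    using Suc by (simp add: distrib_right)
  also have "\<dots> = 1 - x ^ Suc n" by (simp add: right_diff_distrib power_Suc2 del: power_Suc)
  finally show ?case .
qed simp

lemma Neumann:
  fixes a :: "'a::complex_banach_algebra"
  assumes s: "summable (\<lambda>n. norm (a ^ n))"
  shows "inverses (1 - a) (\<Sum>n. a ^ n)"
proof -
  have sm: "summable (\<lambda>n. a ^ n)" by (rule summable_norm_cancel[OF s])
  have split: "(\<Sum>n. a ^ n) = (\<Sum>n. a ^ Suc n) + 1"
    using suminf_split_head[OF sm] by simp
  have "a * (\<Sum>n. a ^ n) = (\<Sum>n. a ^ Suc n)"
    using suminf_mult[OF sm, of a] by simp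
  moreover have "(\<Sum>n. a ^ n) * a = (\<Sum>n. a ^ Suc n)"
    using suminf_mult2[OF sm, of a] by (simp add: power_commutes)
  ultimately show ?thesis using split by (simp add: inverses_def algebra_simps)
qed

lemma has_inverse_one_minus:
  fixes a :: "'a::complex_banach_algebra"
  assumes "norm a < 1"
  shows "has_inverse (1 - a)"
proof -
  have "summable (\<lambda>n. norm (a ^ n))"
  proof (rule summable_comparison_test)
    show "\<exists>N. \<forall>n\<ge>N. norm (norm (a ^ n)) \<le> norm a ^ n"
    proof (intro exI[of _ 1] allI impI)
      fix n :: nat assume "1 \<le> n"
      then show "norm (norm (a ^ n)) \<le> norm a ^ n"
        using norm_power_Suc_le[of a "n - 1"] by simp
    qed
  qed (use assms in \<open>auto intro: summable_geometric\<close>)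
  from Neumann[OF this] show ?thesis by (auto simp: has_inverse_def)
qed

lemma has_inverse_scaleC_one_minus:
  fixes a :: "'a::complex_banach_algebra"
  assumes "norm a < cmod l"
  shows "has_inverse (l *\<^sub>C 1 - a)"
proof -
  have l: "l \<noteq> 0" using assms norm_ge_zero[of a] by (metis norm_zero not_le)
  have "has_inverse (1 - inverse l *\<^sub>C a)"
  proof (rule has_inverse_one_minus)
    have "norm (inverse l *\<^sub>C a) = norm a / cmod l"
      by (simp add: norm_scaleC norm_inverse divide_inverse mult.commute)
    also have "\<dots> < 1" using assms l by simp
    finally show "norm (inverse l *\<^sub>C a) < 1" .
  qed
  then have "has_inverse (l *\<^sub>C (1 - inverse l *\<^sub>C a))"
    by (simp add: has_inverse_scaleC_iff l)
  then show ?thesis by (simp add: scaleC_diff_right scaleC_scaleC l)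
qed

text \<open>
  Only the convergence \<open>f \<rightarrow> a\<close> is given; that the inverses stay bounded follows from
  \<open>g - b = g (a - f) b\<close>.
\<close>

lemma tendsto_inverses:
  fixes f g :: "'b \<Rightarrow> 'a::complex_banach_algebra"
  assumes f: "(f \<longlongrightarrow> a) F" and g: "eventually (\<lambda>x. inverses (f x) (g x)) F" and b: "inverses a b"
  shows "(g \<longlongrightarrow> b) F"
proof -
  have f0: "((\<lambda>x. norm (a - f x)) \<longlongrightarrow> 0) F"
    using tendsto_norm_zero[OF LIM_zero[OF f]] by (simp add: norm_minus_commute)
  then have "((\<lambda>x. norm (a - f x) * norm b) \<longlongrightarrow> 0) F"
    by (rule tendsto_mult_left_zero)
  then have small: "eventually (\<lambda>x. norm (a - f x) * norm b < 1/2) F"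
    by (rule order_tendstoD) simp
  have bound: "((\<lambda>x. norm (a - f x) * (2 * norm b * norm b)) \<longlongrightarrow> 0) F"
    by (rule tendsto_mult_left_zero[OF f0])
  have "((\<lambda>x. g x - b) \<longlongrightarrow> 0) F"
  proof (rule Lim_null_comparison[OF _ bound])
    show "\<forall>\<^sub>F x in F. norm (g x - b) \<le> norm (a - f x) * (2 * norm b * norm b)"
      using small g
    proof eventually_elim
      case (elim x)
      have eq: "g x - b = g x * (a - f x) * b"
      proof -
        have "g x * (a - f x) * b = g x * (a * b) - (g x * f x) * b"
          by (simp add: algebra_simps)
        then show ?thesis using elim(2) b by (simp add: inverses_def)
      qed
      have "norm (g x - b) \<le> norm (g x * (a - f x)) * norm b" unfolding eq by (rule norm_mult_ineq)
      also have "\<dots> \<le> norm (g x) * norm (a - f x) * norm b"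
        by (intro mult_right_mono norm_mult_ineq) auto
      finally have le: "norm (g x - b) \<le> norm (g x) * (norm (a - f x) * norm b)" by (simp add: mult.assoc)
      also have "\<dots> \<le> norm (g x) * (1/2)" using elim(1) by (intro mult_left_mono) auto
      finally have "norm (g x) \<le> 2 * norm b"
        using norm_triangle_sub[of "g x" b] by simp
      then have "norm (g x) * (norm (a - f x) * norm b) \<le> 2 * norm b * (norm (a - f x) * norm b)"
        by (intro mult_right_mono) auto
      with le show ?case by (simp add: algebra_simps)
    qed
  qed
  then show ?thesis by (simp add: LIM_zero_iff)
qed

lemma sum_powers_of_roots_of_unity:
  fixes n j :: nat
  assumes "j < n"
  defines "w \<equiv> exp (2 * of_real pi * \<i> / of_nat n)"
  shows "(\<Sum>k<n. (w ^ k) ^ j) = (if j = 0 then of_nat n else (0::complex))"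
proof (cases "j = 0")
  case False
  have wj: "w ^ j = exp (2 * of_real pi * \<i> * of_nat j / of_nat n)"
    unfolding w_def by (simp add: exp_of_nat_mult[symmetric] mult_ac)
  have n: "1 \<le> n" using assms by simp
  have "w ^ j \<noteq> 1"
    unfolding wj using complex_root_unity_eq_1[OF n, of j] False assms(1) by (auto dest: dvd_imp_le)
  moreover have "(w ^ j) ^ n = 1"
    unfolding wj by (rule complex_root_unity) (use n in simp)
  moreover have "(\<Sum>k<n. (w ^ k) ^ j) = (\<Sum>k<n. (w ^ j) ^ k)"
    by (simp add: power_mult[symmetric] mult.commute)
  ultimately show ?thesis using False by (simp add: geometric_sum)
qed simp

text \<open>
  The average of \<open>(1 - z a)\<inverse>\<close> over the \<open>n\<close> rotations of \<open>z\<close> keeps only the powers of \<open>a\<close> divisible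
  by \<open>n\<close>, so it is the inverse of \<open>1 - (z a)\<^sup>n\<close>.
\<close>

lemma inverse_average_over_roots_of_unity:
  fixes a :: "'a::complex_banach_algebra" and n :: nat
  assumes n: "0 < n"
  defines "w \<equiv> exp (2 * of_real pi * \<i> / of_nat n)"
  assumes G: "\<And>k. k < n \<Longrightarrow> inverses (1 - (w ^ k * z) *\<^sub>C a) (G k)"
  shows "(1 - (z *\<^sub>C a) ^ n) * (\<Sum>k<n. G k) = of_nat n *\<^sub>C 1"
proof -
  have wn: "(w ^ k) ^ n = 1" for k
  proof -
    have "w ^ n = 1" unfolding w_def using complex_root_unity[of n 1] n by simp
    then show ?thesis by (metis mult.commute power_mult power_one)
  qed
  have "(1 - (z *\<^sub>C a) ^ n) * G k = (\<Sum>j<n. ((w ^ k) ^ j * z ^ j) *\<^sub>C a ^ j)" if k: "k < n" for k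
  proof -
    let ?x = "(w ^ k * z) *\<^sub>C a"
    have "(z *\<^sub>C a) ^ n = ?x ^ n" by (simp add: scaleC_power power_mult_distrib wn)
    then have "(1 - (z *\<^sub>C a) ^ n) * G k = (\<Sum>j<n. ?x ^ j) * ((1 - ?x) * G k)"
      by (simp add: one_minus_power[symmetric] mult.assoc)
    also have "\<dots> = (\<Sum>j<n. ?x ^ j)" using G[OF k] by (simp add: inverses_def)
    finally show ?thesis by (simp add: scaleC_power power_mult_distrib)
  qed
  then have "(1 - (z *\<^sub>C a) ^ n) * (\<Sum>k<n. G k) = (\<Sum>k<n. \<Sum>j<n. ((w ^ k) ^ j * z ^ j) *\<^sub>C a ^ j)"
    by (simp add: sum_distrib_left)
  also have "\<dots> = (\<Sum>j<n. ((\<Sum>k<n. (w ^ k) ^ j) * z ^ j) *\<^sub>C a ^ j)"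
    by (subst sum.swap)
      (simp add: sum_distrib_right bounded_bilinear.sum_left[OF bounded_bilinear_scaleC])
  also have "\<dots> = (\<Sum>j<n. if j = 0 then of_nat n *\<^sub>C 1 else 0)"
    using sum_powers_of_roots_of_unity[of _ n] by (intro sum.cong) (auto simp: w_def)
  also have "\<dots> = of_nat n *\<^sub>C 1" using n by (simp add: sum.delta)
  finally show ?thesis .
qed

text \<open>
  Rickart's proof of the spectral radius formula, which avoids vector-valued complex analysis.  The
  inverses of \<open>1 - z a\<close> depend uniformly continuously on \<open>z\<close> in the closed disc, hence the averages
  over rotations at radius \<open>r\<close> and at a slightly smaller radius \<open>s\<close> are close, uniformly in \<open>n\<close>.
  At radius \<open>s\<close> they tend to \<open>1\<close>; so at radius \<open>r\<close> they are near \<open>1\<close> for large \<open>n\<close>, which makes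
  \<open>(r a)\<^sup>n\<close> small.
\<close>

theorem spectral_radius_attained:
  fixes a :: "'a::complex_banach_algebra"
  assumes r: "0 < r"
    and inv: "\<And>z. cmod z \<le> r \<Longrightarrow> has_inverse (1 - z *\<^sub>C a)"
    and lim: "\<And>s. 0 \<le> s \<Longrightarrow> s < r \<Longrightarrow> (\<lambda>n. s ^ n * norm (a ^ n)) \<longlonglongrightarrow> 0"
  shows "\<exists>n\<ge>1. r ^ n * norm (a ^ n) < 1"
proof -
  obtain G where G: "\<And>z. cmod z \<le> r \<Longrightarrow> inverses (1 - z *\<^sub>C a) (G z)"
    using inv unfolding has_inverse_def by metis
  have "continuous_on (cball 0 r) G"
    unfolding continuous_on_def
  proof
    fix z assume z: "z \<in> cball (0::complex) r"
    show "(G \<longlongrightarrow> G z) (at z within cball 0 r)"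
    proof (rule tendsto_inverses)
      show "((\<lambda>x. 1 - x *\<^sub>C a) \<longlongrightarrow> 1 - z *\<^sub>C a) (at z within cball 0 r)"
        by (intro tendsto_intros tendsto_scaleC)
      show "\<forall>\<^sub>F x in at z within cball 0 r. inverses (1 - x *\<^sub>C a) (G x)"
        using G by (auto simp: eventually_at_filter)
    qed (use z G in auto)
  qed
  then have "uniformly_continuous_on (cball 0 r) G"
    by (rule compact_uniformly_continuous) simp
  then obtain d where d: "0 < d"
    "\<And>x y. x \<in> cball 0 r \<Longrightarrow> y \<in> cball 0 r \<Longrightarrow> dist y x < d \<Longrightarrow> dist (G y) (G x) < 1/8"
    unfolding uniformly_continuous_on_def by (metis zero_less_divide_1_iff zero_less_numeral)
  define s where "s = max 0 (r - d / 2)"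
  have s: "0 \<le> s" "s < r" "r - s < d" using r d(1) by (auto simp: s_def)
  define H where "H n z = inverse (of_nat n) *\<^sub>C (\<Sum>k<n. G (exp (2 * of_real pi * \<i> / of_nat n) ^ k * z))"
    for n :: nat and z :: complex
  have nw: "cmod (exp (2 * of_real pi * \<i> / of_nat n) ^ k * z) = cmod z" for n k :: nat and z
    by (simp add: norm_mult norm_power norm_exp_eq_Re)
  have H: "(1 - (z *\<^sub>C a) ^ n) * H n z = 1" if "0 < n" "cmod z \<le> r" for n z
  proof -
    have "(1 - (z *\<^sub>C a) ^ n) * (\<Sum>k<n. G (exp (2 * of_real pi * \<i> / of_nat n) ^ k * z)) = of_nat n *\<^sub>C 1"
      by (rule inverse_average_over_roots_of_unity) (use that G nw in auto)
    then show ?thesis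
      using that(1) by (simp add: H_def mult_scaleC_right scaleC_scaleC)
  qed
  have close: "norm (H n (of_real r) - H n (of_real s)) \<le> 1/8" if n: "0 < n" for n
  proof -
    let ?w = "\<lambda>k. exp (2 * of_real pi * \<i> / of_nat n) ^ k"
    have "norm (H n (of_real r) - H n (of_real s)) =
        inverse (real n) * norm (\<Sum>k<n. G (?w k * of_real r) - G (?w k * of_real s))"
      unfolding H_def scaleC_diff_right[symmetric] norm_scaleC sum_subtractf[symmetric]
      by (simp add: norm_inverse)
    also have "\<dots> \<le> inverse (real n) * (\<Sum>k<n. 1/8)"
    proof (intro mult_left_mono sum_norm_le)
      fix k assume "k \<in> {..<n}"
      have "dist (?w k * of_real r) (?w k * of_real s) = norm (?w k * of_real (r - s))"
        by (simp add: dist_norm right_diff_distrib)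
      also have "\<dots> = r - s" using nw[of n k "of_real (r - s)"] s by (simp add: of_real_diff[symmetric] del: of_real_diff)
      finally show "norm (G (?w k * of_real r) - G (?w k * of_real s)) \<le> 1/8"
        unfolding dist_norm[symmetric] using s r nw by (intro less_imp_le d(2)) auto
    qed auto
    also have "\<dots> = 1/8" using n by simp
    finally show ?thesis .
  qed
  obtain N where N: "\<And>n. n \<ge> N \<Longrightarrow> s ^ n * norm (a ^ n) < 1 / (16 * (1 + norm (1::'a)))"
    using order_tendstoD(2)[OF lim[OF s(1,2)], of "1 / (16 * (1 + norm (1::'a)))"]
    by (auto simp: eventually_sequentially add_pos_nonneg)
  define n where "n = Suc N"
  have n: "0 < n" "s ^ n * norm (a ^ n) < 1 / (16 * (1 + norm (1::'a)))" using N[of n] by (auto simp: n_def)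
  have solve: "norm (y - 1) \<le> norm x * (norm (y - 1) + norm (1::'a)) " if "(1 - x) * y = 1" for x y :: 'a
  proof -
    have "y - 1 = x * y" using that by (simp add: algebra_simps)
    also have "\<dots> = x * (y - 1) + x * 1" by (simp add: algebra_simps)
    finally have "norm (y - 1) \<le> norm (x * (y - 1)) + norm (x * 1)" by (metis norm_triangle_ineq)
    also have "\<dots> \<le> norm x * norm (y - 1) + norm x * norm (1::'a)" by (intro add_mono norm_mult_ineq)
    finally show ?thesis by (simp add: algebra_simps)
  qed
  define X Y where "X = (of_real s *\<^sub>C a) ^ n" and "Y = (of_real r *\<^sub>C a) ^ n"
  have nX: "norm X = s ^ n * norm (a ^ n)" and nY: "norm Y = r ^ n * norm (a ^ n)"
    using s(1) r by (simp_all add: X_def Y_def scaleC_power norm_scaleC norm_power)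
  have HX: "(1 - X) * H n (of_real s) = 1" and HY: "(1 - Y) * H n (of_real r) = 1"
    using H[OF n(1)] s(1,2) r by (auto simp: X_def Y_def)
  have one: "norm X * (1 + norm (1::'a)) < 1/16"
    using n(2) by (simp add: nX add_pos_nonneg field_simps)
  moreover have "0 \<le> norm X * norm (1::'a)" "0 \<le> norm X" by auto
  ultimately have X: "norm X \<le> 1/2" "norm X * norm (1::'a) \<le> 1/16"
    unfolding distrib_left by linarith+
  have "norm X * norm (H n (of_real s) - 1) \<le> 1/2 * norm (H n (of_real s) - 1)"
    using X(1) by (intro mult_right_mono) auto
  then have "norm (H n (of_real s) - 1) \<le> 1/8"
    using solve[OF HX] X(2) by (simp add: distrib_left)
  then have E: "norm (H n (of_real r) - 1) \<le> 1/4"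
    using close[OF n(1)] norm_triangle_ineq[of "H n (of_real r) - H n (of_real s)" "H n (of_real s) - 1"]
    by simp
  have "Y = (H n (of_real r) - 1) - Y * (H n (of_real r) - 1)"
    using HY by (simp add: algebra_simps)
  then have "norm Y \<le> norm (H n (of_real r) - 1) + norm (Y * (H n (of_real r) - 1))"
    by (metis norm_triangle_ineq4)
  also have "\<dots> \<le> 1/4 + norm Y * (1/4)"
    by (intro add_mono E order_trans[OF norm_mult_ineq] mult_left_mono) auto
  finally have "norm Y < 1" by simp
  then show ?thesis using n(1) by (intro exI[of _ n]) (auto simp: nY)
qed

section \<open>Order in unital C*-algebras\<close>

subsection \<open>Involution\<close>

lemma star_zero [simp]: "star 0 = (0::'a::cstar_algebra)"
  using star_add[of "0::'a" 0] by simp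

lemma star_minus: "star (- a) = - star (a::'a::cstar_algebra)"
  using star_add[of a "- a"] by (simp add: add_eq_0_iff)

lemma star_diff: "star (a - b) = star a - star (b::'a::cstar_algebra)"
  using star_add[of a "- b"] by (simp add: star_minus)

lemma star_scaleR: "star (r *\<^sub>R a) = r *\<^sub>R star (a::'a::cstar_algebra)"
  by (simp add: complex_normed_scaleR star_scaleC)

lemma norm_star [simp]: "norm (star a) = norm (a::'a::cstar_algebra)"
proof -
  have le: "norm b \<le> norm (star b)" for b :: 'a
  proof (cases "b = 0")
    case False
    have "norm b * norm b \<le> norm (star b) * norm b"
      using norm_mult_ineq[of "star b" b] by (simp add: cstar_identity power2_eq_square)
    then show ?thesis using False by simp
  qed simp
  show ?thesis using le[of a] le[of "star a"] by (simp add: star_star)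
qed

lemma bounded_linear_star: "bounded_linear (star :: 'a::cstar_algebra \<Rightarrow> 'a)"
  by (rule bounded_linear_intro[of _ 1]) (simp_all add: star_add star_scaleR)

lemma star_mult_eq_0D: "star a * a = 0 \<Longrightarrow> a = (0::'a::cstar_algebra)"
  using cstar_identity[of a] by simp

definition selfadjoint :: "'a::cstar_algebra \<Rightarrow> bool"
  where "selfadjoint a \<longleftrightarrow> star a = a"

lemma selfadjoint_intros [simp, intro]:
  fixes a b :: "'a::cstar_algebra"
  shows "selfadjoint 0"
    "selfadjoint a \<Longrightarrow> selfadjoint b \<Longrightarrow> selfadjoint (a + b)"
    "selfadjoint a \<Longrightarrow> selfadjoint b \<Longrightarrow> selfadjoint (a - b)"
    "selfadjoint a \<Longrightarrow> selfadjoint (- a)"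
    "selfadjoint a \<Longrightarrow> selfadjoint (r *\<^sub>R a)"
    "selfadjoint (a + star a)" "selfadjoint (star a * a)" "selfadjoint (a * star a)"
    "selfadjoint a \<Longrightarrow> selfadjoint (a * a)"
  by (simp_all add: selfadjoint_def star_add star_diff star_minus star_scaleR star_mult star_star add.commute)

lemma selfadjoint_conj: "selfadjoint k \<Longrightarrow> selfadjoint (star c * k * c)"
  by (simp add: selfadjoint_def star_mult star_star mult.assoc)

lemma selfadjoint_mult: "selfadjoint a \<Longrightarrow> selfadjoint b \<Longrightarrow> a * b = b * a \<Longrightarrow> selfadjoint (a * b)"
  by (simp add: selfadjoint_def star_mult)

lemma norm_selfadjoint_square: "selfadjoint a \<Longrightarrow> norm (a * a) = (norm a)\<^sup>2"
  using cstar_identity[of a] by (simp add: selfadjoint_def)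

definition re_part :: "'a::cstar_algebra \<Rightarrow> 'a"
  where "re_part a = (1/2) *\<^sub>R (a + star a)"

definition im_part :: "'a::cstar_algebra \<Rightarrow> 'a"
  where "im_part a = re_part (- \<i> *\<^sub>C a)"

lemma selfadjoint_re_part [simp, intro]: "selfadjoint (re_part a)"
  unfolding re_part_def by (intro selfadjoint_intros)

lemma selfadjoint_im_part [simp, intro]: "selfadjoint (im_part a)"
  unfolding im_part_def by (rule selfadjoint_re_part)

lemma cartesian_decomposition: "a = re_part a + \<i> *\<^sub>C im_part a"
proof -
  have "\<i> *\<^sub>C im_part a = (1/2) *\<^sub>R (\<i> *\<^sub>C (- (\<i> *\<^sub>C a)) + \<i> *\<^sub>C (\<i> *\<^sub>C star a))"
    by (simp add: im_part_def re_part_def star_scaleC star_minus scaleC_scaleR_commute scaleC_add_right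
        scaleC_diff_right)
  also have "\<dots> = (1/2) *\<^sub>R (a - star a)"
    by (simp add: scaleC_scaleC)
  finally have "re_part a + \<i> *\<^sub>C im_part a = (1/2) *\<^sub>R (a + star a) + (1/2) *\<^sub>R (a - star a)"
    by (simp add: re_part_def)
  also have "\<dots> = a" by (simp add: scaleR_add_right[symmetric] scaleR_2[symmetric])
  finally show ?thesis by simp
qed

lemma re_part_add: "re_part (a + b) = re_part a + re_part b"
  by (simp add: re_part_def star_add algebra_simps)

lemma re_part_scaleR: "re_part (r *\<^sub>R a) = r *\<^sub>R re_part a"
  by (simp add: re_part_def star_scaleR scaleR_add_right mult.commute)

lemma re_part_selfadjoint: "selfadjoint a \<Longrightarrow> re_part a = a"
  by (simp add: re_part_def selfadjoint_def scaleR_2[symmetric])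

lemma norm_re_part: "norm (re_part a) \<le> norm a"
  using norm_triangle_ineq[of a "star a"] by (simp add: re_part_def)

lemma norm_le_cartesian: "norm a \<le> norm (re_part a) + norm (im_part a)"
  by (subst cartesian_decomposition[of a]) (metis norm_triangle_ineq norm_scaleC norm_ii mult_1_left)

subsection \<open>Spectra of selfadjoint elements\<close>

class unital_cstar_algebra = cstar_algebra + monoid_mult

subclass (in unital_cstar_algebra) complex_banach_algebra
  by standard (simp_all add: scaleC_mult_left scaleC_mult_right)

lemma star_one [simp]: "star 1 = (1::'a::unital_cstar_algebra)"
  by (metis mult_1_left mult_1_right star_mult star_star)

lemma selfadjoint_one [simp, intro]: "selfadjoint (1::'a::unital_cstar_algebra)"
  by (simp add: selfadjoint_def)

lemma norm_one_le: "norm (1::'a::unital_cstar_algebra) \<le> 1"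
  using norm_selfadjoint_square[of "1::'a"] by (cases "norm (1::'a) = 0") (auto simp: power2_eq_square)

lemma inverses_star:
  "inverses a b \<Longrightarrow> inverses (star a) (star (b::'a::unital_cstar_algebra))"
  by (simp add: inverses_def flip: star_mult)

lemma selfadjoint_inverse:
  "selfadjoint a \<Longrightarrow> inverses a b \<Longrightarrow> selfadjoint (b::'a::unital_cstar_algebra)"
  using inverses_star[of a b] inverses_unique[of a b "star b"] by (simp add: selfadjoint_def)

lemma selfadjoint_power: "selfadjoint a \<Longrightarrow> selfadjoint ((a::'a::unital_cstar_algebra) ^ n)"
  by (induction n) (auto simp: power_commutes intro!: selfadjoint_mult)

lemma norm_selfadjoint_power:
  fixes a :: "'a::unital_cstar_algebra"
  assumes "selfadjoint a" "1 \<le> n"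
  shows "norm (a ^ n) = norm a ^ n"
proof (rule antisym)
  have pow: "norm (a ^ (2 ^ m)) = norm a ^ (2 ^ m)" for m
  proof (induction m)
    case (Suc m)
    have "norm (a ^ (2 ^ Suc m)) = norm (a ^ (2 ^ m) * a ^ (2 ^ m))"
      by (simp add: mult_2 power_add[symmetric])
    also have "\<dots> = (norm (a ^ (2 ^ m)))\<^sup>2"
      by (rule norm_selfadjoint_square) (rule selfadjoint_power[OF assms(1)])
    finally show ?case by (simp add: Suc power_mult[symmetric] mult.commute)
  qed simp
  have le: "norm (a ^ k) \<le> norm a ^ k" if "1 \<le> k" for k
    using norm_power_Suc_le[of a "k - 1"] that by simp
  show "norm (a ^ n) \<le> norm a ^ n" by (rule le[OF assms(2)])
  show "norm a ^ n \<le> norm (a ^ n)"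
  proof (cases "a = 0")
    case False
    have "n < 2 ^ n" by simp
    then obtain k where k: "2 ^ n = n + k" "1 \<le> k" by (metis less_imp_add_positive Suc_leI One_nat_def)
    have "norm a ^ n * norm a ^ k = norm (a ^ n * a ^ k)"
      by (simp add: power_add[symmetric] k(1)[symmetric] pow)
    also have "\<dots> \<le> norm (a ^ n) * norm (a ^ k)" by (rule norm_mult_ineq)
    also have "\<dots> \<le> norm (a ^ n) * norm a ^ k" by (intro mult_left_mono le k) auto
    finally show ?thesis using False by simp
  qed (use assms in \<open>simp add: power_0_left\<close>)
qed

text \<open>
  Translate by \<open>\<i> s\<close>: the squared modulus of a spectral value with imaginary part \<open>b\<close> grows like
  \<open>s\<^sup>2 + 2 b s\<close>, while the squared norm of \<open>a + \<i> s\<close> is at most \<open>\<parallel>a\<parallel>\<^sup>2 + s\<^sup>2\<close>.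
\<close>

lemma selfadjoint_spectrum_real:
  fixes a :: "'a::unital_cstar_algebra"
  assumes a: "selfadjoint a" and l: "Im l \<noteq> 0"
  shows "has_inverse (l *\<^sub>C 1 - a)"
proof (rule ccontr)
  assume non: "\<not> has_inverse (l *\<^sub>C 1 - a)"
  have le: "(Re l)\<^sup>2 + (Im l + s)\<^sup>2 \<le> (norm a)\<^sup>2 + s\<^sup>2" for s :: real
  proof -
    define b where "b = a + (\<i> * s) *\<^sub>C 1"
    have "(l + \<i> * s) *\<^sub>C 1 - b = l *\<^sub>C 1 - a" by (simp add: b_def scaleC_add_left)
    then have "cmod (l + \<i> * s) \<le> norm b"
      using non has_inverse_scaleC_one_minus[of b "l + \<i> * s"] by force
    then have "(cmod (l + \<i> * s))\<^sup>2 \<le> norm (star b * b)"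
      by (simp add: cstar_identity power_mono)
    also have "star b * b = a * a + s\<^sup>2 *\<^sub>R 1"
      using a by (simp add: b_def selfadjoint_def star_add star_scaleC mult_scaleC_left mult_scaleC_right
          scaleC_scaleC scaleC_add_right scaleC_add_left scaleC_diff_right complex_normed_scaleR algebra_simps
          power2_eq_square)
    also have "norm \<dots> \<le> norm (a * a) + s\<^sup>2 * norm (1::'a)"
      by (rule order_trans[OF norm_triangle_ineq]) simp
    also have "\<dots> \<le> (norm a)\<^sup>2 + s\<^sup>2 * 1"
      by (intro add_mono mult_left_mono norm_one_le) (simp_all add: norm_selfadjoint_square a)
    finally show ?thesis by (simp add: cmod_power2)
  qed
  have "(Re l)\<^sup>2 + (Im l)\<^sup>2 + ((norm a)\<^sup>2 + 1) \<le> (norm a)\<^sup>2"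
    using le[of "((norm a)\<^sup>2 + 1) / (2 * Im l)"] l by (simp add: power2_sum)
  then show False using sum_power2_ge_zero[of "Re l" "Im l"] by simp
qed

text \<open>
  For selfadjoint \<open>a\<close> the C*-identity gives \<open>\<parallel>a\<^sup>n\<parallel> = \<parallel>a\<parallel>\<^sup>n\<close>, so the norm is the spectral radius; since the
  spectrum is real, only the points \<open>\<plusminus>\<parallel>a\<parallel>\<close> can carry it.
\<close>

lemma selfadjoint_norm_in_spectrum:
  fixes a :: "'a::unital_cstar_algebra"
  assumes a: "selfadjoint a" "a \<noteq> 0"
  shows "\<not> has_inverse (norm a *\<^sub>R 1 - a) \<or> \<not> has_inverse (norm a *\<^sub>R 1 + a)"
proof (rule ccontr)
  assume "\<not> ?thesis"
  then have inv: "has_inverse (norm a *\<^sub>R 1 - a)" "has_inverse (norm a *\<^sub>R 1 + a)" by auto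
  define r where "r = 1 / norm a"
  have r: "0 < r" using a(2) by (simp add: r_def)
  have "\<exists>n\<ge>1. r ^ n * norm (a ^ n) < 1"
  proof (rule spectral_radius_attained[OF r])
    fix z assume z: "cmod z \<le> r"
    show "has_inverse (1 - z *\<^sub>C a)"
    proof (cases "cmod z = r")
      case True
      then have z0: "z \<noteq> 0" using r by auto
      define l where "l = inverse z"
      have l: "cmod l = norm a" "l \<noteq> 0" using True z0 by (auto simp: l_def norm_inverse r_def)
      have eq: "1 - z *\<^sub>C a = z *\<^sub>C (l *\<^sub>C 1 - a)"
        using z0 by (simp add: l_def scaleC_diff_right scaleC_scaleC)
      have "has_inverse (l *\<^sub>C 1 - a)"
      proof (cases "Im l = 0")
        case True
        then have "l = of_real (norm a) \<or> l = of_real (- norm a)"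
          using l(1) by (auto simp: complex_eq_iff cmod_def)
        then show ?thesis
        proof
          assume "l = of_real (- norm a)"
          then have "l *\<^sub>C 1 - a = (-1) *\<^sub>C (norm a *\<^sub>R 1 + a)"
            by (simp add: scaleC_of_real del: of_real_minus)
          then show ?thesis using inv(2) has_inverse_scaleC_iff[of "-1" "norm a *\<^sub>R 1 + a"] by simp
        qed (use inv(1) in \<open>simp add: scaleC_of_real\<close>)
      qed (rule selfadjoint_spectrum_real[OF a(1)])
      then show ?thesis unfolding eq using z0 by (simp add: has_inverse_scaleC_iff)
    next
      case False
      then have "cmod z < r" using z by simp
      then have "norm (z *\<^sub>C a) < 1" using a(2) by (simp add: norm_scaleC r_def field_simps)
      then show ?thesis by (rule has_inverse_one_minus)
    qed
  next
    fix s assume s: "0 \<le> s" "s < r"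
    have "(\<lambda>n. (s * norm a) ^ n) \<longlonglongrightarrow> 0"
      using s a(2) by (intro LIMSEQ_power_zero) (simp add: r_def field_simps)
    then show "(\<lambda>n. s ^ n * norm (a ^ n)) \<longlonglongrightarrow> 0"
      by (rule Lim_transform_eventually)
        (use norm_selfadjoint_power[OF a(1)] in \<open>auto intro!: eventually_sequentiallyI[of 1] simp: power_mult_distrib\<close>)
  qed
  then show False using norm_selfadjoint_power[OF a(1)] a(2) by (auto simp: r_def power_divide)
qed

subsection \<open>Positive elements\<close>

text \<open>
  The spectrum is contained in \<open>[0, \<infinity>)\<close>; for selfadjoint elements only the points \<open>- t\<close> have to be
  excluded.
\<close>

definition pos_elt :: "'a::unital_cstar_algebra \<Rightarrow> bool"
  where "pos_elt a \<longleftrightarrow> selfadjoint a \<and> (\<forall>t>0. has_inverse (t *\<^sub>R 1 + a))"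

lemma has_inverse_real_plus:
  fixes a :: "'a::unital_cstar_algebra"
  assumes "norm a < t"
  shows "has_inverse (t *\<^sub>R 1 + a)"
  using has_inverse_scaleC_one_minus[of "- a" "of_real t"] assms norm_ge_zero[of a]
  by (simp add: scaleC_of_real)

text \<open>
  The link between order and norm: norms of selfadjoint elements are estimated by sandwiching them
  between two multiples of the unit.
\<close>

lemma norm_le_iff_pos_elt:
  fixes a :: "'a::unital_cstar_algebra"
  assumes a: "selfadjoint a" and r: "0 \<le> r"
  shows "norm a \<le> r \<longleftrightarrow> pos_elt (r *\<^sub>R 1 - a) \<and> pos_elt (r *\<^sub>R 1 + a)"
proof
  assume le: "norm a \<le> r"
  have "has_inverse (t *\<^sub>R 1 + (r *\<^sub>R 1 + b))" if "t > 0" "norm b = norm a" for t and b :: 'a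
  proof -
    have "has_inverse ((t + r) *\<^sub>R 1 + b)" using that le by (intro has_inverse_real_plus) simp
    then show ?thesis by (simp add: algebra_simps)
  qed
  from this[of _ a] this[of _ "- a"] show "pos_elt (r *\<^sub>R 1 - a) \<and> pos_elt (r *\<^sub>R 1 + a)"
    using a by (auto simp: pos_elt_def)
next
  assume pos: "pos_elt (r *\<^sub>R 1 - a) \<and> pos_elt (r *\<^sub>R 1 + a)"
  show "norm a \<le> r"
  proof (rule ccontr)
    assume "\<not> norm a \<le> r"
    then have lt: "0 < norm a - r" "a \<noteq> 0" using r by auto
    have "has_inverse ((norm a - r) *\<^sub>R 1 + (r *\<^sub>R 1 - a))" "has_inverse ((norm a - r) *\<^sub>R 1 + (r *\<^sub>R 1 + a))"
      using pos lt(1) by (auto simp: pos_elt_def)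
    then show False using selfadjoint_norm_in_spectrum[OF a lt(2)] by (simp add: algebra_simps)
  qed
qed

lemma pos_elt_real [simp]: "0 \<le> r \<Longrightarrow> pos_elt (r *\<^sub>R (1::'a::unital_cstar_algebra))"
  unfolding pos_elt_def
proof (intro conjI allI impI)
  fix t :: real assume t: "0 \<le> r" "t > 0"
  then show "has_inverse (t *\<^sub>R 1 + r *\<^sub>R (1::'a))"
    using has_inverse_real_plus[of "0::'a" "t + r"] by (simp add: scaleR_add_left)
qed auto

lemma pos_elt_zero [simp]: "pos_elt (0::'a::unital_cstar_algebra)"
  using pos_elt_real[of 0] by simp

lemma pos_elt_plus_real: "pos_elt a \<Longrightarrow> 0 \<le> r \<Longrightarrow> pos_elt (r *\<^sub>R 1 + a)"
  unfolding pos_elt_def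
proof (elim conjE, intro conjI allI impI)
  fix t :: real assume "\<forall>t>0. has_inverse (t *\<^sub>R 1 + a)" "0 \<le> r" "0 < t"
  then have "has_inverse ((t + r) *\<^sub>R 1 + a)" by simp
  then show "has_inverse (t *\<^sub>R 1 + (r *\<^sub>R 1 + a))" by (simp add: algebra_simps)
qed auto

text \<open>
  Positivity becomes membership in a ball, from which closure under addition is evident.
\<close>

lemma pos_elt_iff_norm:
  fixes a :: "'a::unital_cstar_algebra"
  assumes a: "selfadjoint a" and r: "norm a \<le> r"
  shows "pos_elt a \<longleftrightarrow> norm (r *\<^sub>R 1 - a) \<le> r"
proof -
  have r0: "0 \<le> r" using r norm_ge_zero order_trans by blast
  have "pos_elt (r *\<^sub>R 1 - a)" using norm_le_iff_pos_elt[OF a r0] r by simp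
  then have "pos_elt (r *\<^sub>R 1 + (r *\<^sub>R 1 - a))" using r0 by (rule pos_elt_plus_real)
  then show ?thesis using norm_le_iff_pos_elt[of "r *\<^sub>R 1 - a" r] a r0 by auto
qed

lemma pos_elt_add:
  fixes a b :: "'a::unital_cstar_algebra"
  assumes "pos_elt a" "pos_elt b"
  shows "pos_elt (a + b)"
proof -
  have sa: "selfadjoint a" "selfadjoint b" using assms by (auto simp: pos_elt_def)
  have "norm (norm a *\<^sub>R 1 - a) \<le> norm a" "norm (norm b *\<^sub>R 1 - b) \<le> norm b"
    using assms pos_elt_iff_norm sa by auto
  moreover have "(norm a + norm b) *\<^sub>R 1 - (a + b) = (norm a *\<^sub>R 1 - a) + (norm b *\<^sub>R 1 - b)"
    by (simp add: algebra_simps)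
  ultimately have "norm ((norm a + norm b) *\<^sub>R 1 - (a + b)) \<le> norm a + norm b"
    by (simp only:) (meson add_mono norm_triangle_ineq order_trans)
  then show ?thesis
    using pos_elt_iff_norm[of "a + b" "norm a + norm b"] sa norm_triangle_ineq[of a b] by simp
qed

lemma pos_elt_scaleR:
  fixes a :: "'a::unital_cstar_algebra"
  assumes "pos_elt a" "0 \<le> r"
  shows "pos_elt (r *\<^sub>R a)"
proof (cases "r = 0")
  case False
  have "has_inverse (t *\<^sub>R 1 + r *\<^sub>R a)" if "t > 0" for t
  proof -
    have "has_inverse (of_real r *\<^sub>C ((t / r) *\<^sub>R 1 + a))"
      using assms False that by (simp add: has_inverse_scaleC_iff pos_elt_def)
    then show ?thesis using False by (simp add: scaleC_of_real scaleR_add_right)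
  qed
  then show ?thesis using assms by (auto simp: pos_elt_def)
qed simp

lemma pos_elt_limit:
  fixes a :: "'a::unital_cstar_algebra"
  assumes "\<And>t. t > 0 \<Longrightarrow> pos_elt (t *\<^sub>R 1 + a)"
  shows "pos_elt a"
proof -
  have "selfadjoint (1 *\<^sub>R 1 + a)" using assms[of 1] by (simp add: pos_elt_def)
  then have "selfadjoint a" using selfadjoint_intros(3)[OF _ selfadjoint_one, of "1 *\<^sub>R 1 + a"] by simp
  moreover have "has_inverse (t *\<^sub>R 1 + a)" if "t > 0" for t
  proof -
    have "has_inverse ((t/2) *\<^sub>R 1 + ((t/2) *\<^sub>R 1 + a))"
      using assms[of "t/2"] that by (simp add: pos_elt_def)
    then show ?thesis by (simp add: add.assoc[symmetric] scaleR_add_left[symmetric])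
  qed
  ultimately show ?thesis by (simp add: pos_elt_def)
qed

lemma norm_pos_elt_mono:
  fixes a b :: "'a::unital_cstar_algebra"
  assumes a: "pos_elt a" and ab: "pos_elt (b - a)"
  shows "norm a \<le> norm b"
proof -
  have "b = (b - a) + a" by simp
  then have b: "pos_elt b" using pos_elt_add[OF ab a] by simp
  have "pos_elt (norm b *\<^sub>R 1 - b)"
    using norm_le_iff_pos_elt[of b "norm b"] b by (simp add: pos_elt_def)
  from pos_elt_add[OF this ab] have "pos_elt (norm b *\<^sub>R 1 - a)" by simp
  moreover have "pos_elt (norm b *\<^sub>R 1 + a)" by (rule pos_elt_plus_real[OF a]) simp
  ultimately show ?thesis using norm_le_iff_pos_elt[of a "norm b"] a by (simp add: pos_elt_def)
qed

lemma pos_elt_norm_le: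
  fixes a :: "'a::unital_cstar_algebra"
  assumes a: "pos_elt a" and r: "0 \<le> r" and le: "pos_elt (r *\<^sub>R 1 - a)"
  shows "norm a \<le> r"
  using norm_le_iff_pos_elt[of a r] a r le pos_elt_plus_real[OF a r] by (simp add: pos_elt_def)

lemma pos_elt_antisym: "pos_elt a \<Longrightarrow> pos_elt (- a) \<Longrightarrow> a = (0::'a::unital_cstar_algebra)"
  using norm_pos_elt_mono[of a 0] by simp

text \<open>
  \<open>a\<^sup>2 + t\<close> factors into \<open>a \<plusminus> \<i> \<surd>t\<close> up to sign, and the spectrum of \<open>a\<close> is real.
\<close>

lemma pos_elt_square:
  fixes a :: "'a::unital_cstar_algebra"
  assumes a: "selfadjoint a"
  shows "pos_elt (a * a)"
  unfolding pos_elt_def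
proof (intro conjI allI impI)
  fix t :: real assume t: "t > 0"
  define l where "l = \<i> * sqrt t"
  have ll: "l * l = - of_real t"
    using t by (simp add: l_def algebra_simps) (simp flip: of_real_mult)
  have "has_inverse (l *\<^sub>C 1 - a)" "has_inverse (- l *\<^sub>C 1 - a)"
    by (rule selfadjoint_spectrum_real[OF a]; use t in \<open>simp add: l_def\<close>)+
  then have "has_inverse ((l *\<^sub>C 1 - a) * (- l *\<^sub>C 1 - a))" by (rule has_inverse_mult)
  also have "(l *\<^sub>C 1 - a) * (- l *\<^sub>C 1 - a) = t *\<^sub>R 1 + a * a"
    by (simp add: algebra_simps mult_scaleC_left mult_scaleC_right scaleC_scaleC scaleC_diff_right ll scaleC_of_real)
  finally show "has_inverse (t *\<^sub>R 1 + a * a)" .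
qed (use a in auto)

subsection \<open>Square roots and Kaplansky's theorem\<close>

text \<open>
  With \<open>k = 1 - x\<close> and root \<open>1 - y\<close> the equation \<open>(1 - y)\<^sup>2 = 1 - x\<close> reads \<open>y = (x + y\<^sup>2) / 2\<close>, which is
  solved by iteration.  The same iteration with \<open>x = 1\<close> in the reals dominates all increments.
\<close>

primrec sqrt_iter :: "'a::real_normed_algebra \<Rightarrow> nat \<Rightarrow> 'a"
  where "sqrt_iter x 0 = 0"
  | "sqrt_iter x (Suc n) = (1/2) *\<^sub>R (x + sqrt_iter x n * sqrt_iter x n)"

lemma sqrt_iter_commute:
  assumes "c * x = x * c"
  shows "c * sqrt_iter x n = sqrt_iter x n * c"
proof (induction n)
  case (Suc n)
  have "c * (sqrt_iter x n * sqrt_iter x n) = sqrt_iter x n * sqrt_iter x n * c"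
    by (metis Suc mult.assoc)
  then show ?case using assms by (simp add: distrib_left distrib_right)
qed simp

lemma sqrt_iter_real_bounds: "0 \<le> sqrt_iter (1::real) n \<and> sqrt_iter (1::real) n \<le> 1"
proof (induction n)
  case (Suc n)
  then have "sqrt_iter (1::real) n * sqrt_iter 1 n \<le> 1" by (simp add: mult_le_one)
  then show ?case by simp
qed simp

lemma norm_sqrt_iter_le:
  assumes "norm x \<le> 1"
  shows "norm (sqrt_iter x n) \<le> sqrt_iter (1::real) n"
proof (induction n)
  case (Suc n)
  have "norm (x + sqrt_iter x n * sqrt_iter x n) \<le> norm x + norm (sqrt_iter x n) * norm (sqrt_iter x n)"
    by (rule order_trans[OF norm_triangle_ineq add_left_mono[OF norm_mult_ineq]])
  also have "\<dots> \<le> 1 + sqrt_iter 1 n * sqrt_iter 1 n"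
    by (intro add_mono mult_mono Suc assms) (use sqrt_iter_real_bounds in auto)
  finally show ?case by simp
qed simp

lemma norm_sqrt_iter_diff_le:
  assumes x: "norm x \<le> 1"
  shows "norm (sqrt_iter x (Suc n) - sqrt_iter x n) \<le> sqrt_iter (1::real) (Suc n) - sqrt_iter 1 n"
proof (induction n)
  case (Suc n)
  let ?y = "sqrt_iter x" and ?s = "sqrt_iter (1::real)"
  have comm: "?y (Suc n) * ?y n = ?y n * ?y (Suc n)"
    by (rule sqrt_iter_commute) (rule sqrt_iter_commute[symmetric], rule refl)
  have "?y (Suc (Suc n)) - ?y (Suc n) = (1/2) *\<^sub>R (?y (Suc n) * ?y (Suc n) - ?y n * ?y n)"
    by (subst (1 2) sqrt_iter.simps(2)) (simp only: scaleR_diff_right[symmetric] add_diff_cancel_left)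
  also have "?y (Suc n) * ?y (Suc n) - ?y n * ?y n = (?y (Suc n) + ?y n) * (?y (Suc n) - ?y n)"
    using comm by (simp only: distrib_right right_diff_distrib) simp
  finally have "norm (?y (Suc (Suc n)) - ?y (Suc n)) \<le> (1/2) * (norm (?y (Suc n) + ?y n) * norm (?y (Suc n) - ?y n))"
    using norm_mult_ineq[of "?y (Suc n) + ?y n" "?y (Suc n) - ?y n"] by simp
  also have "\<dots> \<le> (1/2) * ((?s (Suc n) + ?s n) * (?s (Suc n) - ?s n))"
    by (intro mult_left_mono mult_mono Suc order_trans[OF norm_triangle_ineq] add_mono norm_sqrt_iter_le x)
      (use sqrt_iter_real_bounds in \<open>auto simp del: sqrt_iter.simps\<close>)
  also have "\<dots> = ?s (Suc (Suc n)) - ?s (Suc n)"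
    by (subst (3 4) sqrt_iter.simps(2)) (simp add: algebra_simps del: sqrt_iter.simps)
  finally show ?case .
qed (use x in simp)

lemma sqrt_iter_converges:
  fixes x :: "'a::{real_normed_algebra,banach}"
  assumes x: "norm x \<le> 1"
  obtains y where "sqrt_iter x \<longlonglongrightarrow> y" "y = (1/2) *\<^sub>R (x + y * y)" "norm y \<le> 1"
proof -
  have step: "0 \<le> sqrt_iter (1::real) (Suc n) - sqrt_iter 1 n" for n
    using norm_sqrt_iter_diff_le[OF x, of n] norm_ge_zero order_trans by blast
  then have "incseq (sqrt_iter (1::real))" by (intro incseq_SucI) simp
  moreover have "bdd_above (range (sqrt_iter (1::real)))"
    using sqrt_iter_real_bounds by (auto intro!: bdd_aboveI[of _ 1])
  ultimately have "sqrt_iter (1::real) \<longlonglongrightarrow> (SUP n. sqrt_iter 1 n)"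
    by (intro LIMSEQ_incseq_SUP)
  then have "summable (\<lambda>n. sqrt_iter (1::real) (Suc n) - sqrt_iter 1 n)"
    by (rule telescope_summable)
  then have "summable (\<lambda>n. sqrt_iter x (Suc n) - sqrt_iter x n)"
    by (rule summable_comparison_test'[of _ 0]) (use norm_sqrt_iter_diff_le[OF x] in blast)
  then have "(\<lambda>n. \<Sum>k<n. sqrt_iter x (Suc k) - sqrt_iter x k) \<longlonglongrightarrow> (\<Sum>n. sqrt_iter x (Suc n) - sqrt_iter x n)"
    by (rule summable_LIMSEQ)
  then obtain y where y: "sqrt_iter x \<longlonglongrightarrow> y"
    by (simp only: sum_lessThan_telescope sqrt_iter.simps(1) diff_zero)
  have "(\<lambda>n. sqrt_iter x (Suc n)) \<longlonglongrightarrow> (1/2) *\<^sub>R (x + y * y)"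
    by (simp only: sqrt_iter.simps(2)) (intro tendsto_intros y)
  then have "y = (1/2) *\<^sub>R (x + y * y)"
    using LIMSEQ_unique[OF LIMSEQ_Suc[OF y]] by blast
  moreover have "norm y \<le> 1"
    by (rule Lim_bounded[OF tendsto_norm[OF y]])
      (use norm_sqrt_iter_le[OF x] sqrt_iter_real_bounds order_trans in blast)
  ultimately show ?thesis using y by (intro that)
qed

lemma pos_elt_sqrt_contraction:
  fixes k :: "'a::unital_cstar_algebra"
  assumes k: "pos_elt k" "norm k \<le> 1"
  obtains r where "pos_elt r" "r * r = k" "\<And>c. c * k = k * c \<Longrightarrow> c * r = r * c"
proof -
  define x where "x = 1 - k"
  have sx: "selfadjoint x" using k by (auto simp: x_def pos_elt_def)
  have x: "norm x \<le> 1" using pos_elt_iff_norm[of k 1] k by (simp add: pos_elt_def x_def)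
  obtain y where lim: "sqrt_iter x \<longlonglongrightarrow> y" and eq: "y = (1/2) *\<^sub>R (x + y * y)" and y: "norm y \<le> 1"
    using sqrt_iter_converges[OF x] by blast
  have "selfadjoint (sqrt_iter x n)" for n
    by (induction n) (use sx in auto)
  then have "(\<lambda>n. star (sqrt_iter x n)) \<longlonglongrightarrow> y" using lim by (simp add: selfadjoint_def)
  moreover have "(\<lambda>n. star (sqrt_iter x n)) \<longlonglongrightarrow> star y"
    by (rule bounded_linear.tendsto[OF bounded_linear_star lim])
  ultimately have sy: "selfadjoint y" using LIMSEQ_unique by (auto simp: selfadjoint_def)
  have "pos_elt (1 - y)" using norm_le_iff_pos_elt[OF sy, of 1] y by simp
  moreover have "(1 - y) * (1 - y) = k"
  proof -
    have "2 *\<^sub>R y = x + y * y" by (subst eq) simp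
    then have "y + y = x + y * y" by (simp add: scaleR_2)
    moreover have "(1 - y) * (1 - y) = 1 - (y + y) + y * y" by (simp add: algebra_simps)
    ultimately show ?thesis by (simp add: x_def)
  qed
  moreover have "c * (1 - y) = (1 - y) * c" if c: "c * k = k * c" for c
  proof -
    have "c * x = x * c" using c by (simp add: x_def algebra_simps)
    then have "c * sqrt_iter x n = sqrt_iter x n * c" for n by (rule sqrt_iter_commute)
    moreover have "(\<lambda>n. c * sqrt_iter x n) \<longlonglongrightarrow> c * y" "(\<lambda>n. sqrt_iter x n * c) \<longlonglongrightarrow> y * c"
      by (intro tendsto_intros lim)+
    ultimately have "c * y = y * c" using LIMSEQ_unique by simp
    then show ?thesis by (simp add: algebra_simps)
  qed
  ultimately show ?thesis by (rule that)
qed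

lemma pos_elt_sqrt:
  fixes k :: "'a::unital_cstar_algebra"
  assumes k: "pos_elt k"
  obtains r where "pos_elt r" "r * r = k" "\<And>c. c * k = k * c \<Longrightarrow> c * r = r * c"
proof (cases "k = 0")
  case True
  then show ?thesis by (intro that[of 0]) auto
next
  case False
  define m where "m = norm k"
  have m: "0 < m" using False by (simp add: m_def)
  have "pos_elt ((1/m) *\<^sub>R k)" "norm ((1/m) *\<^sub>R k) \<le> 1"
    using m by (simp_all add: pos_elt_scaleR[OF k] m_def)
  then obtain r where r: "pos_elt r" "r * r = (1/m) *\<^sub>R k" "\<And>c. c * ((1/m) *\<^sub>R k) = (1/m) *\<^sub>R k * c \<Longrightarrow> c * r = r * c"
    using pos_elt_sqrt_contraction by blast
  show ?thesis
  proof (rule that)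
    show "pos_elt (sqrt m *\<^sub>R r)" using r(1) m by (intro pos_elt_scaleR) auto
    show "(sqrt m *\<^sub>R r) * (sqrt m *\<^sub>R r) = k" using r(2) m by simp
    show "c * (sqrt m *\<^sub>R r) = (sqrt m *\<^sub>R r) * c" if "c * k = k * c" for c
      using r(3)[of c] that by simp
  qed
qed

text \<open>
  Here \<open>m\<close> plays the role of \<open>|h|\<close>, so \<open>m - h\<close> is twice the negative part.  The difference
  \<open>d = m - h\<close> satisfies \<open>d\<^sup>2 = 2 m d\<close>; therefore \<open>(t + d) (2 m + t - d) = t (2 m + t)\<close>, and the
  right-hand side is invertible.
\<close>

lemma pos_elt_modulus_minus:
  fixes h m :: "'a::unital_cstar_algebra"
  assumes m: "pos_elt m" "m * m = h * h" and h: "selfadjoint h" "h * m = m * h"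
  shows "pos_elt (m - h)"
  unfolding pos_elt_def
proof (intro conjI allI impI)
  show "selfadjoint (m - h)" using m h by (auto simp: pos_elt_def)
  fix t :: real assume t: "t > 0"
  define d where "d = m - h"
  have dd: "d * d = 2 *\<^sub>R (m * d)" and md: "m * d = d * m"
    using m(2) h(2) by (simp_all add: d_def algebra_simps scaleR_2)
  define f where "f = 2 *\<^sub>R m + t *\<^sub>R 1 - d"
  have "has_inverse (of_real (2 * t) *\<^sub>C ((t/2) *\<^sub>R 1 + m))"
    using m(1) t by (subst has_inverse_scaleC_iff) (auto simp: pos_elt_def)
  also have "of_real (2 * t) *\<^sub>C ((t/2) *\<^sub>R 1 + m) = t *\<^sub>R (t *\<^sub>R 1 + 2 *\<^sub>R m)"
    unfolding scaleC_of_real by (simp add: scaleR_add_right mult.commute)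
  also have "\<dots> = (t *\<^sub>R 1 + d) * f"
  proof -
    have "d * f = 2 *\<^sub>R (d * m) + t *\<^sub>R d - d * d"
      by (simp add: f_def distrib_left right_diff_distrib)
    then have "d * f = t *\<^sub>R d" using dd md by simp
    then have "(t *\<^sub>R 1 + d) * f = t *\<^sub>R (f + d)" by (simp add: distrib_right scaleR_add_right)
    then show ?thesis by (simp add: f_def add.commute)
  qed
  finally have inv: "has_inverse ((t *\<^sub>R 1 + d) * f)" .
  show "has_inverse (t *\<^sub>R 1 + d)"
  proof (rule has_inverse_commuting_factor[OF inv])
    have "d * f = f * d"
      by (simp add: f_def md distrib_left distrib_right right_diff_distrib left_diff_distrib)
    then show "(t *\<^sub>R 1 + d) * f = f * (t *\<^sub>R 1 + d)" by (simp add: distrib_left distrib_right)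
  qed
qed

text \<open>
  Away from zero, \<open>c* c\<close> and \<open>c c*\<close> have the same spectrum: if \<open>b\<close> inverts \<open>t - c* c\<close>, then
  \<open>(1 + c b (star c)) / t\<close> inverts \<open>t - c c*\<close>.
\<close>

lemma pos_elt_times_star_swap:
  fixes c :: "'a::unital_cstar_algebra"
  assumes "pos_elt (- (star c * c))"
  shows "pos_elt (- (c * star c))"
  unfolding pos_elt_def
proof (intro conjI allI impI)
  fix t :: real assume t: "t > 0"
  then have "has_inverse (t *\<^sub>R 1 + - (star c * c))" using assms by (simp add: pos_elt_def)
  then obtain b where b: "(t *\<^sub>R 1 - star c * c) * b = 1" "b * (t *\<^sub>R 1 - star c * c) = 1"
    by (auto simp: has_inverse_def inverses_def)
  then have b': "star c * c * b = t *\<^sub>R b - 1" "b * (star c * c) = t *\<^sub>R b - 1"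
    by (simp_all add: left_diff_distrib right_diff_distrib eq_diff_eq diff_eq_eq add.commute)
  have 1: "c * star c * (c * b * star c) = t *\<^sub>R (c * b * star c) - c * star c"
  proof -
    have "c * star c * (c * b * star c) = c * (star c * c * b) * star c" by (simp only: mult.assoc)
    also have "\<dots> = t *\<^sub>R (c * b * star c) - c * star c" unfolding b'(1) by (simp add: algebra_simps)
    finally show ?thesis .
  qed
  have 2: "(c * b * star c) * (c * star c) = t *\<^sub>R (c * b * star c) - c * star c"
  proof -
    have "(c * b * star c) * (c * star c) = c * (b * (star c * c)) * star c" by (simp only: mult.assoc)
    also have "\<dots> = t *\<^sub>R (c * b * star c) - c * star c" unfolding b'(2) by (simp add: algebra_simps)
    finally show ?thesis .
  qed
  have "inverses (t *\<^sub>R 1 + - (c * star c)) ((1/t) *\<^sub>R (1 + c * b * star c))"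
    unfolding inverses_def using t
    by (simp add: left_diff_distrib right_diff_distrib distrib_left distrib_right 1 2)
  then show "has_inverse (t *\<^sub>R 1 + - (c * star c))" by (auto simp: has_inverse_def)
qed auto

text \<open>
  Kaplansky's argument: if \<open>h = a* a\<close> had a negative part \<open>n \<noteq> 0\<close>, then \<open>c = a n\<close> would satisfy
  \<open>c* c = - n\<^sup>3 \<le> 0\<close>, hence also \<open>c c* \<le> 0\<close>, although \<open>c* c + c c*\<close> is a sum of two squares.
  Below, \<open>n = m - h\<close> is twice the negative part, which accounts for a factor \<open>1/2\<close>.
\<close>

theorem pos_elt_star_mult:
  fixes a :: "'a::unital_cstar_algebra"
  shows "pos_elt (star a * a)"
proof -
  define h where "h = star a * a"
  have h: "selfadjoint h" by (simp add: h_def)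
  obtain m where m: "pos_elt m" "m * m = h * h" and mc: "\<And>c. c * (h * h) = h * h * c \<Longrightarrow> c * m = m * c"
    using pos_elt_sqrt[OF pos_elt_square[OF h]] by blast
  have hm: "h * m = m * h" by (rule mc) (simp add: mult.assoc)
  define n where "n = m - h"
  have n: "pos_elt n" unfolding n_def by (rule pos_elt_modulus_minus[OF m h hm])
  have sn: "selfadjoint n" using n by (simp add: pos_elt_def)
  have nn: "n * n = - 2 *\<^sub>R (h * n)"
    using m(2) hm by (simp add: n_def algebra_simps scaleR_2)
  have hn: "h * n = n * h" using hm by (simp add: n_def algebra_simps)
  define c where "c = a * n"
  have cc: "star c * c = - ((1/2) *\<^sub>R (n * n * n))"
  proof -
    have "star c * c = n * h * n"
      using sn by (simp add: c_def h_def star_mult selfadjoint_def mult.assoc)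
    also have "\<dots> = h * n * n" by (simp add: hn)
    also have "h * n = - ((1/2) *\<^sub>R (n * n))" by (simp add: nn)
    finally show ?thesis by simp
  qed
  obtain r where r: "pos_elt r" "r * r = n" using pos_elt_sqrt[OF n] by blast
  have nr: "n * r = r * n" by (simp only: r(2)[symmetric] mult.assoc)
  then have "selfadjoint (n * r)"
    using r by (intro selfadjoint_mult sn) (simp_all add: pos_elt_def)
  then have "pos_elt ((n * r) * (n * r))" by (rule pos_elt_square)
  also have "(n * r) * (n * r) = n * (r * n) * r" by (simp only: mult.assoc)
  also have "\<dots> = n * n * (r * r)" by (simp only: nr[symmetric] mult.assoc)
  also have "\<dots> = n * n * n" by (simp only: r(2))
  finally have n3: "pos_elt (n * n * n)" .
  then have neg: "pos_elt (- (star c * c))" unfolding cc by (simp add: pos_elt_scaleR)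
  have "star c * c + c * star c = 2 *\<^sub>R (re_part c * re_part c + im_part c * im_part c)"
  proof -
    define x y where "x = re_part c" and "y = im_part c"
    have xy: "star x = x" "star y = y"
      using selfadjoint_re_part[of c] selfadjoint_im_part[of c] by (simp_all add: x_def y_def selfadjoint_def)
    have c: "c = x + \<i> *\<^sub>C y" unfolding x_def y_def by (rule cartesian_decomposition)
    have sc: "star c = x - \<i> *\<^sub>C y" by (subst c) (simp add: star_add star_scaleC xy)
    show ?thesis
      unfolding sc x_def[symmetric] y_def[symmetric] unfolding c
      by (simp add: algebra_simps mult_scaleC_left mult_scaleC_right scaleC_scaleC scaleR_2 scaleC_diff_right
          scaleC_add_right)
  qed
  then have "pos_elt (star c * c + c * star c)"
    by (simp only:) (intro pos_elt_scaleR pos_elt_add pos_elt_square; simp)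
  from pos_elt_add[OF this pos_elt_times_star_swap[OF neg]] have "pos_elt (star c * c)" by simp
  then have "star c * c = 0" using neg by (rule pos_elt_antisym)
  then have "n * n * n = 0" unfolding cc by simp
  then have "(n * n) * (n * n) = 0" by (simp add: mult.assoc[symmetric])
  then have "n = 0" using norm_selfadjoint_square[of "n * n"] norm_selfadjoint_square[OF sn] sn by simp
  then have "h = m" by (simp add: n_def)
  with m(1) show ?thesis by (simp add: h_def)
qed

lemma pos_elt_conj:
  fixes k c :: "'a::unital_cstar_algebra"
  assumes "pos_elt k"
  shows "pos_elt (star c * k * c)"
proof -
  obtain r where r: "pos_elt r" "r * r = k" using pos_elt_sqrt[OF assms] by blast
  have "star (r * c) * (r * c) = star c * k * c"
    using r(1) by (simp add: star_mult pos_elt_def selfadjoint_def mult.assoc flip: r(2))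
  then show ?thesis using pos_elt_star_mult[of "r * c"] by simp
qed

lemma pos_elt_conj_eq_0D:
  fixes k b :: "'a::unital_cstar_algebra"
  assumes "pos_elt k" "star b * k * b = 0"
  shows "k * b = 0"
proof -
  obtain r where r: "pos_elt r" "r * r = k" using pos_elt_sqrt[OF assms(1)] by blast
  have "star (r * b) * (r * b) = star b * k * b"
    using r(1) by (simp add: star_mult pos_elt_def selfadjoint_def mult.assoc flip: r(2))
  then have "r * b = 0" using assms(2) star_mult_eq_0D[of "r * b"] by simp
  moreover have "k * b = r * (r * b)" by (simp only: r(2)[symmetric] mult.assoc)
  ultimately show ?thesis by simp
qed

text \<open>For large \<open>s\<close> the element \<open>1 - (1 + s k)\<inverse>\<close> acts almost as a unit on everything below \<open>k\<close>.\<close>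

lemma approximate_unit_element:
  fixes k :: "'a::unital_cstar_algebra"
  assumes k: "pos_elt k" and s: "0 < s"
  obtains u where "selfadjoint u" "pos_elt u" "pos_elt (1 - u)" "norm (u * k * u) \<le> 1 / s"
    "1 - u = s *\<^sub>R (k * u)"
proof -
  have "has_inverse ((1/s) *\<^sub>R 1 + k)" using k s by (simp add: pos_elt_def)
  then have "has_inverse (of_real s *\<^sub>C ((1/s) *\<^sub>R 1 + k))" using s by (simp add: has_inverse_scaleC_iff)
  then have "has_inverse (1 + s *\<^sub>R k)" using s by (simp add: scaleC_of_real scaleR_add_right)
  then obtain u where u: "inverses (1 + s *\<^sub>R k) u" by (auto simp: has_inverse_def)
  have sk: "selfadjoint k" using k by (simp add: pos_elt_def)
  have su: "selfadjoint u" by (rule selfadjoint_inverse[OF _ u]) (use sk in auto)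
  have e: "1 - u = s *\<^sub>R (k * u)" "1 - u = s *\<^sub>R (u * k)"
    using u by (simp_all add: inverses_def algebra_simps)
  have "u = star u * (1 *\<^sub>R 1 + s *\<^sub>R k) * u"
    using u su by (simp add: inverses_def selfadjoint_def)
  moreover have "pos_elt (star u * (1 *\<^sub>R 1 + s *\<^sub>R k) * u)"
    by (intro pos_elt_conj pos_elt_plus_real pos_elt_scaleR k) (use s in auto)
  ultimately have pu: "pos_elt u" by simp
  obtain r where r: "pos_elt r" "r * r = u" "\<And>c. c * u = u * c \<Longrightarrow> c * r = r * c"
    using pos_elt_sqrt[OF pu] by blast
  have "k * u = u * k" using e s by simp
  then have kr: "k * r = r * k" by (rule r(3))
  have "k * u = k * r * r" by (simp add: r(2)[symmetric] mult.assoc)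
  also have "\<dots> = star r * k * r" using r(1) by (simp add: kr pos_elt_def selfadjoint_def)
  finally have "k * u = star r * k * r" .
  then have p1: "pos_elt (1 - u)"
    unfolding e(1) using s by (simp add: pos_elt_scaleR pos_elt_conj[OF k])
  have n: "norm u \<le> 1" "norm (1 - u) \<le> 1"
    using pos_elt_norm_le[OF pu, of 1] pos_elt_norm_le[OF p1, of 1] pu p1 by auto
  have "s *\<^sub>R (u * k * u) = (1 - u) * u" by (simp add: e(2))
  then have "s * norm (u * k * u) = norm ((1 - u) * u)" using s by (metis abs_of_pos norm_scaleR)
  also have "\<dots> \<le> 1 * 1" by (rule order_trans[OF norm_mult_ineq mult_mono]) (use n in auto)
  finally have "norm (u * k * u) \<le> 1 / s" using s by (simp add: field_simps)
  with su pu p1 e(1) show ?thesis by (intro that)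
qed

section \<open>Unitization\<close>

typedef 'a unitization = "UNIV :: ('a \<times> complex) set"
  morphisms body Unitization ..

setup_lifting type_definition_unitization

lift_definition scalar_part :: "'a unitization \<Rightarrow> complex" is snd .

lift_definition unitize :: "'a::zero \<Rightarrow> 'a unitization" is "\<lambda>a. (a, 0)" .

definition act :: "'a::cstar_algebra \<times> complex \<Rightarrow> 'a \<Rightarrow> 'a"
  where "act u x = fst u * x + snd u *\<^sub>C x"

lemma bounded_linear_act: "bounded_linear (act u)"
  unfolding act_def[abs_def]
  by (intro bounded_linear_add bounded_linear_mult_right bounded_linear_scaleC_right)

lemma onorm_scaleC:
  fixes f :: "'a::real_normed_vector \<Rightarrow> 'b::complex_normed_vector"
  assumes f: "bounded_linear f"
  shows "onorm (\<lambda>x. c *\<^sub>C f x) = cmod c * onorm f"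
proof (cases "c = 0")
  case True
  then show ?thesis by (simp add: onorm_zero)
next
  case False
  have le: "onorm (\<lambda>x. c *\<^sub>C g x) \<le> cmod c * onorm g" if "bounded_linear g"
    for c and g :: "'a \<Rightarrow> 'b"
    by (rule onorm_bound)
      (auto simp: norm_scaleC mult.assoc onorm_pos_le[OF that] intro!: mult_left_mono onorm[OF that])
  have "onorm f \<le> cmod (inverse c) * onorm (\<lambda>x. c *\<^sub>C f x)"
    using le[of "\<lambda>x. c *\<^sub>C f x" "inverse c"] False
    by (simp add: scaleC_scaleC bounded_linear_compose[OF bounded_linear_scaleC_right f])
  then show ?thesis
    using le[OF f, of c] False by (simp add: norm_inverse norm_divide field_simps)
qed

lemma norm_le_left_mult:
  fixes a :: "'a::cstar_algebra"
  assumes "0 \<le> K" and le: "\<And>x. norm (a * x) \<le> K * norm x"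
  shows "norm a \<le> K"
proof (cases "a = 0")
  case False
  have "norm a * norm a = norm (a * star a)"
    using cstar_identity[of "star a"] by (simp add: star_star power2_eq_square)
  also have "\<dots> \<le> K * norm a" using le[of "star a"] by simp
  finally show ?thesis using False by simp
qed (use assms in simp)

lemma onorm_left_mult: "onorm ((*) a) = norm (a::'a::cstar_algebra)"
proof (rule antisym)
  show "onorm ((*) a) \<le> norm a" by (rule onorm_bound) (simp_all add: norm_mult_ineq)
  show "norm a \<le> onorm ((*) a)"
    by (rule norm_le_left_mult) (auto intro: onorm_pos_le onorm bounded_linear_mult_right)
qed

lemma act_simps:
  "act (u + v) = (\<lambda>x. act u x + act v x)"
  "act (fst u * fst v + snd v *\<^sub>C fst u + snd u *\<^sub>C fst v, snd u * snd v) = act u \<circ> act v"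
  "act (c *\<^sub>C fst u, c * snd u) = (\<lambda>x. c *\<^sub>C act u x)"
  by (auto simp: act_def fun_eq_iff algebra_simps scaleC_mult_left scaleC_mult_right scaleC_add_left
      scaleC_add_right scaleC_scaleC mult.assoc)

lemma star_act: "star (act u x) * y = star x * act (star (fst u), cnj (snd u)) y"
  by (simp add: act_def star_add star_mult star_scaleC distrib_left distrib_right mult.assoc
      scaleC_mult_left scaleC_mult_right)

text \<open>
  The operator norm of the action by left multiplication is only a seminorm if the algebra already
  has a unit.  Taking the maximum with the modulus of the scalar part repairs this; in that case the
  unitization is the direct sum of the algebra with the complex numbers.
\<close>

definition extension_norm :: "'a::cstar_algebra \<times> complex \<Rightarrow> real"
  where "extension_norm u = max (cmod (snd u)) (onorm (act u))"

lemma norm_act_le: "norm (act u x) \<le> extension_norm u * norm x"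
  using onorm[OF bounded_linear_act, of u x]
  by (rule order_trans) (auto simp: extension_norm_def intro: mult_right_mono)

lemma extension_norm_bounds:
  "cmod (snd u) \<le> extension_norm u" "norm (fst u) \<le> 2 * extension_norm u"
  "extension_norm u \<le> norm (fst u) + cmod (snd u)"
proof -
  show s: "cmod (snd u) \<le> extension_norm u" by (simp add: extension_norm_def)
  have nn: "0 \<le> extension_norm u" using s norm_ge_zero order_trans by blast
  show "norm (fst u) \<le> 2 * extension_norm u"
  proof (rule norm_le_left_mult)
    fix x :: 'a
    have "norm (fst u * x) = norm (act u x - snd u *\<^sub>C x)" by (simp add: act_def)
    also have "\<dots> \<le> extension_norm u * norm x + cmod (snd u) * norm x"
      by (rule order_trans[OF norm_triangle_ineq4]) (simp add: norm_act_le norm_scaleC)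
    also have "\<dots> \<le> 2 * extension_norm u * norm x"
      using mult_right_mono[OF s norm_ge_zero[of x]] by (simp add: mult_ac)
    finally show "norm (fst u * x) \<le> 2 * extension_norm u * norm x" .
  qed (use nn in simp)
  have "onorm (act u) \<le> norm (fst u) + cmod (snd u)"
  proof (rule onorm_bound)
    fix x
    have "norm (act u x) \<le> norm (fst u * x) + norm (snd u *\<^sub>C x)"
      unfolding act_def by (rule norm_triangle_ineq)
    also have "\<dots> \<le> norm (fst u) * norm x + cmod (snd u) * norm x"
      by (intro add_mono norm_mult_ineq) (simp add: norm_scaleC)
    finally show "norm (act u x) \<le> (norm (fst u) + cmod (snd u)) * norm x"
      by (simp add: algebra_simps)
  qed simp
  then show "extension_norm u \<le> norm (fst u) + cmod (snd u)" by (simp add: extension_norm_def)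
qed

lemma extension_norm_eq_0: "extension_norm u = 0 \<longleftrightarrow> u = 0"
  using extension_norm_bounds[of u] extension_norm_bounds(3)[of 0] extension_norm_bounds(1)[of 0]
  by (cases u) (auto simp: zero_prod_def)

lemma extension_norm_triangle: "extension_norm (u + v) \<le> extension_norm u + extension_norm v"
proof -
  have "onorm (act (u + v)) \<le> onorm (act u) + onorm (act v)"
    unfolding act_simps(1) by (rule onorm_triangle[OF bounded_linear_act bounded_linear_act])
  moreover have "cmod (snd (u + v)) \<le> cmod (snd u) + cmod (snd v)" by (simp add: norm_triangle_ineq)
  ultimately show ?thesis unfolding extension_norm_def by linarith
qed

lemma extension_norm_mult:
  "extension_norm (fst u * fst v + snd v *\<^sub>C fst u + snd u *\<^sub>C fst v, snd u * snd v)
    \<le> extension_norm u * extension_norm v"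
proof -
  have "onorm (act u \<circ> act v) \<le> onorm (act u) * onorm (act v)"
    by (rule onorm_compose[OF bounded_linear_act bounded_linear_act])
  also have "\<dots> \<le> extension_norm u * extension_norm v"
    by (intro mult_mono) (auto simp: extension_norm_def onorm_pos_le[OF bounded_linear_act] le_max_iff_disj)
  finally have "onorm (act u \<circ> act v) \<le> extension_norm u * extension_norm v" .
  moreover have "cmod (snd u * snd v) \<le> extension_norm u * extension_norm v"
    unfolding norm_mult by (intro mult_mono extension_norm_bounds)
      (auto simp: extension_norm_def le_max_iff_disj)
  ultimately show ?thesis
    by (simp only: extension_norm_def[of "(_, _)"] act_simps(2) snd_conv max.bounded_iff)
qed

lemma extension_norm_scaleC: "extension_norm (c *\<^sub>C fst u, c * snd u) = cmod c * extension_norm u"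
  by (simp only: extension_norm_def act_simps(3) onorm_scaleC[OF bounded_linear_act] snd_conv norm_mult
      max_mult_distrib_left) simp

text \<open>
  The inequality \<open>\<parallel>u x\<parallel>\<^sup>2 = \<parallel>x* (u* u) x\<parallel> \<le> \<parallel>u* u\<parallel> \<parallel>x\<parallel>\<^sup>2\<close> bounds the square of the operator norm of \<open>u\<close>
  by the operator norm of \<open>u* u\<close>.
\<close>

lemma extension_norm_cstar:
  fixes u :: "'a::cstar_algebra \<times> complex"
  defines "s \<equiv> \<lambda>u. (star (fst u), cnj (snd u)) :: 'a \<times> complex"
  defines "m \<equiv> \<lambda>u v. (fst u * fst v + snd v *\<^sub>C fst u + snd u *\<^sub>C fst v, snd u * snd v) :: 'a \<times> complex"
  shows "extension_norm (m (s u) u) = (extension_norm u)\<^sup>2"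
proof -
  have act_m: "act (m v w) = act v \<circ> act w" for v w unfolding m_def by (rule act_simps)
  have on: "(onorm (act v))\<^sup>2 \<le> onorm (act (m (s v) v))" for v
  proof -
    have nn: "0 \<le> onorm (act (m (s v) v))" by (rule onorm_pos_le[OF bounded_linear_act])
    have "norm (act v x) \<le> sqrt (onorm (act (m (s v) v))) * norm x" for x
    proof -
      have "(norm (act v x))\<^sup>2 = norm (star x * act (m (s v) v) x)"
        by (simp add: cstar_identity[symmetric] star_act act_m s_def)
      also have "\<dots> \<le> norm x * (onorm (act (m (s v) v)) * norm x)"
        by (rule order_trans[OF norm_mult_ineq]) (simp add: mult_left_mono onorm bounded_linear_act)
      also have "\<dots> = (sqrt (onorm (act (m (s v) v))) * norm x)\<^sup>2"
        using nn by (simp add: power_mult_distrib power2_eq_square)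
      finally show ?thesis by (rule power2_le_imp_le) (simp add: nn)
    qed
    then have "onorm (act v) \<le> sqrt (onorm (act (m (s v) v)))" by (intro onorm_bound) (auto simp: nn)
    from power_mono[OF this onorm_pos_le[OF bounded_linear_act], of 2] show ?thesis
      by (simp add: nn)
  qed
  have comp: "onorm (act (m (s v) v)) \<le> onorm (act (s v)) * onorm (act v)" for v
    unfolding act_m by (rule onorm_compose[OF bounded_linear_act bounded_linear_act])
  have le: "onorm (act v) \<le> onorm (act (s v))" for v
  proof (cases "onorm (act v) = 0")
    case True
    then show ?thesis by (simp add: onorm_pos_le[OF bounded_linear_act])
  next
    case False
    then have "0 < onorm (act v)" using onorm_pos_le[OF bounded_linear_act, of v] by simp
    moreover have "onorm (act v) * onorm (act v) \<le> onorm (act (s v)) * onorm (act v)"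
      using on[of v] comp[of v] by (simp add: power2_eq_square)
    ultimately show ?thesis by simp
  qed
  have "s (s u) = u" by (simp add: s_def star_star)
  then have eq: "onorm (act (s u)) = onorm (act u)" using le[of u] le[of "s u"] by simp
  then have "onorm (act (m (s u) u)) = (onorm (act u))\<^sup>2"
    using on[of u] comp[of u] by (simp add: power2_eq_square)
  moreover have "cmod (snd (m (s u) u)) = (cmod (snd u))\<^sup>2"
    by (simp add: m_def s_def norm_mult power2_eq_square)
  ultimately have "extension_norm (m (s u) u) = max ((cmod (snd u))\<^sup>2) ((onorm (act u))\<^sup>2)"
    by (simp add: extension_norm_def)
  also have "\<dots> = (extension_norm u)\<^sup>2"
    using onorm_pos_le[OF bounded_linear_act, of u]
    by (cases "cmod (snd u) \<le> onorm (act u)") (auto simp: extension_norm_def max_def power_mono dest: power2_le_imp_le)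
  finally show ?thesis .
qed

instantiation unitization :: (cstar_algebra) complex_normed_vector
begin

lift_definition norm_unitization :: "'a unitization \<Rightarrow> real" is extension_norm .
lift_definition zero_unitization :: "'a unitization" is 0 .
lift_definition plus_unitization :: "'a unitization \<Rightarrow> 'a unitization \<Rightarrow> 'a unitization" is "(+)" .
lift_definition minus_unitization :: "'a unitization \<Rightarrow> 'a unitization \<Rightarrow> 'a unitization" is "(-)" .
lift_definition uminus_unitization :: "'a unitization \<Rightarrow> 'a unitization" is uminus .
lift_definition scaleC_unitization :: "complex \<Rightarrow> 'a unitization \<Rightarrow> 'a unitization"
  is "\<lambda>c u. (c *\<^sub>C fst u, c * snd u)" .
definition scaleR_unitization :: "real \<Rightarrow> 'a unitization \<Rightarrow> 'a unitization"
  where "scaleR_unitization r u = complex_of_real r *\<^sub>C u"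

definition dist_unitization :: "'a unitization \<Rightarrow> 'a unitization \<Rightarrow> real"
  where "dist_unitization u v = norm (u - v)"

definition uniformity_unitization :: "('a unitization \<times> 'a unitization) filter"
  where "uniformity_unitization = (INF e\<in>{0 <..}. principal {(u, v). dist u v < e})"

definition open_unitization :: "'a unitization set \<Rightarrow> bool"
  where "open_unitization S \<longleftrightarrow> (\<forall>u\<in>S. \<forall>\<^sub>F (u', v) in uniformity. u' = u \<longrightarrow> v \<in> S)"

definition sgn_unitization :: "'a unitization \<Rightarrow> 'a unitization"
  where "sgn_unitization u = inverse (norm u) *\<^sub>R u"

instance
proof
  fix u v w :: "'a unitization" and a b :: real and c d :: complex
  show "u + v + w = u + (v + w)" "u + v = v + u" "0 + u = u" "- u + u = 0" "u - v = u + - v"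
    by (transfer, simp add: algebra_simps)+
  show "a *\<^sub>R (u + v) = a *\<^sub>R u + a *\<^sub>R v" "(a + b) *\<^sub>R u = a *\<^sub>R u + b *\<^sub>R u"
    "a *\<^sub>R b *\<^sub>R u = (a * b) *\<^sub>R u" "1 *\<^sub>R u = u"
    unfolding scaleR_unitization_def
    by (transfer, simp add: algebra_simps scaleC_add_right scaleC_add_left scaleC_scaleC)+
  show "c *\<^sub>C (u + v) = c *\<^sub>C u + c *\<^sub>C v" "(c + d) *\<^sub>C u = c *\<^sub>C u + d *\<^sub>C u"
    "c *\<^sub>C d *\<^sub>C u = (c * d) *\<^sub>C u"
    by (transfer, simp add: algebra_simps scaleC_add_right scaleC_add_left scaleC_scaleC)+
  show "complex_of_real a *\<^sub>C u = a *\<^sub>R u"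
    by (simp add: scaleR_unitization_def)
  show nC: "norm (c *\<^sub>C u) = cmod c * norm u" for c
    by transfer (rule extension_norm_scaleC)
  show "norm (a *\<^sub>R u) = \<bar>a\<bar> * norm u"
    by (simp add: scaleR_unitization_def nC)
  show "(norm u = 0) = (u = 0)" by transfer (rule extension_norm_eq_0)
  show "norm (u + v) \<le> norm u + norm v" by transfer (rule extension_norm_triangle)
qed (simp_all add: dist_unitization_def uniformity_unitization_def open_unitization_def sgn_unitization_def)

end

instantiation unitization :: (cstar_algebra) unital_cstar_algebra
begin

lift_definition one_unitization :: "'a unitization" is "(0, 1)" .
lift_definition star_unitization :: "'a unitization \<Rightarrow> 'a unitization"
  is "\<lambda>u. (star (fst u), cnj (snd u))" .
lift_definition times_unitization :: "'a unitization \<Rightarrow> 'a unitization \<Rightarrow> 'a unitization"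
  is "\<lambda>u v. (fst u * fst v + snd v *\<^sub>C fst u + snd u *\<^sub>C fst v, snd u * snd v)" .

instance
proof
  fix u v w :: "'a unitization" and a :: real and c :: complex
  show "norm (u * v) \<le> norm u * norm v" by transfer (rule extension_norm_mult)
  show "norm (star u * u) = (norm u)\<^sup>2"
    by transfer (simp only: extension_norm_cstar[symmetric] fst_conv snd_conv)
  show "u * v * w = u * (v * w)"
    by transfer (simp add: algebra_simps scaleC_mult_left scaleC_mult_right scaleC_add_right scaleC_scaleC)
  show "1 * u = u" "u * 1 = u" by (transfer, simp)+
  show "(u + v) * w = u * w + v * w" "u * (v + w) = u * v + u * w"
    by (transfer, simp add: algebra_simps scaleC_add_right scaleC_add_left)+
  show "(a *\<^sub>R u) * v = a *\<^sub>R (u * v)" "u * (a *\<^sub>R v) = a *\<^sub>R (u * v)"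
    unfolding scaleR_unitization_def
    by (transfer, simp add: algebra_simps scaleC_mult_left scaleC_mult_right scaleC_add_right scaleC_scaleC)+
  show "(c *\<^sub>C u) * v = c *\<^sub>C (u * v)" "u * (c *\<^sub>C v) = c *\<^sub>C (u * v)"
    by (transfer, simp add: algebra_simps scaleC_mult_left scaleC_mult_right scaleC_add_right scaleC_scaleC)+
  show "star (u + v) = star u + star v" by transfer (simp add: star_add)
  show "star (c *\<^sub>C u) = cnj c *\<^sub>C star u" by transfer (simp add: star_scaleC)
  show "star (u * v) = star v * star u"
    by transfer (simp add: star_add star_mult star_scaleC algebra_simps)
  show "star (star u) = u" by transfer (simp add: star_star)
next
  fix X :: "nat \<Rightarrow> 'a unitization"
  assume X: "Cauchy X"
  have "Cauchy (\<lambda>n. fst (body (X n)))" "Cauchy (\<lambda>n. snd (body (X n)))"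
  proof -
    show "Cauchy (\<lambda>n. fst (body (X n)))"
    proof (rule metric_CauchyI)
      fix e :: real assume "0 < e"
      then obtain M where M: "\<And>m n. m \<ge> M \<Longrightarrow> n \<ge> M \<Longrightarrow> dist (X m) (X n) < e / 2"
        using metric_CauchyD[OF X, of "e/2"] by auto
      have "dist (fst (body (X m))) (fst (body (X n))) < e" if "m \<ge> M" "n \<ge> M" for m n
        using M[OF that] extension_norm_bounds(2)[of "body (X m) - body (X n)"]
        by (simp add: dist_unitization_def norm_unitization.rep_eq minus_unitization.rep_eq dist_norm)
      then show "\<exists>M. \<forall>m\<ge>M. \<forall>n\<ge>M. dist (fst (body (X m))) (fst (body (X n))) < e" by blast
    qed
    show "Cauchy (\<lambda>n. snd (body (X n)))"
    proof (rule metric_CauchyI)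
      fix e :: real assume "0 < e"
      then obtain M where M: "\<And>m n. m \<ge> M \<Longrightarrow> n \<ge> M \<Longrightarrow> dist (X m) (X n) < e"
        using metric_CauchyD[OF X] by blast
      have "dist (snd (body (X m))) (snd (body (X n))) < e" if "m \<ge> M" "n \<ge> M" for m n
        using M[OF that] extension_norm_bounds(1)[of "body (X m) - body (X n)"]
        by (simp add: dist_unitization_def norm_unitization.rep_eq minus_unitization.rep_eq dist_norm)
      then show "\<exists>M. \<forall>m\<ge>M. \<forall>n\<ge>M. dist (snd (body (X m))) (snd (body (X n))) < e" by blast
    qed
  qed
  then obtain a l where a: "(\<lambda>n. fst (body (X n))) \<longlonglongrightarrow> a" and l: "(\<lambda>n. snd (body (X n))) \<longlonglongrightarrow> l"
    by (auto simp: Cauchy_convergent_iff convergent_def)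
  have "(\<lambda>n. norm (fst (body (X n)) - a) + cmod (snd (body (X n)) - l)) \<longlonglongrightarrow> 0"
    using tendsto_add[OF tendsto_norm[OF LIM_zero[OF a]] tendsto_norm[OF LIM_zero[OF l]]] by simp
  then have "(\<lambda>n. norm (X n - Unitization (a, l))) \<longlonglongrightarrow> 0"
  proof (rule Lim_null_comparison[rotated])
    have "norm (X n - Unitization (a, l)) \<le> norm (fst (body (X n)) - a) + cmod (snd (body (X n)) - l)" for n
      using extension_norm_bounds(3)[of "body (X n) - (a, l)"]
      by (simp add: norm_unitization.rep_eq minus_unitization.rep_eq Unitization_inverse)
    then show "\<forall>\<^sub>F n in sequentially. norm (norm (X n - Unitization (a, l)))
        \<le> norm (fst (body (X n)) - a) + cmod (snd (body (X n)) - l)"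
      by (simp del: norm_unitization.rep_eq)
  qed
  then have "X \<longlonglongrightarrow> Unitization (a, l)"
    by (intro metric_LIMSEQ_I) (auto simp: dist_unitization_def dest!: order_tendstoD(2) simp: eventually_sequentially)
  then show "convergent X" by (auto simp: convergent_def)
qed

end

lemma unitize_simps:
  fixes a b :: "'a::cstar_algebra"
  shows "unitize (a + b) = unitize a + unitize b" "unitize (a - b) = unitize a - unitize b"
    "unitize (- a) = - unitize a" "unitize 0 = (0::'a unitization)" "unitize (c *\<^sub>C a) = c *\<^sub>C unitize a"
    "unitize (a * b) = unitize a * unitize b" "unitize (star a) = star (unitize a)"
  by (simp_all add: body_inject[symmetric] unitize.rep_eq plus_unitization.rep_eq minus_unitization.rep_eq
      uminus_unitization.rep_eq zero_unitization.rep_eq scaleC_unitization.rep_eq times_unitization.rep_eq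
      star_unitization.rep_eq zero_prod_def)

lemma unitize_scaleR: "unitize (r *\<^sub>R a) = r *\<^sub>R unitize (a::'a::cstar_algebra)"
  by (simp add: complex_normed_scaleR unitize_simps)

lemma unitize_eq_iff: "unitize a = unitize b \<longleftrightarrow> a = b"
  by transfer simp

lemma norm_unitize [simp]: "norm (unitize a) = norm (a::'a::cstar_algebra)"
proof transfer
  fix a :: 'a
  have "act (a, 0) = (*) a" by (simp add: act_def fun_eq_iff)
  then show "extension_norm (a, 0) = norm a"
    by (simp add: extension_norm_def onorm_left_mult)
qed

lemma scalar_part_simps:
  fixes u v :: "'a::cstar_algebra unitization"
  shows "scalar_part (u * v) = scalar_part u * scalar_part v" "scalar_part (unitize a) = 0"
    "scalar_part (c *\<^sub>C u) = c * scalar_part u"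
  by (transfer, simp)+

lemma unitize_surj: "scalar_part u = 0 \<Longrightarrow> \<exists>a. u = unitize a"
  by transfer auto

lemma selfadjoint_unitize: "selfadjoint (unitize a) \<longleftrightarrow> selfadjoint a"
  by (simp add: selfadjoint_def unitize_eq_iff flip: unitize_simps)

section \<open>Positivity in C*-algebras without unit\<close>

definition cstar_positive :: "'a::cstar_algebra \<Rightarrow> bool"
  where "cstar_positive a \<longleftrightarrow> pos_elt (unitize a)"

lemma cstar_positive_selfadjoint: "cstar_positive a \<Longrightarrow> selfadjoint a"
  by (auto simp: cstar_positive_def pos_elt_def selfadjoint_unitize)

lemma cstar_positive_zero [simp]: "cstar_positive 0"
  by (simp add: cstar_positive_def unitize_simps)

lemma cstar_positive_add: "cstar_positive a \<Longrightarrow> cstar_positive b \<Longrightarrow> cstar_positive (a + b)"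
  by (simp add: cstar_positive_def unitize_simps pos_elt_add)

lemma cstar_positive_scaleR: "cstar_positive a \<Longrightarrow> 0 \<le> r \<Longrightarrow> cstar_positive (r *\<^sub>R a)"
  by (simp add: cstar_positive_def unitize_scaleR pos_elt_scaleR)

lemma cstar_positive_star_mult [simp]: "cstar_positive (star a * a)"
  by (simp add: cstar_positive_def unitize_simps pos_elt_star_mult)

lemma cstar_positive_mult_star [simp]: "cstar_positive (a * star a)"
  using cstar_positive_star_mult[of "star a"] by (simp add: star_star)

text \<open>
  This monotonicity of the norm is dual to the existence of positive functionals above a given one.
\<close>

lemma norm_positive_mono:
  assumes "cstar_positive a" "cstar_positive b"
  shows "norm a \<le> norm (a + b)"
proof -
  have "norm (unitize a) \<le> norm (unitize (a + b))"
    by (rule norm_pos_elt_mono) (use assms in \<open>simp_all add: cstar_positive_def unitize_simps\<close>)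
  then show ?thesis by simp
qed

lemma cstar_positive_sum: "(\<And>x. x \<in> X \<Longrightarrow> cstar_positive (f x)) \<Longrightarrow> cstar_positive (\<Sum>x\<in>X. f x)"
  by (induction X rule: infinite_finite_induct) (auto intro: cstar_positive_add)

text \<open>
  Finitely many elements are treated at once by inserting \<open>k = \<Sum> x x*\<close> into
  \<open>approximate_unit_element\<close>: each \<open>x x*\<close> lies below \<open>k\<close>.  The element \<open>e = 1 - u\<close> is a multiple of \<open>k u\<close>
  and so belongs to the algebra itself.
\<close>

lemma approximate_unit:
  fixes F :: "'a::cstar_algebra set"
  assumes F: "finite F" and d: "0 < d"
  obtains e where "cstar_positive e" "pos_elt (1 - unitize e)" "norm e \<le> 1" "\<And>x. x \<in> F \<Longrightarrow> norm (x - e * x) \<le> d"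
proof -
  define k where "k = (\<Sum>x\<in>F. x * star x)"
  have k: "cstar_positive k" unfolding k_def by (intro cstar_positive_sum) simp
  obtain u where u: "selfadjoint u" "pos_elt u" "pos_elt (1 - u)"
    "norm (u * unitize k * u) \<le> 1 / (1 / d\<^sup>2)" "1 - u = (1 / d\<^sup>2) *\<^sub>R (unitize k * u)"
    using approximate_unit_element[of "unitize k" "1 / d\<^sup>2"] k d by (auto simp: cstar_positive_def)
  have "scalar_part (1 - u) = 0"
    unfolding u(5) by (simp add: complex_normed_scaleR scalar_part_simps)
  then obtain e where e: "1 - u = unitize e" using unitize_surj by blast
  then have ue: "u = 1 - unitize e" by (simp add: algebra_simps)
  have "norm (x - e * x) \<le> d" if x: "x \<in> F" for x
  proof -
    have ux: "unitize (x - e * x) = u * unitize x" by (simp add: ue unitize_simps left_diff_distrib)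
    have "k - x * star x = (\<Sum>y\<in>F - {x}. y * star y)"
      unfolding k_def using sum.remove[OF F x, of "\<lambda>y. y * star y"] by simp
    then have "cstar_positive (k - x * star x)" by (simp only:) (intro cstar_positive_sum; simp)
    then have "pos_elt (star u * (unitize k - unitize x * star (unitize x)) * u)"
      by (intro pos_elt_conj) (simp add: cstar_positive_def unitize_simps)
    moreover have "pos_elt (star u * (unitize x * star (unitize x)) * u)"
      using cstar_positive_mult_star[of x] by (intro pos_elt_conj) (simp add: cstar_positive_def unitize_simps)
    ultimately have le: "norm (u * (unitize x * star (unitize x)) * u) \<le> norm (u * unitize k * u)"
      using u(1) by (intro norm_pos_elt_mono) (simp_all add: selfadjoint_def algebra_simps)
    have "(norm (star (u * unitize x)))\<^sup>2 = norm (u * (unitize x * star (unitize x)) * u)"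
      using u(1) unfolding cstar_identity[symmetric]
      by (simp add: star_mult star_star selfadjoint_def mult.assoc)
    also have "\<dots> \<le> d\<^sup>2" using le u(4) by simp
    finally have "norm (u * unitize x) \<le> d" using d by (simp add: power2_le_iff_abs_le)
    then show ?thesis unfolding ux[symmetric] by simp
  qed
  moreover have "cstar_positive e" using u(3) e by (simp add: cstar_positive_def)
  moreover have "norm e \<le> 1"
    using pos_elt_norm_le[of "unitize e" 1] u(2,3) ue e by simp
  ultimately show ?thesis using u(2) by (intro that[of e]) (auto simp: ue)
qed

section \<open>Positive functionals\<close>

lemma dual_cone_iff: "f \<in> dual_cone \<longleftrightarrow> (\<forall>a. cdual_apply f (star a * a) \<in> \<real>\<^sub>\<ge>\<^sub>0)"
  using cdual_apply[of f] by (simp add: dual_cone_def positive_functional_def bounded_clinear_def)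

lemma dual_cone_Re: "f \<in> dual_cone \<Longrightarrow> 0 \<le> Re (cdual_apply f (star a * a))"
  unfolding dual_cone_iff by (metis complex_nonneg_Reals_iff)

lemma dual_cone_Im: "f \<in> dual_cone \<Longrightarrow> Im (cdual_apply f (star a * a)) = 0"
  unfolding dual_cone_iff by (metis complex_nonneg_Reals_iff)

text \<open>
  Compare the imaginary parts of the cross terms in \<open>star (a + \<i> b) * (a + \<i> b)\<close>, where a positive
  functional is real.
\<close>

lemma dual_cone_polarization:
  assumes f: "f \<in> dual_cone"
  shows "Re (cdual_apply f (star a * b)) = Re (cdual_apply f (star b * a))"
proof -
  have "star (a + \<i> *\<^sub>C b) * (a + \<i> *\<^sub>C b) = star a * a + \<i> *\<^sub>C (star a * b) - \<i> *\<^sub>C (star b * a) + star b * b"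
    by (simp add: star_add star_scaleC scaleC_mult_left scaleC_mult_right distrib_left distrib_right
        scaleC_scaleC scaleC_diff_right scaleC_add_right left_diff_distrib)
  then have "Im (cdual_apply f (star a * a + \<i> *\<^sub>C (star a * b) - \<i> *\<^sub>C (star b * a) + star b * b)) = 0"
    using dual_cone_Im[OF f, of "a + \<i> *\<^sub>C b"] by simp
  then show ?thesis
    by (simp add: cdual_add cdual_diff cdual_scaleC dual_cone_Im[OF f])
qed

lemma cdual_norm_almost_attained:
  fixes f :: "'a::complex_normed_vector cdual"
  assumes e: "0 < e"
  obtains x where "norm x \<le> 1" "norm f - e \<le> Re (cdual_apply f x)"
proof (cases "norm f - e \<le> 0")
  case True
  then show ?thesis by (intro that[of 0]) (auto simp: cdual_zero)
next
  case False
  then obtain y where y: "norm y \<le> 1" "norm f - e \<le> norm (cdual_apply f y)"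
    using bounded_linear_large_on_ball[OF cdual_apply_bounded_linear, of 1 "norm f - e" f 0] e
    by (auto simp: norm_cdual.rep_eq)
  define z where "z = cdual_apply f y"
  have z: "z \<noteq> 0" using y False by (auto simp: z_def)
  have "(cnj z / norm z) * z = norm z"
    using z by (simp add: complex_norm_square[symmetric] mult.commute power2_eq_square)
  then have "Re (cdual_apply f ((cnj z / norm z) *\<^sub>C y)) = norm z"
    by (simp only: cdual_scaleC z_def[symmetric] Re_complex_of_real)
  moreover have "norm ((cnj z / norm z) *\<^sub>C y) \<le> 1"
    using z y by (simp add: norm_scaleC norm_divide)
  ultimately show ?thesis using y by (intro that) (auto simp: z_def)
qed

text \<open>
  The norm of a positive functional is the limit of its values at the squares of an approximate
  unit.  Since one element can serve two functionals at once, the norm is additive.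
\<close>

lemma norm_additive_on_dual_cone:
  fixes f g :: "'a::cstar_algebra cdual"
  assumes f: "f \<in> dual_cone" and g: "g \<in> dual_cone"
  shows "norm f + norm g \<le> norm (f + g)"
proof (rule field_le_epsilon)
  fix e0 :: real assume e0: "0 < e0"
  define e where "e = e0 / 8"
  have e: "0 < e" using e0 by (simp add: e_def)
  define d where "d = e / (norm f + norm g + 1)"
  have d: "0 < d" using e by (simp add: d_def add_nonneg_pos)
  obtain x where x: "norm x \<le> 1" "norm f - e \<le> Re (cdual_apply f x)"
    using cdual_norm_almost_attained[OF e] by blast
  obtain y where y: "norm y \<le> 1" "norm g - e \<le> Re (cdual_apply g y)"
    using cdual_norm_almost_attained[OF e] by blast
  have "finite {x, y}" by simp
  then obtain u where u: "cstar_positive u" "norm u \<le> 1" and "\<And>z. z \<in> {x, y} \<Longrightarrow> norm (z - u * z) \<le> d"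
    using approximate_unit[OF _ d] by blast
  then have ux: "norm (x - u * x) \<le> d" and uy: "norm (y - u * y) \<le> d" by auto
  have su: "star u = u" using cstar_positive_selfadjoint[OF u(1)] by (simp add: selfadjoint_def)
  have key: "norm h - 4 * e \<le> Re (cdual_apply h (u * u))"
    if h: "h \<in> dual_cone" and z: "norm z \<le> 1" "norm h - e \<le> Re (cdual_apply h z)"
      and uz: "norm (z - u * z) \<le> d" and nh: "norm h \<le> norm f + norm g" for h z
  proof -
    have "Re (cdual_apply h (z - u * z)) \<le> norm h * norm (z - u * z)"
      using norm_cdual_apply[of h "z - u * z"] complex_Re_le_cmod order_trans by blast
    also have "\<dots> \<le> (norm f + norm g + 1) * d"
      using nh uz d by (intro mult_mono) auto
    also have "\<dots> = e" by (simp add: d_def add_nonneg_eq_0_iff)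
    finally have 1: "Re (cdual_apply h z) - e \<le> Re (cdual_apply h (u * z))" by (simp add: cdual_diff)
    have "0 \<le> Re (cdual_apply h (star (z - u) * (z - u)))" by (rule dual_cone_Re[OF h])
    also have "star (z - u) * (z - u) = star z * z - star z * u - star u * z + u * u"
      by (simp add: star_diff su algebra_simps)
    also have "Re (cdual_apply h \<dots>)
        = Re (cdual_apply h (star z * z)) - 2 * Re (cdual_apply h (u * z)) + Re (cdual_apply h (u * u))"
      using dual_cone_polarization[OF h, of z u] by (simp add: cdual_add cdual_diff su)
    finally have 2: "2 * Re (cdual_apply h (u * z)) \<le> Re (cdual_apply h (star z * z)) + Re (cdual_apply h (u * u))"
      by simp
    have "Re (cdual_apply h (star z * z)) \<le> norm h * norm (star z * z)"
      using norm_cdual_apply[of h "star z * z"] complex_Re_le_cmod order_trans by blast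
    also have "\<dots> \<le> norm h * 1"
      using z(1) by (intro mult_left_mono) (auto simp: cstar_identity power_le_one)
    finally show ?thesis using 1 2 z(2) by linarith
  qed
  have "Re (cdual_apply (f + g) (u * u)) \<le> norm (f + g) * norm (u * u)"
    using norm_cdual_apply[of "f + g" "u * u"] complex_Re_le_cmod order_trans by blast
  also have "\<dots> \<le> norm (f + g) * 1"
    using u(2) cstar_identity[of u] by (intro mult_left_mono) (auto simp: su power_le_one)
  finally have "Re (cdual_apply f (u * u)) + Re (cdual_apply g (u * u)) \<le> norm (f + g)"
    by (simp add: plus_cdual.rep_eq)
  then show "norm f + norm g \<le> norm (f + g) + e0"
    using key[OF f x ux] key[OF g y uy] by (simp add: e_def)
qed

definition cdual_star :: "'a::cstar_algebra cdual \<Rightarrow> 'a cdual"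
  where "cdual_star f = Cdual (\<lambda>x. cnj (cdual_apply f (star x)))"

lemma cdual_star_apply: "cdual_apply (cdual_star f) x = cnj (cdual_apply f (star x))"
proof -
  have "bounded_clinear (\<lambda>x. cnj (cdual_apply f (star x)))"
    by (rule bounded_clinearI[of _ "norm f"])
      (auto simp: star_add star_scaleC cdual_add cdual_scaleC scaleC_complex_def mult.commute
        intro: order_trans[OF norm_cdual_apply])
  then show ?thesis by (simp add: cdual_star_def Cdual_inverse)
qed

text \<open>
  A positive functional \<open>p \<ge> f\<close> is found by applying the Hahn--Banach theorem to the infimum of
  \<open>C \<parallel>x + y + z\<parallel> - f(y)\<close> over positive \<open>y\<close> and \<open>z\<close>.  Inserting \<open>x = - z\<close> and \<open>x = - y\<close> shows that a
  linear functional below this infimum is positive and dominates \<open>f\<close> on the cone.  The infimum is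
  finite because the norm is monotone on the cone.
\<close>

lemma hermitian_functional_decomposition:
  fixes f :: "'a::cstar_algebra cdual"
  assumes f: "cdual_star f = f"
  obtains g h where "g \<in> dual_cone" "h \<in> dual_cone" "f = g - h"
proof -
  define C where "C = norm f"
  define K where "K = {yz :: 'a \<times> 'a. cstar_positive (fst yz) \<and> cstar_positive (snd yz)}"
  define F where "F x yz = C * norm (x + fst yz + snd yz) - Re (cdual_apply f (fst yz))" for x and yz :: "'a \<times> 'a"
  have K0: "0 \<in> K" by (simp add: K_def)
  have lower: "- C * norm x \<le> F x yz" if "yz \<in> K" for x yz
  proof -
    have "Re (cdual_apply f (fst yz)) \<le> C * norm (fst yz)"
      unfolding C_def using norm_cdual_apply complex_Re_le_cmod order_trans by blast
    also have "\<dots> \<le> C * norm (fst yz + snd yz)"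
      using that by (intro mult_left_mono norm_positive_mono) (auto simp: K_def C_def)
    also have "\<dots> \<le> C * (norm (x + fst yz + snd yz) + norm x)"
      using norm_triangle_ineq4[of "x + fst yz + snd yz" x] by (intro mult_left_mono) (auto simp: C_def algebra_simps)
    finally show ?thesis by (simp add: F_def algebra_simps)
  qed
  have bdd: "bdd_below (F x ` K)" for x
    using lower[of _ x] by (intro bdd_belowI2)
  have "sublinear (\<lambda>x. INF yz\<in>K. F x yz)"
  proof (rule sublinear_INF[OF K0 _ _ bdd])
    fix x y and k l :: "'a \<times> 'a"
    have "norm ((x + fst k + snd k) + (y + fst l + snd l)) \<le> norm (x + fst k + snd k) + norm (y + fst l + snd l)"
      by (rule norm_triangle_ineq)
    from mult_left_mono[OF this, of C] show "F (x + y) (k + l) \<le> F x k + F y l"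
      by (simp add: F_def C_def cdual_add algebra_simps)
  next
    fix c :: real and x and k :: "'a \<times> 'a" assume "0 \<le> c"
    then show "F (c *\<^sub>R x) (c *\<^sub>R k) = c * F x k"
      by (simp add: F_def cdual_scaleR right_diff_distrib flip: scaleR_add_right)
  qed (auto simp: K_def cstar_positive_add cstar_positive_scaleR)
  then obtain g where g: "linear g" "\<And>x. g x \<le> (INF yz\<in>K. F x yz)"
    using sublinear_dominates_linear by blast
  have gF: "g x \<le> F x yz" if "yz \<in> K" for x yz
    using g(2)[of x] cINF_lower[OF bdd that, of x] by linarith
  have gC: "g x \<le> C * norm x" for x using gF[OF K0, of x] by (simp add: F_def cdual_zero)
  have gf: "Re (cdual_apply f y) \<le> g y" "0 \<le> g y" if "cstar_positive y" for y
    using gF[of "(y, 0)" "- y"] gF[of "(0, y)" "- y"] that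
    by (auto simp: K_def F_def linear_neg[OF g(1)] cdual_zero)
  have "linear (\<lambda>x. g (re_part x))"
    by (rule linearI) (simp_all add: re_part_add re_part_scaleR linear_add[OF g(1)] linear_scale[OF g(1)])
  moreover have "g (re_part x) \<le> C * norm x" for x
    using gC[of "re_part x"] mult_left_mono[OF norm_re_part[of x], of C] by (simp add: C_def)
  moreover have "0 \<le> C" by (simp add: C_def)
  ultimately obtain p :: "'a cdual" where p: "\<And>x. Re (cdual_apply p x) = g (re_part x)"
    using complexify_functional[of "\<lambda>x. g (re_part x)" C] by blast
  have Re_p: "Re (cdual_apply p (star a * a)) = g (star a * a)" for a
    by (simp add: p re_part_selfadjoint)
  have Im_p: "Im (cdual_apply p (star a * a)) = 0" for a
  proof -
    have "re_part (\<i> *\<^sub>C (star a * a)) = 0"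
      by (simp add: re_part_def star_scaleC star_mult star_star)
    then show ?thesis using p[of "\<i> *\<^sub>C (star a * a)"] linear_0[OF g(1)] by (simp add: cdual_scaleC)
  qed
  have Im_f: "Im (cdual_apply f (star a * a)) = 0" for a
    using cdual_star_apply[of f "star a * a"] by (simp add: f star_mult star_star complex_eq_iff)
  have "p \<in> dual_cone"
    unfolding dual_cone_iff by (auto simp: complex_nonneg_Reals_iff Re_p Im_p gf)
  moreover have "p - f \<in> dual_cone"
    unfolding dual_cone_iff by (auto simp: complex_nonneg_Reals_iff Re_p Im_p Im_f gf minus_cdual.rep_eq)
  moreover have "f = p - (p - f)" by simp
  ultimately show ?thesis by (rule that)
qed

lemma dual_cone_generating:
  fixes f :: "'a::cstar_algebra cdual"
  obtains a b c d where "a \<in> dual_cone" "b \<in> dual_cone" "c \<in> dual_cone" "d \<in> dual_cone"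
    "f = (a - b) + \<i> *\<^sub>C (c - d)"
proof -
  define f1 where "f1 = (1/2) *\<^sub>C (f + cdual_star f)"
  define f2 where "f2 = (- \<i> / 2) *\<^sub>C (f - cdual_star f)"
  have "cdual_star f1 = f1" "cdual_star f2 = f2"
    by (rule cdual_eqI; simp add: f1_def f2_def cdual_star_apply scaleC_cdual.rep_eq plus_cdual.rep_eq
        minus_cdual.rep_eq uminus_cdual.rep_eq star_star algebra_simps)+
  then obtain a b c d where "a \<in> dual_cone" "b \<in> dual_cone" "c \<in> dual_cone" "d \<in> dual_cone"
    "f1 = a - b" "f2 = c - d" using hermitian_functional_decomposition by metis
  moreover have "f = f1 + \<i> *\<^sub>C f2"
    by (rule cdual_eqI) (simp add: f1_def f2_def scaleC_cdual.rep_eq plus_cdual.rep_eq minus_cdual.rep_eq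
        uminus_cdual.rep_eq algebra_simps)
  ultimately show ?thesis by (intro that) auto
qed

lemma dual_cone_convex_cone:
  "f \<in> dual_cone \<Longrightarrow> g \<in> dual_cone \<Longrightarrow> f + g \<in> dual_cone"
  "f \<in> dual_cone \<Longrightarrow> 0 \<le> r \<Longrightarrow> r *\<^sub>R f \<in> dual_cone"
  by (auto simp: dual_cone_iff plus_cdual.rep_eq scaleR_cdual_def scaleC_cdual.rep_eq complex_nonneg_Reals_iff)

lemma zero_in_dual_cone: "0 \<in> dual_cone"
  by (simp add: dual_cone_iff zero_cdual.rep_eq)

lemma bounded_linear_cdual_eval: "bounded_linear (\<lambda>f. cdual_apply f x)"
  by (rule bounded_linear_intro[of _ "norm x"])
    (auto simp: plus_cdual.rep_eq scaleR_cdual_def scaleC_cdual.rep_eq norm_cdual_apply scaleR_conv_of_real)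

lemma closed_dual_cone: "closed (dual_cone :: 'a::cstar_algebra cdual set)"
proof -
  have "(dual_cone :: 'a cdual set) = (\<Inter>a. (\<lambda>f. cdual_apply f (star a * a)) -` \<real>\<^sub>\<ge>\<^sub>0)"
    by (auto simp: dual_cone_iff)
  moreover have "closed (\<Inter>a::'a. (\<lambda>f. cdual_apply f (star a * a)) -` \<real>\<^sub>\<ge>\<^sub>0)"
    by (intro closed_INT ballI closed_vimage closed_nonneg_Reals_complex
        linear_continuous_on bounded_linear_cdual_eval)
  ultimately show ?thesis by simp
qed

section \<open>Algebras with a predual\<close>

text \<open>
  Completeness turns approximate corrections into exact ones: if the error \<open>f\<close> can always be halved
  by a move of length at most a fixed multiple of it, then the moves are summable.
\<close>

lemma iterate_halving:
  fixes f :: "'a::complete_space \<Rightarrow> real"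
  assumes S: "closed S" "s0 \<in> S" and f: "continuous_on S f" "\<And>s. 0 \<le> f s" and c: "0 \<le> c"
    and step: "\<And>s. s \<in> S \<Longrightarrow> \<exists>s'\<in>S. dist s s' \<le> c * f s \<and> f s' \<le> f s / 2"
  obtains s where "s \<in> S" "f s = 0" "dist s0 s \<le> 2 * c * f s0"
proof -
  have "\<exists>x. \<forall>n. (x n \<in> S \<and> (n = 0 \<longrightarrow> x n = s0)) \<and> (dist (x n) (x (Suc n)) \<le> c * f (x n) \<and> f (x (Suc n)) \<le> f (x n) / 2)"
    by (rule dependent_nat_choice) (use S step in auto)
  then obtain x where xS: "\<And>n. x n \<in> S" and x0: "x 0 = s0"
    and dx: "\<And>n. dist (x n) (x (Suc n)) \<le> c * f (x n)" and fx: "\<And>n. f (x (Suc n)) \<le> f (x n) / 2"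
    by blast
  have fn: "f (x n) \<le> f s0 / 2 ^ n" for n
    by (induction n) (use fx x0 in \<open>auto intro: order_trans[OF fx]\<close>)
  have far: "dist (x n) (x (n + m)) \<le> 2 * c * f (x n)" for n m
  proof (induction m arbitrary: n)
    case (Suc m)
    have "dist (x n) (x (n + Suc m)) \<le> dist (x n) (x (Suc n)) + dist (x (Suc n)) (x (Suc n + m))"
      using dist_triangle[of "x n" "x (n + Suc m)" "x (Suc n)"] by simp
    also have "\<dots> \<le> c * f (x n) + 2 * c * (f (x n) / 2)"
      by (intro add_mono dx order_trans[OF Suc] mult_left_mono fx) (use c in auto)
    finally show ?case by simp
  qed (use f c in auto)
  have lim: "(\<lambda>n. f s0 / 2 ^ n) \<longlonglongrightarrow> 0"
    using tendsto_mult_right_zero[OF LIMSEQ_power_zero[of "1/2::real"], of "f s0"] by (simp add: power_divide)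
  have "Cauchy x"
  proof (rule metric_CauchyI)
    fix e :: real assume e: "0 < e"
    have "(\<lambda>n. 2 * c * (f s0 / 2 ^ n)) \<longlonglongrightarrow> 0" by (rule tendsto_mult_right_zero[OF lim])
    then have "\<forall>\<^sub>F n in sequentially. 2 * c * (f s0 / 2 ^ n) < e / 2"
      by (rule order_tendstoD) (use e in simp)
    then obtain N where N: "2 * c * (f s0 / 2 ^ N) < e / 2"
      unfolding eventually_sequentially by blast
    have "dist (x N) (x n) < e / 2" if "n \<ge> N" for n
    proof -
      have "dist (x N) (x (N + (n - N))) \<le> 2 * c * (f s0 / 2 ^ N)"
        by (rule order_trans[OF far]) (intro mult_left_mono fn, use c in auto)
      then show ?thesis using N that by simp
    qed
    then show "\<exists>M. \<forall>m\<ge>M. \<forall>n\<ge>M. dist (x m) (x n) < e"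
      by (intro exI[of _ N] allI impI) (metis dist_commute dist_triangle_half_l)
  qed
  then obtain s where s: "x \<longlonglongrightarrow> s" by (auto simp: Cauchy_convergent_iff convergent_def)
  have sS: "s \<in> S" by (rule closed_sequentially[OF S(1) xS s])
  have "(\<lambda>n. f (x n)) \<longlonglongrightarrow> f s"
    by (rule continuous_on_tendsto_compose[OF f(1) s sS]) (simp add: xS)
  moreover have "(\<lambda>n. f (x n)) \<longlonglongrightarrow> 0"
    by (rule tendsto_sandwich[OF _ _ tendsto_const lim]) (use f(2) fn in auto)
  ultimately have "f s = 0" by (rule LIMSEQ_unique)
  moreover have "dist s0 s \<le> 2 * c * f s0"
    by (rule Lim_bounded[OF tendsto_dist[OF tendsto_const s], of 0]) (use far[of 0] x0 in auto)
  ultimately show ?thesis using sS by (intro that)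
qed

text \<open>
  Expand \<open>0 \<le> f ((x - e)* (x - e))\<close> at a contraction \<open>x\<close> at which \<open>f\<close> almost attains its norm.
\<close>

lemma norm_functional_le_at_unit:
  fixes f :: "'a::cstar_algebra cdual"
  assumes f: "f \<in> dual_cone" and e: "star e = e" "\<And>b. e * b = b" "\<And>b. b * e = b"
  shows "norm f \<le> Re (cdual_apply f e)"
proof (rule field_le_epsilon)
  fix d :: real assume d: "0 < d"
  obtain x where x: "norm x \<le> 1" "norm f - d / 2 \<le> Re (cdual_apply f x)"
    using cdual_norm_almost_attained[of "d / 2" f] d by auto
  have "0 \<le> Re (cdual_apply f (star (x - e) * (x - e)))" by (rule dual_cone_Re[OF f])
  also have "star (x - e) * (x - e) = star x * x - star x * e - star e * x + e"
    by (simp add: star_diff e algebra_simps)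
  also have "Re (cdual_apply f \<dots>)
      = Re (cdual_apply f (star x * x)) - 2 * Re (cdual_apply f x) + Re (cdual_apply f e)"
    using dual_cone_polarization[OF f, of x e] by (simp add: cdual_add cdual_diff e)
  finally have "2 * Re (cdual_apply f x) \<le> Re (cdual_apply f (star x * x)) + Re (cdual_apply f e)" by simp
  moreover have "Re (cdual_apply f (star x * x)) \<le> norm f * norm (star x * x)"
    using norm_cdual_apply[of f "star x * x"] complex_Re_le_cmod order_trans by blast
  moreover have "norm f * norm (star x * x) \<le> norm f * 1"
    using x(1) by (intro mult_left_mono) (auto simp: cstar_identity power_le_one)
  ultimately show "norm f \<le> Re (cdual_apply f e) + d" using x(2) by simp
qed

locale predual =
  fixes \<iota> :: "'a::cstar_algebra \<Rightarrow> 'p::complex_banach cdual"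
  assumes is_predual: "is_predual \<iota>"
begin

abbreviation ev :: "'a \<Rightarrow> 'p \<Rightarrow> complex"
  where "ev a \<equiv> cdual_apply (\<iota> a)"

lemma ev_simps:
  "ev (a + b) x = ev a x + ev b x" "ev (c *\<^sub>C a) x = c * ev a x" "ev (- a) x = - ev a x"
  "ev (a - b) x = ev a x - ev b x" "ev (r *\<^sub>R a) x = r * ev a x" "ev 0 x = 0"
proof -
  have add: "\<iota> (a + b) = \<iota> a + \<iota> b" and sc: "\<iota> (c *\<^sub>C a) = c *\<^sub>C \<iota> a" for a b c
    using is_predual by (auto simp: is_predual_def clinear_def)
  show 1: "ev (a + b) x = ev a x + ev b x" and 2: "ev (c *\<^sub>C a) x = c * ev a x" for a b c
    by (simp_all add: add sc plus_cdual.rep_eq scaleC_cdual.rep_eq)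
  show m: "ev (- a) x = - ev a x" for a using 2[of "-1" a] by simp
  show "ev (a - b) x = ev a x - ev b x" using 1[of a "- b"] m by simp
  show "ev (r *\<^sub>R a) x = r * ev a x" using 2[of "of_real r" a] by (simp add: complex_normed_scaleR)
  show "ev 0 x = 0" using 2[of 0 0] by simp
qed

lemma norm_ev_le: "cmod (ev a x) \<le> norm a * norm x"
  using norm_cdual_apply[of "\<iota> a" x] is_predual by (simp add: is_predual_def)

lemma Re_ev_le: "Re (ev a x) \<le> norm a * norm x"
  using norm_ev_le complex_Re_le_cmod order_trans by blast

lemma norm_le_ev:
  assumes "0 \<le> r" "\<And>x. cmod (ev a x) \<le> r * norm x"
  shows "norm a \<le> r"
  using norm_cdual_le[OF assms] is_predual by (simp add: is_predual_def)

lemma ev_inj: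
  assumes "\<And>x. Re (ev a x) = Re (ev b x)"
  shows "a = b"
proof -
  have "ev (a - b) x = 0" for x
    using assms[of x] assms[of "\<i> *\<^sub>C x"] by (simp add: ev_simps cdual_scaleC complex_eq_iff)
  then have "norm (a - b) \<le> 0" by (intro norm_le_ev) auto
  then show ?thesis by simp
qed

lemma linear_functional_is_ev:
  assumes g: "linear g" and K: "0 \<le> K" "\<And>x. g x \<le> K * norm x"
  obtains a where "\<And>x. Re (ev a x) = g x" "norm a \<le> K"
proof -
  obtain f :: "'p cdual" where f: "\<And>x. Re (cdual_apply f x) = g x" "norm f \<le> K"
    using complexify_functional[OF g K] by blast
  obtain a where "f = \<iota> a" using is_predual by (auto simp: is_predual_def surj_def)
  with f is_predual show ?thesis by (intro that[of a]) (auto simp: is_predual_def)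
qed

subsection \<open>Weak* compactness\<close>

definition weak_ball :: "'a \<Rightarrow> real \<Rightarrow> ('p \<Rightarrow> complex) set"
  where "weak_ball b r = {f. \<forall>x. cmod (f x - ev b x) \<le> r * norm x}"

lemma ev_in_weak_ball_iff: "0 \<le> r \<Longrightarrow> ev a \<in> weak_ball b r \<longleftrightarrow> norm (a - b) \<le> r"
  using norm_le_ev[of r "a - b"] order_trans[OF norm_ev_le[of "a - b"] mult_right_mono[OF _ norm_ge_zero]]
  by (auto simp: weak_ball_def ev_simps)

lemma continuous_on_coordinate: "continuous_on S (\<lambda>f::'p \<Rightarrow> complex. f x)"
  by (rule continuous_on_subset[OF continuous_on_product_coordinates]) simp

lemma closed_weak_ball: "closed (weak_ball b r)"
proof -
  have "weak_ball b r = (\<Inter>x. {f. cmod (f x - ev b x) \<le> r * norm x})"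
    by (auto simp: weak_ball_def)
  moreover have "closed (\<Inter>x. {f. cmod (f x - ev b x) \<le> r * norm x})"
    by (intro closed_INT ballI closed_Collect_le continuous_intros continuous_on_coordinate)
  ultimately show ?thesis by simp
qed

text \<open>
  The Banach--Alaoglu theorem: the unit ball is a closed subset of a product of discs.
\<close>

lemma compact_ev_unit_ball: "compact (ev ` {a. norm a \<le> 1})"
proof -
  define C where "C = {f :: 'p \<Rightarrow> complex. \<forall>x. f x \<in> cball 0 (norm x)}"
  define L where "L = {f :: 'p \<Rightarrow> complex. \<forall>x y c. f (x + y) = f x + f y \<and> f (c *\<^sub>C x) = c * f x}"
  have C: "C = PiE UNIV (\<lambda>x. cball 0 (norm x))" by (auto simp: C_def)
  have "compactin (product_topology (\<lambda>_. euclidean) UNIV) C"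
    unfolding C compactin_PiE by (simp add: compactin_euclidean_iff)
  then have "compact C" by (simp add: euclidean_product_topology)
  moreover have "closed L"
  proof -
    have "L = (\<Inter>x. \<Inter>y. \<Inter>c. {f. f (x + y) = f x + f y} \<inter> {f. f (c *\<^sub>C x) = c * f x})"
      by (auto simp: L_def)
    moreover have "closed (\<Inter>x::'p. \<Inter>y. \<Inter>c. {f::'p \<Rightarrow> complex. f (x + y) = f x + f y} \<inter> {f. f (c *\<^sub>C x) = c * f x})"
      by (intro closed_INT ballI closed_Int closed_Collect_eq continuous_intros continuous_on_coordinate)
    ultimately show ?thesis by simp
  qed
  ultimately have "compact (C \<inter> L)" by (rule compact_Int_closed)
  moreover have "ev ` {a. norm a \<le> 1} = C \<inter> L"
  proof (intro equalityI subsetI)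
    fix f assume "f \<in> ev ` {a. norm a \<le> 1}"
    then obtain a where a: "norm a \<le> 1" "f = ev a" by auto
    have "cmod (ev a x) \<le> norm x" for x
      using norm_ev_le[of a x] mult_right_mono[OF a(1) norm_ge_zero[of x]] by simp
    then show "f \<in> C \<inter> L" unfolding a(2) by (auto simp: C_def L_def cdual_add cdual_scaleC)
  next
    fix f assume f: "f \<in> C \<inter> L"
    then have "bounded_clinear f"
      by (intro bounded_clinearI[of _ 1]) (auto simp: C_def L_def scaleC_complex_def)
    then have Cf: "cdual_apply (Cdual f) = f" by (simp add: Cdual_inverse)
    obtain a where a: "Cdual f = \<iota> a" using is_predual by (auto simp: is_predual_def surj_def)
    then have fa: "f = ev a" using Cf by simp
    moreover have "norm a \<le> 1" by (rule norm_le_ev) (use f fa in \<open>auto simp: C_def\<close>)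
    ultimately show "f \<in> ev ` {a. norm a \<le> 1}" by auto
  qed
  ultimately show ?thesis by simp
qed

text \<open>
  A bipolar theorem for compact convex sets.  On finitely many test vectors the point of \<open>Q\<close>
  nearest to \<open>v\<close> agrees with \<open>v\<close>, since otherwise the difference would yield a separating vector.
\<close>

lemma mem_if_below_support_function:
  assumes comp: "compact (ev ` Q)" and conv: "convex Q" and ne: "Q \<noteq> {}"
    and below: "\<And>x c. (\<And>q. q \<in> Q \<Longrightarrow> Re (ev q x) \<le> c) \<Longrightarrow> Re (ev v x) \<le> c"
  shows "v \<in> Q"
proof -
  have fin: "\<exists>q\<in>Q. \<forall>x\<in>X. Re (ev q x) = Re (ev v x)" if X: "finite X" for X
  proof -
    define h where "h f = (\<Sum>x\<in>X. (Re (f x) - Re (ev v x))\<^sup>2)" for f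
    have "continuous_on (ev ` Q) h"
      unfolding h_def by (intro continuous_intros continuous_on_coordinate)
    then obtain q0 where q0: "q0 \<in> Q" and min: "\<And>q. q \<in> Q \<Longrightarrow> h (ev q0) \<le> h (ev q)"
      using continuous_attains_inf[OF comp _ \<open>continuous_on (ev ` Q) h\<close>] ne by auto
    define c where "c x = Re (ev q0 x) - Re (ev v x)" for x
    define y where "y = (\<Sum>x\<in>X. c x *\<^sub>R x)"
    have ev_y: "Re (ev a y) = (\<Sum>x\<in>X. c x * Re (ev a x))" for a
      unfolding y_def by (induction X rule: infinite_finite_induct) (auto simp: cdual_add cdual_scaleR cdual_zero)
    have "Re (ev q0 y) \<le> Re (ev q y)" if q: "q \<in> Q" for q
    proof -
      define D where "D x = Re (ev q x) - Re (ev q0 x)" for x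
      define M N where "M = (\<Sum>x\<in>X. c x * D x)" and "N = (\<Sum>x\<in>X. (D x)\<^sup>2)"
      have N: "0 \<le> N" by (auto simp: N_def intro: sum_nonneg)
      have quad: "0 \<le> 2 * M + t * N" if t: "0 < t" "t \<le> 1" for t
      proof -
        have "(1 - t) *\<^sub>R q0 + t *\<^sub>R q \<in> Q" using conv q0 q t by (intro convexD) auto
        from min[OF this] have "(\<Sum>x\<in>X. (c x)\<^sup>2) \<le> (\<Sum>x\<in>X. (c x + t * D x)\<^sup>2)"
          by (simp add: h_def c_def D_def ev_simps algebra_simps)
        also have "\<dots> = (\<Sum>x\<in>X. (c x)\<^sup>2) + t * (2 * M + t * N)"
          by (simp add: M_def N_def power2_eq_square algebra_simps sum.distrib sum_distrib_left)
        finally show ?thesis using t by (simp add: zero_le_mult_iff)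
      qed
      have "0 \<le> M"
      proof (rule ccontr)
        assume "\<not> 0 \<le> M"
        then have M: "M < 0" by simp
        define t where "t = min 1 (- M / (N + 1))"
        have t: "0 < t" "t \<le> 1" "t \<le> - M / (N + 1)" using M N by (auto simp: t_def divide_less_0_iff)
        have "t * N \<le> - M / (N + 1) * N" using t N by (intro mult_right_mono)
        also have "\<dots> \<le> - M" using M N by (simp add: field_simps)
        finally show False using quad[OF t(1,2)] M by simp
      qed
      then show ?thesis by (simp add: ev_y M_def D_def right_diff_distrib sum_subtractf)
    qed
    then have "Re (ev v (- y)) \<le> Re (ev q0 (- y))" by (intro below) (simp add: cdual_neg)
    then have "(\<Sum>x\<in>X. (c x)\<^sup>2) \<le> 0"
      by (simp add: cdual_neg ev_y c_def power2_eq_square right_diff_distrib sum_subtractf)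
    then have "(\<Sum>x\<in>X. (c x)\<^sup>2) = 0" by (intro antisym sum_nonneg) auto
    then have "\<forall>x\<in>X. c x = 0" using X by (simp add: sum_nonneg_eq_0_iff)
    then show ?thesis using q0 by (auto simp: c_def)
  qed
  have "ev ` Q \<inter> \<Inter> ((\<lambda>x. {f. Re (f x) = Re (ev v x)}) ` UNIV) \<noteq> {}"
  proof (rule compact_imp_fip[OF comp])
    fix T assume "T \<in> (\<lambda>x. {f. Re (f x) = Re (ev v x)}) ` UNIV"
    then show "closed T" by (auto intro!: closed_Collect_eq continuous_intros continuous_on_coordinate)
  next
    fix F' assume "finite F'" "F' \<subseteq> (\<lambda>x. {f. Re (f x) = Re (ev v x)}) ` UNIV"
    then obtain X where X: "finite X" "F' = (\<lambda>x. {f. Re (f x) = Re (ev v x)}) ` X"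
      by (meson finite_subset_image)
    show "ev ` Q \<inter> \<Inter> F' \<noteq> {}" using fin[OF X(1)] unfolding X(2) by blast
  qed
  then obtain q where "q \<in> Q" "\<And>x. Re (ev q x) = Re (ev v x)" by auto
  then show ?thesis using ev_inj[of q v] by blast
qed

subsection \<open>The unit\<close>

text \<open>
  A weak* limit \<open>e\<close> of an approximate unit need not be recognizable as a unit through products, since
  multiplication is not known to be weak* continuous.  But the balls \<open>\<parallel>e - 2 k\<parallel> \<le> 1\<close> for all positive
  contractions \<open>k\<close> are weak* closed, and approximate units almost lie in any finite number of them.
  A selfadjoint point in all of them satisfies \<open>2 k \<le> 1 + e\<close>; letting \<open>k\<close> run through an approximate
  unit gives \<open>b* (1 - e) b = 0\<close> for all \<open>b\<close>.
\<close>

lemma exists_unit: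
  obtains e :: 'a where "star e = e" "\<And>b. e * b = b" "\<And>b. b * e = b" "pos_elt (1 - unitize e)"
proof -
  define P where "P = {k::'a. cstar_positive k \<and> norm k \<le> 1}"
  have pK: "pos_elt (1 - unitize k)" if "k \<in> P" for k
    using norm_le_iff_pos_elt[of "unitize k" 1] that by (simp add: P_def cstar_positive_def pos_elt_def)
  have "ev ` {a. norm a \<le> 1} \<inter> \<Inter> ((\<lambda>(k, d). weak_ball (2 *\<^sub>R k) (1 + d)) ` (P \<times> {0<..})) \<noteq> {}"
  proof (rule compact_imp_fip[OF compact_ev_unit_ball])
    fix F' assume "finite F'" "F' \<subseteq> (\<lambda>(k, d). weak_ball (2 *\<^sub>R k) (1 + d)) ` (P \<times> {0<..})"
    then obtain J where J: "finite J" "J \<subseteq> P \<times> {0<..}" "F' = (\<lambda>(k, d). weak_ball (2 *\<^sub>R k) (1 + d)) ` J"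
      by (meson finite_subset_image)
    define d where "d = Min (insert 1 (snd ` J))"
    have d: "0 < d"
      unfolding d_def using J(1,2) by (subst Min_gr_iff) auto
    have dJ: "d \<le> t" if "(k, t) \<in> J" for k t
      unfolding d_def using J(1) that by (intro Min_le) force+
    obtain u where u: "cstar_positive u" "norm u \<le> 1" and uk: "\<And>k. k \<in> fst ` J \<Longrightarrow> norm (k - u * k) \<le> d / 2"
      using approximate_unit[of "fst ` J" "d / 2"] J(1) d by (metis finite_imageI half_gt_zero)
    have su: "star u = u" using cstar_positive_selfadjoint[OF u(1)] by (simp add: selfadjoint_def)
    have nu: "norm (u * u) \<le> 1"
      using u(2) cstar_identity[of u] by (simp add: su power_le_one)
    define U where "U = unitize u"
    have sU: "star U = U" by (simp add: U_def su flip: unitize_simps)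
    have "norm (u * u - 2 *\<^sub>R k) \<le> 1 + d" if k: "k \<in> fst ` J" for k
    proof -
      have kP: "k \<in> P" using k J(2) by auto
      then have sk: "star k = k" using cstar_positive_selfadjoint[of k] by (simp add: P_def selfadjoint_def)
      define K where "K = unitize k"
      have sK: "selfadjoint K" "selfadjoint U" using sk su by (simp_all add: K_def U_def selfadjoint_unitize) (simp_all add: selfadjoint_def)
      have "norm (k - u * k * u) \<le> norm (k - u * k) + norm (u * star (k - u * k))"
        using norm_triangle_ineq[of "k - u * k" "u * star (k - u * k)"]
        by (simp add: star_diff star_mult su sk algebra_simps)
      also have "\<dots> \<le> d / 2 + 1 * (d / 2)"
        by (intro add_mono uk k order_trans[OF norm_mult_ineq mult_mono]) (use u uk[OF k] in auto)
      finally have "norm (unitize (k - u * k * u)) \<le> d" by simp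
      then have nd: "norm (K - U * K * U) \<le> d" by (simp add: unitize_simps K_def U_def)
      have sUKU: "selfadjoint (U * K * U)" using selfadjoint_conj[OF sK(1), of U] sU by simp
      have "pos_elt (d *\<^sub>R 1 - (K - U * K * U))"
        using norm_le_iff_pos_elt[of "K - U * K * U" d] nd d sK sUKU by auto
      moreover have "pos_elt (1 - K)" using pK[OF kP] by (simp add: K_def)
      moreover have "pos_elt (U * U - U * K * U)"
        using pos_elt_conj[OF \<open>pos_elt (1 - K)\<close>, of U] sU by (simp add: algebra_simps)
      ultimately have "pos_elt (d *\<^sub>R 1 - (K - U * K * U) + (1 - K) + (U * U - U * K * U))"
        by (intro pos_elt_add)
      moreover have "d *\<^sub>R 1 - (K - U * K * U) + (1 - K) + (U * U - U * K * U) = (1 + d) *\<^sub>R 1 + (U * U - 2 *\<^sub>R K)"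
        by (simp add: algebra_simps scaleR_2)
      ultimately have lower: "pos_elt ((1 + d) *\<^sub>R 1 + (U * U - 2 *\<^sub>R K))" by simp
      have "norm (U * U) \<le> 1" using nu norm_unitize[of "u * u"] by (simp add: unitize_simps U_def)
      then have "pos_elt (1 *\<^sub>R 1 - U * U)"
        using norm_le_iff_pos_elt[of "U * U" 1] sK by auto
      moreover have "pos_elt (d *\<^sub>R 1 + 2 *\<^sub>R K)"
        using kP d by (intro pos_elt_plus_real pos_elt_scaleR) (auto simp: P_def cstar_positive_def K_def)
      ultimately have "pos_elt ((1 *\<^sub>R 1 - U * U) + (d *\<^sub>R 1 + 2 *\<^sub>R K))" by (rule pos_elt_add)
      then have upper: "pos_elt ((1 + d) *\<^sub>R 1 - (U * U - 2 *\<^sub>R K))" by (simp add: algebra_simps)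
      have "norm (U * U - 2 *\<^sub>R K) \<le> 1 + d"
        using norm_le_iff_pos_elt[of "U * U - 2 *\<^sub>R K" "1 + d"] lower upper d sK by auto
      then have "norm (unitize (u * u - 2 *\<^sub>R k)) \<le> 1 + d" by (simp add: unitize_simps unitize_scaleR U_def K_def)
      then show ?thesis by simp
    qed
    then have "ev (u * u) \<in> \<Inter> F'"
      unfolding J(3) using J(2) dJ
      by (auto simp: ev_in_weak_ball_iff intro: order_trans) (smt (verit) fst_conv greaterThan_iff image_eqI mem_Sigma_iff subsetD ev_in_weak_ball_iff)
    then show "ev ` {a. norm a \<le> 1} \<inter> \<Inter> F' \<noteq> {}" using nu by blast
  qed (auto intro: closed_weak_ball)
  then obtain a where a: "norm a \<le> 1" "\<And>k d. k \<in> P \<Longrightarrow> d > 0 \<Longrightarrow> ev a \<in> weak_ball (2 *\<^sub>R k) (1 + d)"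
    by fastforce
  have ak: "norm (a - 2 *\<^sub>R k) \<le> 1" if k: "k \<in> P" for k
    by (rule field_le_epsilon) (use a(2)[OF k] ev_in_weak_ball_iff in \<open>simp add: add_nonneg_pos\<close>)
  define e where "e = re_part a"
  have se: "star e = e" using selfadjoint_re_part[of a] by (simp add: e_def selfadjoint_def)
  have ne: "norm e \<le> 1" using norm_re_part[of a] a(1) by (simp add: e_def)
  define E where "E = unitize e"
  have sE: "selfadjoint E" unfolding E_def selfadjoint_unitize using se by (simp add: selfadjoint_def)
  have "norm E \<le> 1" using ne by (simp add: E_def)
  then have pE: "pos_elt (1 - E)" using norm_le_iff_pos_elt[OF sE, of 1] by simp
  have le: "pos_elt (1 + (E - 2 *\<^sub>R unitize k))" if k: "k \<in> P" for k
  proof -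
    have sk: "selfadjoint k" using k by (simp add: P_def cstar_positive_selfadjoint)
    have "e - 2 *\<^sub>R k = re_part (a - 2 *\<^sub>R k)"
      using re_part_add[of a "(- 2) *\<^sub>R k"] re_part_selfadjoint[OF sk] by (simp add: e_def re_part_scaleR del: scaleR_minus_left) (simp add: re_part_scaleR)
    then have "norm (e - 2 *\<^sub>R k) \<le> 1" using norm_re_part ak[OF k] order_trans by metis
    then have "norm (E - 2 *\<^sub>R unitize k) \<le> 1"
      using norm_unitize[of "e - 2 *\<^sub>R k"] by (simp add: unitize_simps unitize_scaleR E_def)
    moreover have "selfadjoint (E - 2 *\<^sub>R unitize k)" using sk sE by (auto simp: selfadjoint_unitize)
    ultimately show ?thesis using norm_le_iff_pos_elt[of "E - 2 *\<^sub>R unitize k" 1] by simp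
  qed
  have eb: "e * b = b" for b
  proof -
    \<comment> \<open>Compress \<open>2 k \<le> 1 + e\<close> by \<open>b\<close>, with \<open>k b\<close> close to \<open>b\<close>.\<close>
    have small: "norm (star (unitize b) * (1 - E) * unitize b) \<le> 2 * norm b * d" if d: "0 < d" for d
    proof -
      obtain k where k: "cstar_positive k" "norm k \<le> 1" "norm (b - k * b) \<le> d"
        using approximate_unit[of "{b}" d] d by (metis finite.emptyI finite.insertI singletonI)
      have kP: "k \<in> P" using k by (simp add: P_def)
      define B K where "B = unitize b" and "K = unitize k"
      have 1: "pos_elt (star B * (1 - E) * B)" by (rule pos_elt_conj[OF pE])
      have "pos_elt (star B * (1 + (E - 2 *\<^sub>R K)) * B)" unfolding K_def by (rule pos_elt_conj[OF le[OF kP]])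
      also have "star B * (1 + (E - 2 *\<^sub>R K)) * B = 2 *\<^sub>R (star B * (B - K * B)) - star B * (1 - E) * B"
        by (simp add: algebra_simps scaleR_2)
      finally have "norm (star B * (1 - E) * B) \<le> norm (2 *\<^sub>R (star B * (B - K * B)))"
        by (rule norm_pos_elt_mono[OF 1])
      also have "\<dots> = 2 * norm (unitize (star b * (b - k * b)))" by (simp add: B_def K_def unitize_simps)
      also have "\<dots> \<le> 2 * (norm b * d)"
        using norm_mult_ineq[of "star b" "b - k * b"] mult_left_mono[OF k(3) norm_ge_zero[of b]] by simp
      finally show ?thesis by (simp add: B_def)
    qed
    have "norm (star (unitize b) * (1 - E) * unitize b) \<le> 0"
    proof (rule field_le_epsilon)
      fix d :: real assume d: "0 < d"
      have pos: "0 < 2 * norm b + 1" by (simp add: add_nonneg_pos)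
      have "2 * norm b * (d / (2 * norm b + 1)) \<le> d"
        by (subst times_divide_eq_right, subst pos_divide_le_eq[OF pos]) (use d in \<open>simp add: algebra_simps\<close>)
      then show "norm (star (unitize b) * (1 - E) * unitize b) \<le> 0 + d"
        using small[of "d / (2 * norm b + 1)"] d by (simp add: add_nonneg_pos)
    qed
    then have "(1 - E) * unitize b = 0" by (intro pos_elt_conj_eq_0D[OF pE]) simp
    then have "unitize (e * b) = unitize b" by (simp add: unitize_simps E_def left_diff_distrib)
    then show ?thesis by (simp add: unitize_eq_iff)
  qed
  moreover have "b * e = b" for b using eb[of "star b"] se by (metis star_mult star_star)
  ultimately show ?thesis using se pE unfolding E_def by (intro that[of e])
qed

subsection \<open>The dual cone of the normal positive functionals\<close>

definition as_functional :: "'p \<Rightarrow> 'a cdual"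
  where "as_functional x = Cdual (predual_functional \<iota> x)"

lemma as_functional_apply: "cdual_apply (as_functional x) a = ev a x"
proof -
  have "bounded_clinear (\<lambda>a. ev a x)"
    by (rule bounded_clinearI[of _ "norm x"]) (auto simp: ev_simps norm_ev_le scaleC_complex_def)
  then show ?thesis by (simp add: as_functional_def predual_functional_def Cdual_inverse)
qed

lemma predual_cone_iff: "x \<in> predual_cone \<iota> \<longleftrightarrow> as_functional x \<in> dual_cone"
proof -
  have "cdual_apply (as_functional x) = predual_functional \<iota> x"
    by (auto simp: as_functional_apply predual_functional_def)
  then show ?thesis
    using normal_predual_functional[OF is_predual] by (simp add: predual_cone_def dual_cone_def)
qed

lemma norm_as_functional: "norm (as_functional x) = norm x"
proof (rule antisym)
  show "norm (as_functional x) \<le> norm x"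
    by (rule norm_cdual_le) (auto simp: as_functional_apply mult.commute intro: order_trans[OF norm_ev_le])
  obtain f :: "'p cdual" where f: "Re (cdual_apply f x) = norm x" "norm f \<le> 1"
    using norming_functional[of x] by blast
  obtain a where a: "f = \<iota> a" using is_predual by (auto simp: is_predual_def surj_def)
  then have "norm a \<le> 1" using f(2) is_predual by (simp add: is_predual_def)
  have "norm x \<le> cmod (cdual_apply (as_functional x) a)"
    using f(1) complex_Re_le_cmod[of "ev a x"] by (simp add: as_functional_apply a)
  also have "\<dots> \<le> norm (as_functional x) * norm a" by (rule norm_cdual_apply)
  also have "\<dots> \<le> norm (as_functional x) * 1" using \<open>norm a \<le> 1\<close> by (intro mult_left_mono) auto
  finally show "norm x \<le> norm (as_functional x)" by simp
qed

lemma as_functional_add: "as_functional (x + y) = as_functional x + as_functional y"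
  and as_functional_scaleR: "as_functional (r *\<^sub>R x) = r *\<^sub>R as_functional x"
  by (rule cdual_eqI; simp add: as_functional_apply plus_cdual.rep_eq cdual_add cdual_scaleR scaleR_cdual_def
      scaleC_cdual.rep_eq scaleR_conv_of_real)+

lemma bounded_linear_as_functional: "bounded_linear as_functional"
  by (rule bounded_linear_intro[of _ 1])
    (simp_all add: as_functional_add as_functional_scaleR norm_as_functional)

lemma predual_cone_add: "x \<in> predual_cone \<iota> \<Longrightarrow> y \<in> predual_cone \<iota> \<Longrightarrow> x + y \<in> predual_cone \<iota>"
  and predual_cone_scaleR: "x \<in> predual_cone \<iota> \<Longrightarrow> 0 \<le> r \<Longrightarrow> r *\<^sub>R x \<in> predual_cone \<iota>"
  by (simp_all add: predual_cone_iff as_functional_add as_functional_scaleR dual_cone_convex_cone)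

lemma zero_in_predual_cone: "0 \<in> predual_cone \<iota>"
  by (simp add: predual_cone_iff dual_cone_iff as_functional_apply cdual_zero)

lemma closed_predual_cone: "closed (predual_cone \<iota>)"
proof -
  have "predual_cone \<iota> = as_functional -` dual_cone" by (auto simp: predual_cone_iff)
  moreover have "closed (as_functional -` dual_cone)"
    by (intro closed_vimage closed_dual_cone linear_continuous_on bounded_linear_as_functional)
  ultimately show ?thesis by simp
qed

lemma norm_additive_on_predual_cone:
  "x \<in> predual_cone \<iota> \<Longrightarrow> y \<in> predual_cone \<iota> \<Longrightarrow> norm x + norm y \<le> norm (x + y)"
  using norm_additive_on_dual_cone[of "as_functional x" "as_functional y"]
  by (simp add: predual_cone_iff norm_as_functional flip: as_functional_add)

definition accretive :: "'a \<Rightarrow> bool"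
  where "accretive a \<longleftrightarrow> cstar_positive (a + star a)"

lemma accretive_add: "accretive a \<Longrightarrow> accretive b \<Longrightarrow> accretive (a + b)"
  using cstar_positive_add[of "a + star a" "b + star b"] by (simp add: accretive_def star_add algebra_simps)

lemma accretive_scaleR:
  assumes "accretive a" "0 \<le> r"
  shows "accretive (r *\<^sub>R a)"
  using cstar_positive_scaleR[of "a + star a" r] assms by (simp add: accretive_def star_scaleR scaleR_add_right)

definition accretive_ball :: "'a set"
  where "accretive_ball = {a. accretive a \<and> norm a \<le> 1}"

text \<open>
  The accretive part of the unit ball is an intersection of balls.  This makes it weak* compact,
  although nothing is known at this point about weak* continuity of the involution.
\<close>

lemma accretive_ball_iff_norms:
  assumes e: "star e = e" "\<And>b. e * b = b" "\<And>b. b * e = b" "pos_elt (1 - unitize e)"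
  shows "a \<in> accretive_ball \<longleftrightarrow> (\<forall>s\<ge>0. norm (a - s *\<^sub>R e) \<le> sqrt (1 + s\<^sup>2))"
proof -
  define A E where "A = unitize a" and "E = unitize e"
  define X where "X s = star (A - s *\<^sub>R E) * (A - s *\<^sub>R E)" for s
  have E: "star E = E" "E * A = A" "A * E = A" "E * star A = star A" "star A * E = star A" "E * E = E"
    unfolding A_def E_def unitize_simps(6,7)[symmetric] by (simp_all add: e)
  have X: "X s = star A * A - s *\<^sub>R (A + star A) + s\<^sup>2 *\<^sub>R E" for s
    by (simp add: X_def star_diff star_scaleR E algebra_simps power2_eq_square)
  have pE: "pos_elt (1 - E)" using e(4) by (simp add: E_def)
  have pX: "pos_elt (X s)" "selfadjoint (X s)" for s unfolding X_def by (simp_all add: pos_elt_star_mult)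
  have norm_iff: "norm (a - s *\<^sub>R e) \<le> sqrt (1 + s\<^sup>2) \<longleftrightarrow> pos_elt ((1 + s\<^sup>2) *\<^sub>R 1 - X s)" for s
  proof -
    have "(norm (a - s *\<^sub>R e))\<^sup>2 = (norm (unitize (a - s *\<^sub>R e)))\<^sup>2" by simp
    also have "\<dots> = norm (X s)" by (simp add: X_def A_def E_def unitize_simps unitize_scaleR cstar_identity)
    finally have sq: "(norm (a - s *\<^sub>R e))\<^sup>2 = norm (X s)" .
    have "norm (a - s *\<^sub>R e) \<le> sqrt (1 + s\<^sup>2) \<longleftrightarrow> (norm (a - s *\<^sub>R e))\<^sup>2 \<le> 1 + s\<^sup>2"
      using real_le_rsqrt[of "norm (a - s *\<^sub>R e)" "1 + s\<^sup>2"] real_sqrt_le_iff[of "(norm (a - s *\<^sub>R e))\<^sup>2" "1 + s\<^sup>2"] by auto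
    also have "\<dots> \<longleftrightarrow> pos_elt ((1 + s\<^sup>2) *\<^sub>R 1 - X s)"
      unfolding sq using norm_le_iff_pos_elt[OF pX(2), of "1 + s\<^sup>2"] pos_elt_plus_real[OF pX(1), of "1 + s\<^sup>2"] by auto
    finally show ?thesis .
  qed
  have acc: "accretive a \<longleftrightarrow> pos_elt (A + star A)"
    by (simp add: accretive_def cstar_positive_def A_def unitize_simps)
  show ?thesis
  proof
    assume a: "a \<in> accretive_ball"
    have "norm (star A * A) \<le> 1"
      using a by (simp add: cstar_identity A_def accretive_ball_def power_le_one)
    then have n: "pos_elt (1 *\<^sub>R 1 - star A * A)" using norm_le_iff_pos_elt[of "star A * A" 1] by auto
    show "\<forall>s\<ge>0. norm (a - s *\<^sub>R e) \<le> sqrt (1 + s\<^sup>2)"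
    proof (intro allI impI)
      fix s :: real assume s: "0 \<le> s"
      have "pos_elt ((1 *\<^sub>R 1 - star A * A) + s *\<^sub>R (A + star A) + s\<^sup>2 *\<^sub>R (1 - E))"
        using a s acc
        by (intro pos_elt_add[OF pos_elt_add[OF n pos_elt_scaleR] pos_elt_scaleR[OF pE]])
          (auto simp: accretive_ball_def)
      also have "(1 *\<^sub>R 1 - star A * A) + s *\<^sub>R (A + star A) + s\<^sup>2 *\<^sub>R (1 - E) = (1 + s\<^sup>2) *\<^sub>R 1 - X s"
        by (simp add: X algebra_simps)
      finally show "norm (a - s *\<^sub>R e) \<le> sqrt (1 + s\<^sup>2)" by (simp add: norm_iff)
    qed
  next
    assume le: "\<forall>s\<ge>0. norm (a - s *\<^sub>R e) \<le> sqrt (1 + s\<^sup>2)"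
    have "pos_elt (t *\<^sub>R 1 + (A + star A))" if t: "0 < t" for t
    proof -
      \<comment> \<open>Large \<open>s\<close> makes the remainder \<open>t\<close> in \<open>a + a* + t \<ge> 0\<close> small.\<close>
      define s where "s = 1 / t"
      have s: "0 < s" using t by (simp add: s_def)
      have "pos_elt (star E * ((1 + s\<^sup>2) *\<^sub>R 1 - X s) * E)"
        using le norm_iff[of s] s by (intro pos_elt_conj) auto
      also have "star E * ((1 + s\<^sup>2) *\<^sub>R 1 - X s) * E = E - star A * A + s *\<^sub>R (A + star A)"
      proof -
        have "E * (star A * A) = star A * A" "star A * A * E = star A * A"
          using E by (simp_all add: mult.assoc[symmetric]) (simp_all add: mult.assoc)
        then show ?thesis by (simp add: X E algebra_simps)
      qed
      finally have "pos_elt (E - star A * A + s *\<^sub>R (A + star A))" .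
      from pos_elt_add[OF pos_elt_add[OF this pos_elt_star_mult[of A]] pE]
      have "pos_elt (1 + s *\<^sub>R (A + star A))" by (simp add: algebra_simps)
      then have "pos_elt (t *\<^sub>R (1 + s *\<^sub>R (A + star A)))" using t by (intro pos_elt_scaleR) auto
      then show ?thesis using t by (simp add: s_def scaleR_add_right)
    qed
    then have "accretive a" unfolding acc by (rule pos_elt_limit)
    moreover have "norm a \<le> 1" using le[rule_format, of 0] by simp
    ultimately show "a \<in> accretive_ball" by (simp add: accretive_ball_def)
  qed
qed

lemma compact_ev_accretive_ball: "compact (ev ` accretive_ball)"
proof -
  obtain e :: 'a where e: "star e = e" "\<And>b. e * b = b" "\<And>b. b * e = b" "pos_elt (1 - unitize e)"
    using exists_unit by blast
  have "ev ` accretive_ball = ev ` {a. norm a \<le> 1} \<inter> (\<Inter>s\<in>{0..}. weak_ball (s *\<^sub>R e) (sqrt (1 + s\<^sup>2)))"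
    (is "_ = ?R")
  proof (intro equalityI subsetI)
    fix f assume "f \<in> ev ` accretive_ball"
    then show "f \<in> ?R"
      using accretive_ball_iff_norms[OF e] by (auto simp: ev_in_weak_ball_iff accretive_ball_def)
  next
    fix f assume f: "f \<in> ?R"
    then obtain a where a: "f = ev a" by auto
    then have "a \<in> accretive_ball"
      using f accretive_ball_iff_norms[OF e] by (auto simp: ev_in_weak_ball_iff)
    then show "f \<in> ev ` accretive_ball" using a by blast
  qed
  moreover have "compact ?R"
    by (intro compact_Int_closed compact_ev_unit_ball closed_INT ballI closed_weak_ball)
  ultimately show ?thesis by simp
qed

lemma convex_accretive_ball: "convex accretive_ball"
proof (rule convexI)
  fix a b :: 'a and u v :: real
  assume a: "a \<in> accretive_ball" "b \<in> accretive_ball" "0 \<le> u" "0 \<le> v" "u + v = 1"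
  have "norm (u *\<^sub>R a + v *\<^sub>R b) \<le> u * norm a + v * norm b"
    using norm_triangle_ineq[of "u *\<^sub>R a" "v *\<^sub>R b"] a by simp
  also have "\<dots> \<le> u * 1 + v * 1" using a by (intro add_mono mult_left_mono) (auto simp: accretive_ball_def)
  finally show "u *\<^sub>R a + v *\<^sub>R b \<in> accretive_ball"
    using a by (simp add: accretive_ball_def accretive_add accretive_scaleR)
qed

lemma zero_in_accretive_ball: "0 \<in> accretive_ball"
  by (simp add: accretive_ball_def accretive_def)

text \<open>How far an element of the predual is from being positive.\<close>

definition defect :: "'p \<Rightarrow> real"
  where "defect x = (SUP w\<in>accretive_ball. - Re (ev w x))"

lemma defect_upper: "w \<in> accretive_ball \<Longrightarrow> - Re (ev w x) \<le> defect x"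
proof -
  have "- Re (ev w x) \<le> norm x" if "w \<in> accretive_ball" for w
    using Re_ev_le[of "- w" x] that mult_right_mono[of "norm w" 1 "norm x"] by (simp add: ev_simps accretive_ball_def)
  then have "bdd_above ((\<lambda>w. - Re (ev w x)) ` accretive_ball)" by (intro bdd_aboveI2)
  then show "w \<in> accretive_ball \<Longrightarrow> - Re (ev w x) \<le> defect x"
    unfolding defect_def by (rule cSUP_upper2) auto
qed

lemma defect_least: "(\<And>w. w \<in> accretive_ball \<Longrightarrow> - Re (ev w x) \<le> c) \<Longrightarrow> defect x \<le> c"
  unfolding defect_def by (rule cSUP_least) (use zero_in_accretive_ball in auto)

lemma defect_nonneg: "0 \<le> defect x"
  using defect_upper[OF zero_in_accretive_ball, of x] by (simp add: ev_simps)

lemma defect_le_norm: "defect x \<le> norm x"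
proof (rule defect_least)
  fix w assume "w \<in> accretive_ball"
  then show "- Re (ev w x) \<le> norm x"
    using Re_ev_le[of "- w" x] mult_right_mono[of "norm w" 1 "norm x"] by (simp add: ev_simps accretive_ball_def)
qed

lemma defect_add: "defect (x + y) \<le> defect x + defect y"
  by (rule defect_least) (use defect_upper[of _ x] defect_upper[of _ y] in \<open>fastforce simp: cdual_add\<close>)

lemma defect_scaleR_le: "0 \<le> c \<Longrightarrow> defect (c *\<^sub>R x) \<le> c * defect x"
  by (rule defect_least) (use mult_left_mono[OF defect_upper] in \<open>fastforce simp: cdual_scaleR\<close>)

lemma defect_scaleR:
  assumes c: "0 \<le> c"
  shows "defect (c *\<^sub>R x) = c * defect x"
proof (cases "c = 0")
  case True
  then show ?thesis using defect_le_norm[of 0] defect_nonneg[of 0] by simp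
next
  case False
  then have "defect (inverse c *\<^sub>R (c *\<^sub>R x)) \<le> inverse c * defect (c *\<^sub>R x)"
    using c by (intro defect_scaleR_le) auto
  then have "c * defect x \<le> defect (c *\<^sub>R x)" using False c by (simp add: field_simps)
  then show ?thesis using defect_scaleR_le[OF c, of x] by simp
qed

lemma continuous_on_defect: "continuous_on S defect"
proof -
  have "\<bar>defect x - defect y\<bar> \<le> norm (x - y)" for x y
    using defect_add[of y "x - y"] defect_add[of x "y - x"] defect_le_norm[of "x - y"] defect_le_norm[of "y - x"]
    by (simp add: norm_minus_commute)
  then have "1-lipschitz_on S defect" by (intro lipschitz_onI) (auto simp: dist_norm)
  then show ?thesis by (rule lipschitz_on_continuous_on)
qed

lemma defect_zero_imp_positive:
  assumes "defect x = 0"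
  shows "x \<in> predual_cone \<iota>"
proof -
  have nn: "0 \<le> Re (ev w x)" if w: "accretive w" for w
  proof -
    define c where "c = norm w + 1"
    have c: "0 < c" by (simp add: c_def add_nonneg_pos)
    have "(1 / c) *\<^sub>R w \<in> accretive_ball"
      using accretive_scaleR[OF w, of "1 / c"] c by (simp add: accretive_ball_def c_def)
    from defect_upper[OF this, of x] show ?thesis
      using assms c by (simp add: ev_simps zero_le_divide_iff)
  qed
  have "ev (star a * a) x \<in> \<real>\<^sub>\<ge>\<^sub>0" for a
  proof -
    have "accretive (star a * a)"
      using cstar_positive_add[OF cstar_positive_star_mult cstar_positive_star_mult] by (simp add: accretive_def star_mult star_star)
    moreover have "accretive (\<i> *\<^sub>C (star a * a))" "accretive (- (\<i> *\<^sub>C (star a * a)))"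
      by (simp_all add: accretive_def star_scaleC star_mult star_star star_minus)
    ultimately have "0 \<le> Re (ev (star a * a) x)" "Im (ev (star a * a) x) = 0"
      using nn[of "star a * a"] nn[of "\<i> *\<^sub>C (star a * a)"] nn[of "- (\<i> *\<^sub>C (star a * a))"]
      by (auto simp: ev_simps)
    then show ?thesis by (simp add: complex_nonneg_Reals_iff)
  qed
  then show ?thesis by (simp add: predual_cone_iff dual_cone_iff as_functional_apply)
qed

text \<open>
  The support function of the accretive part of the unit ball at \<open>- x\<close> is the defect of \<open>x\<close>, so the
  bipolar theorem for compact sets applies.
\<close>

lemma accretive_if_dominated_by_defect:
  assumes le: "\<And>x. Re (ev a x) \<le> c * defect x" and c: "0 < c"
  shows "accretive (- a)"
proof -
  have "(1 / c) *\<^sub>R (- a) \<in> accretive_ball"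
  proof (rule mem_if_below_support_function[OF compact_ev_accretive_ball convex_accretive_ball])
    fix x b assume b: "\<And>q. q \<in> accretive_ball \<Longrightarrow> Re (ev q x) \<le> b"
    have "defect (- x) \<le> b" by (rule defect_least) (use b in \<open>simp add: cdual_neg\<close>)
    then show "Re (ev ((1 / c) *\<^sub>R (- a)) x) \<le> b"
      using le[of "- x"] c by (simp add: ev_simps cdual_neg field_simps) (smt (verit) mult_left_mono mult.commute)
  qed (use zero_in_accretive_ball in auto)
  then have "accretive ((1 / c) *\<^sub>R (- a))" by (simp only: accretive_ball_def mem_Collect_eq)
  from accretive_scaleR[OF this, of c] show ?thesis using c by simp
qed

text \<open>
  Let \<open>q(x)\<close> be the infimum of \<open>\<parallel>y\<parallel> + 4 defect (x + y)\<close> over \<open>y\<close>.  A linear functional below \<open>q\<close> that agrees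
  with \<open>q\<close> at \<open>x\<close> has norm at most one, as \<open>y = - x\<close> shows, and is minus an accretive element, as \<open>y = 0\<close>
  shows; hence its value at \<open>x\<close> is at most the defect.  So \<open>q(x) \<le> defect x\<close>, independently of the
  factor in front of the defect; with the factor \<open>4\<close> the defect can be halved.
\<close>

lemma reduce_defect:
  assumes "0 < defect x"
  shows "\<exists>y. norm y \<le> 2 * defect x \<and> defect (x + y) \<le> defect x / 2"
proof -
  define F where "F x y = norm y + 4 * defect (x + y)" for x y
  define q where "q x = (INF y\<in>UNIV. F x y)" for x
  have bdd: "bdd_below (F x ` UNIV)" for x
    by (rule bdd_belowI2[of _ 0]) (simp add: F_def defect_nonneg)
  have "sublinear q"
    unfolding q_def
  proof (rule sublinear_INF[OF _ _ _ bdd])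
    fix x y k l
    have "defect (x + y + (k + l)) \<le> defect (x + k) + defect (y + l)"
      using defect_add[of "x + k" "y + l"] by (simp add: algebra_simps)
    then show "F (x + y) (k + l) \<le> F x k + F y l"
      using norm_triangle_ineq[of k l] by (simp add: F_def)
  next
    fix c :: real and x k assume c: "0 \<le> c"
    then show "F (c *\<^sub>R x) (c *\<^sub>R k) = c * F x k"
      using defect_scaleR[OF c, of "x + k"] by (simp add: F_def algebra_simps)
  qed auto
  then obtain g where g: "linear g" "\<And>z. g z \<le> q z" "g x = q x"
    using Hahn_Banach_dominated by blast
  have qF: "q z \<le> F z y" for z y unfolding q_def by (rule cINF_lower[OF bdd]) simp
  have "g z \<le> 1 * norm z" for z
    using g(2)[of z] qF[of z "- z"] defect_scaleR[of 0 0] by (simp add: F_def)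
  then obtain a where a: "\<And>z. Re (ev a z) = g z" "norm a \<le> 1"
    using linear_functional_is_ev[OF g(1), of 1] by auto
  have "accretive (- a)"
    by (rule accretive_if_dominated_by_defect[of _ 4]) (use a g(2) qF[of _ 0] order_trans in \<open>fastforce simp: F_def\<close>)+
  then have "- a \<in> accretive_ball" using a(2) by (simp add: accretive_ball_def)
  from defect_upper[OF this, of x] have "q x \<le> defect x" using a(1)[of x] g(3) by (simp add: ev_simps)
  then have "q x < 2 * defect x" using assms by simp
  then obtain y where "F x y < 2 * defect x"
    using cINF_less_iff[OF _ bdd, of x "2 * defect x"] by (auto simp: q_def)
  then show ?thesis
    using defect_nonneg[of "x + y"] norm_ge_zero[of y] unfolding F_def
    by (intro exI[of _ y] conjI; linarith)
qed

lemma near_predual_cone: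
  obtains z where "z \<in> predual_cone \<iota>" "norm (x - z) \<le> 4 * defect x"
proof -
  have "\<exists>s'\<in>UNIV. dist s s' \<le> 2 * defect s \<and> defect s' \<le> defect s / 2" for s
  proof (cases "defect s = 0")
    case False
    then have "0 < defect s" using defect_nonneg[of s] by simp
    then obtain y where "norm y \<le> 2 * defect s" "defect (s + y) \<le> defect s / 2"
      using reduce_defect by blast
    then show ?thesis by (intro bexI[of _ "s + y"]) (auto simp: dist_norm)
  qed (auto intro!: bexI[of _ s])
  then obtain z where "defect z = 0" "dist x z \<le> 2 * 2 * defect x"
    using iterate_halving[of UNIV x defect 2] continuous_on_defect defect_nonneg by auto
  then show ?thesis by (intro that[of z]) (auto simp: dist_norm defect_zero_imp_positive)
qed

text \<open>
  Every vector is within four times its defect of the cone, so a functional that is nonnegative on the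
  cone is bounded below by a multiple of the defect.
\<close>

lemma accretive_if_nonneg_on_predual_cone:
  assumes "\<And>z. z \<in> predual_cone \<iota> \<Longrightarrow> 0 \<le> Re (ev a z)"
  shows "accretive a"
proof -
  have "accretive (- (- a))"
  proof (rule accretive_if_dominated_by_defect)
    fix x
    obtain z where z: "z \<in> predual_cone \<iota>" "norm (x - z) \<le> 4 * defect x" using near_predual_cone by blast
    have "Re (ev (- a) x) = - Re (ev a z) + Re (ev (- a) (x - z))" by (simp add: ev_simps cdual_diff)
    also have "\<dots> \<le> 0 + norm (- a) * norm (x - z)" by (intro add_mono Re_ev_le) (use assms z in auto)
    also have "\<dots> \<le> (norm a + 1) * (4 * defect x)"
      using z(2) by (simp only: add_0 norm_minus_cancel) (intro mult_mono, auto)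
    finally show "Re (ev (- a) x) \<le> (4 * (norm a + 1)) * defect x" by (simp add: algebra_simps)
  qed (simp add: add_nonneg_pos)
  then show ?thesis by simp
qed

text \<open>
  On the cone the norm is evaluation at the unit.  Hence \<open>e - c a\<close> is nonnegative on the cone for all
  unimodular \<open>c\<close>, which bounds the real and imaginary parts of \<open>a\<close> by the unit.
\<close>

lemma norm_le_if_bounded_on_predual_cone:
  assumes le: "\<And>z. z \<in> predual_cone \<iota> \<Longrightarrow> cmod (ev a z) \<le> norm z"
  shows "norm a \<le> 2"
proof -
  obtain e :: 'a where e: "star e = e" "\<And>b. e * b = b" "\<And>b. b * e = b" "pos_elt (1 - unitize e)"
    using exists_unit by blast
  have ne: "norm z \<le> Re (ev e z)" if "z \<in> predual_cone \<iota>" for z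
    using norm_functional_le_at_unit[of "as_functional z" e] that e
    by (simp add: predual_cone_iff norm_as_functional as_functional_apply)
  have bound: "pos_elt (1 - unitize (re_part (c *\<^sub>C a)))" if c: "cmod c = 1" for c
  proof -
    have "accretive (e - c *\<^sub>C a)"
    proof (rule accretive_if_nonneg_on_predual_cone)
      fix z assume z: "z \<in> predual_cone \<iota>"
      have "Re (c * ev a z) \<le> cmod (ev a z)" using complex_Re_le_cmod[of "c * ev a z"] c by (simp add: norm_mult)
      then show "0 \<le> Re (ev (e - c *\<^sub>C a) z)" using ne[OF z] le[OF z] by (simp add: ev_simps)
    qed
    then have "cstar_positive ((1/2) *\<^sub>R ((e - c *\<^sub>C a) + star (e - c *\<^sub>C a)))"
      unfolding accretive_def by (rule cstar_positive_scaleR) simp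
    also have "(1/2) *\<^sub>R ((e - c *\<^sub>C a) + star (e - c *\<^sub>C a)) = e - re_part (c *\<^sub>C a)"
    proof -
      have "(e - c *\<^sub>C a) + star (e - c *\<^sub>C a) = 2 *\<^sub>R e - (c *\<^sub>C a + star (c *\<^sub>C a))"
        by (simp add: star_diff e scaleR_2)
      then show ?thesis by (simp only:) (simp add: re_part_def scaleR_diff_right)
    qed
    finally have "pos_elt (unitize e - unitize (re_part (c *\<^sub>C a)))" by (simp add: cstar_positive_def unitize_simps)
    from pos_elt_add[OF e(4) this] show ?thesis by simp
  qed
  have re: "norm (re_part (c *\<^sub>C a)) \<le> 1" if c: "cmod c = 1" for c
  proof -
    have "re_part ((- c) *\<^sub>C a) = - re_part (c *\<^sub>C a)"
      using re_part_scaleR[of "-1" "c *\<^sub>C a"] by simp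
    then have "pos_elt (1 + unitize (re_part (c *\<^sub>C a)))" using bound[of "- c"] c by (simp add: unitize_simps)
    then have "norm (unitize (re_part (c *\<^sub>C a))) \<le> 1"
      using norm_le_iff_pos_elt[of "unitize (re_part (c *\<^sub>C a))" 1] bound[OF c] by (simp add: selfadjoint_unitize)
    then show ?thesis by simp
  qed
  show ?thesis
    using norm_le_cartesian[of a] re[of 1] re[of "- \<i>"] by (simp add: im_part_def)
qed

subsection \<open>The normal positive functionals generate the predual\<close>

definition combine :: "('p \<times> 'p) \<times> ('p \<times> 'p) \<Rightarrow> 'p"
  where "combine = (\<lambda>((a, b), (c, d)). (a - b) + \<i> *\<^sub>C (c - d))"

definition total_norm :: "('p \<times> 'p) \<times> ('p \<times> 'p) \<Rightarrow> real"
  where "total_norm = (\<lambda>((a, b), (c, d)). norm a + norm b + (norm c + norm d))"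

abbreviation cone4 :: "(('p \<times> 'p) \<times> ('p \<times> 'p)) set"
  where "cone4 \<equiv> (predual_cone \<iota> \<times> predual_cone \<iota>) \<times> (predual_cone \<iota> \<times> predual_cone \<iota>)"

lemma combine_add: "combine (k + l) = combine k + combine l"
  and combine_scaleR: "combine (r *\<^sub>R k) = r *\<^sub>R combine k"
  by (auto simp: combine_def case_prod_beta scaleC_diff_right scaleC_add_right scaleC_scaleR_commute algebra_simps)

text \<open>
  By the Hahn--Banach theorem the infimum of \<open>total_norm k + 16 \<parallel>x - combine k\<parallel>\<close> equals \<open>Re (ev a x)\<close>
  for some \<open>a\<close> whose values on the cone are bounded by twice the norm; so \<open>\<parallel>a\<parallel> \<le> 4\<close>, whatever the
  factor in front of the residual.  The factor \<open>16\<close> makes the residual at most half of \<open>x\<close>.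
\<close>

lemma approximate_decomposition:
  assumes "x \<noteq> 0"
  shows "\<exists>k\<in>cone4. total_norm k \<le> 5 * norm x \<and> norm (x - combine k) \<le> norm x / 2"
proof -
  define F where "F x k = total_norm k + 16 * norm (x - combine k)" for x k
  define q where "q x = (INF k\<in>cone4. F x k)" for x
  have K0: "0 \<in> cone4" by (simp add: zero_prod_def zero_in_predual_cone)
  have c0: "combine 0 = 0" by (simp add: combine_def zero_prod_def)
  have bdd: "bdd_below (F x ` cone4)" for x
    by (rule bdd_belowI2[of _ 0]) (auto simp: F_def total_norm_def)
  have "sublinear q"
    unfolding q_def
  proof (rule sublinear_INF[OF K0 _ _ bdd])
    fix x y k l
    have "norm (x + y - combine (k + l)) \<le> norm (x - combine k) + norm (y - combine l)"
      using norm_triangle_ineq[of "x - combine k" "y - combine l"] by (simp add: combine_add algebra_simps)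
    moreover have "total_norm (k + l) \<le> total_norm k + total_norm l"
      unfolding total_norm_def case_prod_beta fst_add snd_add
      using norm_triangle_ineq[of "fst (fst k)" "fst (fst l)"] norm_triangle_ineq[of "snd (fst k)" "snd (fst l)"]
        norm_triangle_ineq[of "fst (snd k)" "fst (snd l)"] norm_triangle_ineq[of "snd (snd k)" "snd (snd l)"]
      by linarith
    ultimately show "F (x + y) (k + l) \<le> F x k + F y l" by (simp add: F_def)
  next
    fix c :: real and x k assume c: "0 \<le> c"
    have "norm (c *\<^sub>R x - combine (c *\<^sub>R k)) = c * norm (x - combine k)"
      using c by (simp add: combine_scaleR flip: scaleR_diff_right)
    moreover have "total_norm (c *\<^sub>R k) = c * total_norm k"
      using c by (simp add: total_norm_def case_prod_beta algebra_simps)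
    ultimately show "F (c *\<^sub>R x) (c *\<^sub>R k) = c * F x k" by (simp add: F_def algebra_simps)
  qed (auto simp: predual_cone_add predual_cone_scaleR)
  then obtain g where g: "linear g" "\<And>z. g z \<le> q z" "g x = q x"
    using Hahn_Banach_dominated by blast
  have gF: "g z \<le> F z k" if "k \<in> cone4" for z k
    using g(2)[of z] cINF_lower[OF bdd that, of z] by (simp add: q_def)
  have "g z \<le> 16 * norm z" for z
    using gF[OF K0, of z] c0 by (simp add: F_def total_norm_def zero_prod_def)
  then obtain a where a: "\<And>z. Re (ev a z) = g z"
    using linear_functional_is_ev[OF g(1), of 16] zero_le_numeral by blast
  have gz: "g z \<le> norm z" "g (- z) \<le> norm z" "g (\<i> *\<^sub>C z) \<le> norm z" "g (- (\<i> *\<^sub>C z)) \<le> norm z"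
    if z: "z \<in> predual_cone \<iota>" for z
    using gF[of "((z, 0), (0, 0))" z] gF[of "((0, z), (0, 0))" "- z"] gF[of "((0, 0), (z, 0))" "\<i> *\<^sub>C z"]
      gF[of "((0, 0), (0, z))" "- (\<i> *\<^sub>C z)"] z
    by (simp_all add: F_def total_norm_def combine_def zero_in_predual_cone)
  have "norm ((1/2) *\<^sub>R a) \<le> 2"
  proof (rule norm_le_if_bounded_on_predual_cone)
    fix z assume z: "z \<in> predual_cone \<iota>"
    have "\<bar>Re (ev a z)\<bar> \<le> norm z" "\<bar>Im (ev a z)\<bar> \<le> norm z"
      using gz[OF z] by (auto simp: a[symmetric] cdual_neg cdual_scaleC)
    then have "cmod (ev a z) \<le> 2 * norm z" using cmod_le[of "ev a z"] by linarith
    then show "cmod (ev ((1/2) *\<^sub>R a) z) \<le> norm z" by (simp add: ev_simps norm_mult)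
  qed
  then have "norm a \<le> 4" by simp
  then have "Re (ev a x) \<le> 4 * norm x"
    using Re_ev_le[of a x] mult_right_mono[of "norm a" 4 "norm x"] by simp
  moreover have "0 < norm x" using assms by simp
  ultimately have "q x < 5 * norm x" using g(3) a[of x] by linarith
  then obtain k where k: "k \<in> cone4" "F x k < 5 * norm x"
    using cINF_less_iff[OF _ bdd, of x "5 * norm x"] K0 by (auto simp: q_def)
  moreover have "0 \<le> total_norm k" by (auto simp: total_norm_def case_prod_beta)
  ultimately show ?thesis
    using norm_ge_zero[of "x - combine k"] unfolding F_def
    by (intro bexI[of _ k] conjI; (assumption | linarith))
qed

theorem predual_cone_generating:
  obtains a b c d where "a \<in> predual_cone \<iota>" "b \<in> predual_cone \<iota>" "c \<in> predual_cone \<iota>"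
    "d \<in> predual_cone \<iota>" "x = (a - b) + \<i> *\<^sub>C (c - d)"
proof -
  define f where "f k = norm (x - combine k)" for k
  have cl: "closed cone4" by (intro closed_Times closed_predual_cone)
  have zero: "0 \<in> cone4" by (simp add: zero_prod_def zero_in_predual_cone)
  have cont: "continuous_on cone4 f"
    unfolding f_def combine_def case_prod_beta
    by (intro continuous_intros bounded_linear.continuous_on[OF bounded_linear_scaleC_right])
  \<comment> \<open>The residual is decomposed again, and the pieces are added to the old ones.\<close>
  have step: "\<exists>k'\<in>cone4. dist k k' \<le> 5 * f k \<and> f k' \<le> f k / 2" if k: "k \<in> cone4" for k
  proof (cases "x - combine k = 0")
    case True
    then show ?thesis using k by (intro bexI[of _ k]) (auto simp: f_def)
  next
    case False
    obtain l where l: "l \<in> cone4" "total_norm l \<le> 5 * norm (x - combine k)"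
      "norm (x - combine k - combine l) \<le> norm (x - combine k) / 2"
      using approximate_decomposition[OF False] by blast
    have "norm l \<le> total_norm l"
      unfolding total_norm_def case_prod_beta
      using norm_Pair_le[of "fst l" "snd l"] norm_Pair_le[of "fst (fst l)" "snd (fst l)"]
        norm_Pair_le[of "fst (snd l)" "snd (snd l)"] by simp
    then have "dist k (k + l) \<le> 5 * f k" using l(2) by (simp add: dist_norm f_def)
    moreover have "f (k + l) \<le> f k / 2" using l(3) by (simp only: f_def combine_add diff_diff_eq)
    moreover have "k + l \<in> cone4" using k l(1) by (simp add: mem_Times_iff predual_cone_add)
    ultimately show ?thesis by (intro bexI[of _ "k + l"] conjI)
  qed
  have f0: "0 \<le> f k" for k by (simp add: f_def)
  obtain k where k: "k \<in> cone4" "f k = 0"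
    by (rule iterate_halving[OF cl zero cont f0 zero_le_numeral step]; (assumption | rule that))
  then have "x = combine k" by (simp add: f_def)
  then show ?thesis using k(1) by (intro that) (auto simp: combine_def case_prod_beta)
qed

end

section \<open>The Banach algebra of bounded operators\<close>

text \<open>
  Bounded complex-linear operators are collected in a type, so that the results on Banach algebras
  apply to them.
\<close>

typedef (overloaded) 'a cop = "{f :: 'a::complex_normed_vector \<Rightarrow>\<^sub>L 'a. \<forall>c x. f (c *\<^sub>C x) = c *\<^sub>C f x}"
  morphisms real_op Cop
  by (rule exI[of _ 0]) simp

setup_lifting type_definition_cop

lift_definition capp :: "'a::complex_normed_vector cop \<Rightarrow> 'a \<Rightarrow> 'a" is blinfun_apply .

instantiation cop :: (complex_normed_vector) complex_normed_vector
begin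

lift_definition norm_cop :: "'a cop \<Rightarrow> real" is norm .
lift_definition zero_cop :: "'a cop" is 0 by simp
lift_definition plus_cop :: "'a cop \<Rightarrow> 'a cop \<Rightarrow> 'a cop" is "(+)"
  by (simp add: blinfun.add_left scaleC_add_right)
lift_definition minus_cop :: "'a cop \<Rightarrow> 'a cop \<Rightarrow> 'a cop" is "(-)"
  by (simp add: blinfun.diff_left scaleC_diff_right)
lift_definition uminus_cop :: "'a cop \<Rightarrow> 'a cop" is uminus
  by (simp add: blinfun.minus_left)
lift_definition scaleR_cop :: "real \<Rightarrow> 'a cop \<Rightarrow> 'a cop" is "(*\<^sub>R)"
  by (simp add: blinfun.scaleR_left scaleC_scaleR_commute)
lift_definition scaleC_cop :: "complex \<Rightarrow> 'a cop \<Rightarrow> 'a cop"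
  is "\<lambda>c (f :: 'a \<Rightarrow>\<^sub>L 'a). Blinfun (\<lambda>x. c *\<^sub>C f x)"
  by (simp add: bounded_linear_Blinfun_apply bounded_linear_compose[OF bounded_linear_scaleC_right]
      blinfun.bounded_linear_right scaleC_scaleC mult.commute)

definition dist_cop :: "'a cop \<Rightarrow> 'a cop \<Rightarrow> real"
  where "dist_cop u v = norm (u - v)"

definition uniformity_cop :: "('a cop \<times> 'a cop) filter"
  where "uniformity_cop = (INF e\<in>{0 <..}. principal {(u, v). dist u v < e})"

definition open_cop :: "'a cop set \<Rightarrow> bool"
  where "open_cop S \<longleftrightarrow> (\<forall>u\<in>S. \<forall>\<^sub>F (u', v) in uniformity. u' = u \<longrightarrow> v \<in> S)"

definition sgn_cop :: "'a cop \<Rightarrow> 'a cop"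
  where "sgn_cop u = inverse (norm u) *\<^sub>R u"

lemma capp_scaleC: "capp (c *\<^sub>C F) x = c *\<^sub>C capp F x"
  by transfer (simp add: bounded_linear_Blinfun_apply bounded_linear_compose[OF bounded_linear_scaleC_right]
      blinfun.bounded_linear_right)

lemma capp_eqI: "(\<And>x. capp F x = capp G x) \<Longrightarrow> F = G"
  by transfer (rule blinfun_eqI)

lemma capp_plus: "capp (F + G) x = capp F x + capp G x"
  by transfer (rule blinfun.add_left)

lemma capp_scaleR: "capp (r *\<^sub>R F) x = r *\<^sub>R capp F x"
  by transfer (rule blinfun.scaleR_left)

lemma norm_cop_eq: "norm F = onorm (capp F)"
  by transfer (rule norm_blinfun.rep_eq)

lemma capp_bounded_linear: "bounded_linear (capp F)"
  by transfer (rule blinfun.bounded_linear_right)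

instance
proof
  fix u v w :: "'a cop" and a b :: real and c d :: complex
  show "u + v + w = u + (v + w)" "u + v = v + u" "0 + u = u" "- u + u = 0" "u - v = u + - v"
    by (transfer, simp add: algebra_simps)+
  show "a *\<^sub>R (u + v) = a *\<^sub>R u + a *\<^sub>R v" "(a + b) *\<^sub>R u = a *\<^sub>R u + b *\<^sub>R u"
    "a *\<^sub>R b *\<^sub>R u = (a * b) *\<^sub>R u" "1 *\<^sub>R u = u"
    by (transfer, simp add: algebra_simps)+
  show "c *\<^sub>C (u + v) = c *\<^sub>C u + c *\<^sub>C v" "(c + d) *\<^sub>C u = c *\<^sub>C u + d *\<^sub>C u"
    "c *\<^sub>C d *\<^sub>C u = (c * d) *\<^sub>C u" "complex_of_real a *\<^sub>C u = a *\<^sub>R u"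
    by (rule capp_eqI; simp add: capp_scaleC capp_plus capp_scaleR scaleC_add_right scaleC_add_left
        scaleC_scaleC scaleC_of_real)+
  show "norm (c *\<^sub>C u) = cmod c * norm u"
  proof -
    have "capp (c *\<^sub>C u) = (\<lambda>x. c *\<^sub>C capp u x)" by (rule ext) (rule capp_scaleC)
    then show ?thesis using onorm_scaleC[OF capp_bounded_linear, of c u] by (simp add: norm_cop_eq)
  qed
  show "norm (a *\<^sub>R u) = \<bar>a\<bar> * norm u" "(norm u = 0) = (u = 0)" "norm (u + v) \<le> norm u + norm v"
    by (transfer, simp add: norm_triangle_ineq)+
qed (simp_all add: dist_cop_def uniformity_cop_def open_cop_def sgn_cop_def)

end

lemma norm_capp_le: "norm (capp F x) \<le> norm F * norm x"
  unfolding norm_cop_eq by (rule onorm[OF capp_bounded_linear])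

lemmas capp_simps = capp_scaleC capp_plus capp_scaleR
lemmas capp_add_right = linear_add[OF bounded_linear.linear[OF capp_bounded_linear]]
lemmas capp_diff_right = linear_diff[OF bounded_linear.linear[OF capp_bounded_linear]]
lemmas capp_scaleR_right = linear_scale[OF bounded_linear.linear[OF capp_bounded_linear]]

lemma capp_scaleC_right: "capp F (c *\<^sub>C x) = c *\<^sub>C capp F x"
  by transfer blast

lemma capp_minus: "capp (F - G) x = capp F x - capp G x"
  by transfer (rule blinfun.diff_left)

lemma bounded_linear_capp_left: "bounded_linear (\<lambda>F. capp F x)"
  by (rule bounded_linear_intro[of _ "norm x"]) (simp_all add: capp_simps norm_capp_le)

definition cop_of :: "('a \<Rightarrow> 'a) \<Rightarrow> 'a::complex_normed_vector cop"
  where "cop_of f = Cop (Blinfun f)"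

lemma capp_cop_of: "bounded_clinear f \<Longrightarrow> capp (cop_of f) = f"
  unfolding cop_of_def capp.rep_eq
  by (subst Cop_inverse) (auto simp: bounded_clinear_iff bounded_linear_Blinfun_apply)

lemma bounded_clinear_capp: "bounded_clinear (capp F)"
  by (auto simp: bounded_clinear_iff capp_bounded_linear capp_scaleC_right)

instantiation cop :: (complex_banach) complex_banach_algebra
begin

lift_definition one_cop :: "'a cop" is id_blinfun by simp
lift_definition times_cop :: "'a cop \<Rightarrow> 'a cop \<Rightarrow> 'a cop" is "(o\<^sub>L)" by simp

lemma capp_times: "capp (F * G) x = capp F (capp G x)"
  by transfer simp

instance
proof
  fix u v w :: "'a cop" and a :: real and c :: complex
  show "u * v * w = u * (v * w)" "1 * u = u" "u * 1 = u"
    by (transfer, rule blinfun_eqI, simp)+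
  show "(u + v) * w = u * w + v * w" "u * (v + w) = u * v + u * w"
    "(a *\<^sub>R u) * v = a *\<^sub>R (u * v)" "u * (a *\<^sub>R v) = a *\<^sub>R (u * v)"
    by (transfer, rule blinfun_eqI, simp add: blinfun.add_left blinfun.add_right blinfun.scaleR_left blinfun.scaleR_right)+
  show "(c *\<^sub>C u) * v = c *\<^sub>C (u * v)" "u * (c *\<^sub>C v) = c *\<^sub>C (u * v)"
    by (rule capp_eqI; simp add: capp_times capp_scaleC capp_scaleC_right)+
  show "norm (u * v) \<le> norm u * norm v" by transfer (rule norm_blinfun_compose)
next
  fix X :: "nat \<Rightarrow> 'a cop"
  assume "Cauchy X"
  then have "Cauchy (\<lambda>n. real_op (X n))"
    by (simp add: Cauchy_def dist_norm norm_cop.rep_eq minus_cop.rep_eq dist_cop_def)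
  then obtain L where L: "(\<lambda>n. real_op (X n)) \<longlonglongrightarrow> L"
    by (auto simp: Cauchy_convergent_iff convergent_def)
  have lim: "(\<lambda>n. capp (X n) x) \<longlonglongrightarrow> blinfun_apply L x" for x
    using blinfun.tendsto[OF L tendsto_const[of x]] by (simp add: capp.rep_eq)
  have "blinfun_apply L (c *\<^sub>C x) = c *\<^sub>C blinfun_apply L x" for c x
  proof (rule LIMSEQ_unique[OF lim])
    show "(\<lambda>n. capp (X n) (c *\<^sub>C x)) \<longlonglongrightarrow> c *\<^sub>C blinfun_apply L x"
      unfolding capp_scaleC_right by (intro tendsto_scaleC tendsto_const lim)
  qed
  then have "real_op (Cop L) = L" by (simp add: Cop_inverse)
  then have "X \<longlonglongrightarrow> Cop L"
    using L by (simp add: lim_sequentially dist_norm norm_cop.rep_eq minus_cop.rep_eq dist_cop_def)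
  then show "convergent X" by (auto simp: convergent_def)
qed

end

lemma capp_one: "capp 1 x = x"
  by transfer simp

definition is_resolvent :: "'a::complex_banach partial_operator \<Rightarrow> complex \<Rightarrow> 'a cop \<Rightarrow> bool"
  where "is_resolvent = (\<lambda>(D, A) l R.
    (\<forall>y. capp R y \<in> D \<and> l *\<^sub>C capp R y - A (capp R y) = y) \<and> (\<forall>x\<in>D. capp R (l *\<^sub>C x - A x) = x))"

lemma resolvent_set_iff: "l \<in> resolvent_set A \<longleftrightarrow> (\<exists>R. is_resolvent A l R)"
proof (cases A)
  case (Pair D B)
  let ?f = "\<lambda>x. l *\<^sub>C x - B x"
  show ?thesis
  proof
    assume "l \<in> resolvent_set A"
    then have bij: "bij_betw ?f D UNIV" and bc: "bounded_clinear (inv_into D ?f)"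
      by (auto simp: resolvent_set_def Pair)
    have "is_resolvent A l (cop_of (inv_into D ?f))"
      using bij_betw_inv_into_left[OF bij] bij_betw_inv_into_right[OF bij] bij_betw_apply[OF bij_betw_inv_into[OF bij]]
      by (simp add: is_resolvent_def Pair capp_cop_of[OF bc])
    then show "\<exists>R. is_resolvent A l R" by blast
  next
    assume "\<exists>R. is_resolvent A l R"
    then obtain R where R: "\<And>y. capp R y \<in> D" "\<And>y. ?f (capp R y) = y" "\<And>x. x \<in> D \<Longrightarrow> capp R (?f x) = x"
      by (auto simp: is_resolvent_def Pair)
    have inj: "inj_on ?f D" by (rule inj_on_inverseI[of _ "capp R"]) (rule R(3))
    have bij: "bij_betw ?f D UNIV"
      unfolding bij_betw_def using inj R(1,2) by (metis (mono_tags, lifting) UNIV_eq_I image_iff)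
    have "inv_into D ?f = capp R"
    proof
      fix y
      show "inv_into D ?f y = capp R y" using inv_into_f_eq[OF inj R(1)] R(2) by blast
    qed
    then show "l \<in> resolvent_set A"
      using bij by (simp add: resolvent_set_def Pair bounded_clinear_capp)
  qed
qed

lemma is_resolvent_bounded_iff:
  "is_resolvent (UNIV, capp F) l R \<longleftrightarrow> inverses (l *\<^sub>C 1 - F) R"
  by (auto simp: is_resolvent_def inverses_def capp_times capp_minus capp_scaleC capp_one
      intro!: capp_eqI dest: arg_cong[of _ _ "\<lambda>F. capp F _"])

lemma resolvent_identity:
  assumes R: "is_resolvent A l R" and S: "is_resolvent A m S"
  shows "S = R + (l - m) *\<^sub>C (R * S)"
proof (rule capp_eqI)
  fix y
  obtain D B where A: "A = (D, B)" by (cases A)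
  have "capp S y = capp R (l *\<^sub>C capp S y - B (capp S y))"
    using R S by (simp add: is_resolvent_def A)
  also have "l *\<^sub>C capp S y - B (capp S y) = y + (l - m) *\<^sub>C capp S y"
  proof -
    have m: "m *\<^sub>C capp S y - B (capp S y) = y" using S by (simp add: is_resolvent_def A)
    have "l *\<^sub>C capp S y - B (capp S y) = (m *\<^sub>C capp S y - B (capp S y)) + (l - m) *\<^sub>C capp S y"
      by (simp add: scaleC_diff_left)
    then show ?thesis by (simp only: m)
  qed
  finally show "capp S y = capp (R + (l - m) *\<^sub>C (R * S)) y"
    by (simp add: capp_add_right capp_scaleC_right capp_plus capp_scaleC capp_times)
qed

section \<open>Semigroups\<close>

locale c0_semigroup =
  fixes T :: "real \<Rightarrow> 'x::complex_banach \<Rightarrow> 'x"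
  assumes C0: "C0_semigroup T"
begin

definition op :: "real \<Rightarrow> 'x cop"
  where "op t = cop_of (T t)"

lemma capp_op: "0 \<le> t \<Longrightarrow> capp (op t) = T t"
  using C0 by (simp add: op_def capp_cop_of C0_semigroup_def)

lemma op_zero: "op 0 = 1"
  using C0 by (intro capp_eqI) (simp add: capp_op capp_one C0_semigroup_def)

lemma op_add: "0 \<le> s \<Longrightarrow> 0 \<le> t \<Longrightarrow> op (s + t) = op s * op t"
  using C0 by (intro capp_eqI) (simp add: capp_op capp_times C0_semigroup_def)

lemma op_power: "0 \<le> t \<Longrightarrow> op t ^ n = op (real n * t)"
  by (induction n) (simp_all add: op_zero distrib_right op_add)

lemma continuous_orbit: "S \<subseteq> {0..} \<Longrightarrow> continuous_on S (\<lambda>t. T t x)"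
  using C0 by (auto simp: C0_semigroup_def intro: continuous_on_subset)

lemma bounded_op_interval:
  obtains M where "0 \<le> M" "\<And>t. 0 \<le> t \<Longrightarrow> t \<le> b \<Longrightarrow> norm (op t) \<le> M"
proof -
  have "\<exists>M. \<forall>f\<in>T ` {0..b}. onorm f \<le> M"
  proof (rule uniform_boundedness)
    show "bounded_linear f" if "f \<in> T ` {0..b}" for f
    proof -
      from that obtain t where "0 \<le> t" "f = T t" by auto
      then show ?thesis using capp_bounded_linear[of "op t"] by (simp add: capp_op)
    qed
    fix x
    have "compact ((\<lambda>t. T t x) ` {0..b})"
      by (intro compact_continuous_image continuous_orbit compact_Icc) auto
    then obtain B where "\<And>y. y \<in> (\<lambda>t. T t x) ` {0..b} \<Longrightarrow> norm y \<le> B"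
      using compact_imp_bounded bounded_iff by metis
    then show "\<exists>B. \<forall>f\<in>T ` {0..b}. norm (f x) \<le> B" by blast
  qed
  then obtain M where M: "\<And>t. 0 \<le> t \<Longrightarrow> t \<le> b \<Longrightarrow> onorm (T t) \<le> M" by fastforce
  have "norm (op t) \<le> max M 0" if "0 \<le> t" "t \<le> b" for t
    using M[OF that] capp_op[OF that(1)] by (simp add: norm_cop_eq)
  then show ?thesis by (intro that[of "max M 0"]) auto
qed

subsection \<open>Growth and spectral radius\<close>

definition growth_exponents :: "real set"
  where "growth_exponents = {w. \<exists>M. \<forall>t\<ge>0. norm (op t) \<le> M * exp (w * t)}"

text \<open>
  Submultiplicativity: a bound at one time propagates to its multiples, and local boundedness fills
  the gaps.
\<close>

lemma growth_exponentI:
  assumes \<tau>: "0 < \<tau>" and le: "norm (op \<tau>) \<le> exp (w * \<tau>)"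
  shows "w \<in> growth_exponents"
proof -
  obtain M where M: "0 \<le> M" "\<And>t. 0 \<le> t \<Longrightarrow> t \<le> \<tau> \<Longrightarrow> norm (op t) \<le> M"
    using bounded_op_interval by blast
  have "norm (op t) \<le> (M * exp (\<bar>w\<bar> * \<tau>)) * exp (w * t)" if t: "0 \<le> t" for t
  proof -
    define n where "n = nat \<lfloor>t / \<tau>\<rfloor>"
    define r where "r = t - real n * \<tau>"
    have "real n \<le> t / \<tau>" "t / \<tau> < real n + 1"
      using t \<tau> by (auto simp: n_def)
    then have r: "0 \<le> r" "r \<le> \<tau>" using \<tau> by (auto simp: r_def field_simps)
    have pow: "norm (op r * op \<tau> ^ k) \<le> norm (op r) * exp (w * \<tau>) ^ k" for k
    proof (induction k)
      case (Suc k)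
      have "norm (op r * op \<tau> ^ Suc k) \<le> norm (op r * op \<tau> ^ k) * norm (op \<tau>)"
        by (simp only: power_Suc2 mult.assoc[symmetric] norm_mult_ineq)
      also have "\<dots> \<le> (norm (op r) * exp (w * \<tau>) ^ k) * exp (w * \<tau>)"
        by (intro mult_mono Suc le) auto
      finally show ?case by (simp add: algebra_simps)
    qed simp
    have "op t = op r * op \<tau> ^ n"
      using r \<tau> by (simp add: op_power op_add[symmetric] r_def)
    then have "norm (op t) \<le> norm (op r) * exp (w * \<tau>) ^ n" using pow by simp
    also have "\<dots> \<le> M * exp (w * \<tau>) ^ n" using M(2)[OF r] by (intro mult_right_mono) auto
    also have "exp (w * \<tau>) ^ n = exp (w * t - w * r)"
      by (simp add: exp_of_nat_mult[symmetric] r_def algebra_simps)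
    also have "M * exp (w * t - w * r) \<le> M * exp (w * t + \<bar>w\<bar> * \<tau>)"
    proof (intro mult_left_mono M)
      have "- (w * r) \<le> \<bar>w\<bar> * r" using r by (simp add: abs_if mult_left_mono)
      also have "\<dots> \<le> \<bar>w\<bar> * \<tau>" using r by (intro mult_left_mono) auto
      finally show "exp (w * t - w * r) \<le> exp (w * t + \<bar>w\<bar> * \<tau>)" by simp
    qed
    finally show ?thesis by (simp add: exp_add mult_ac)
  qed
  then show ?thesis by (auto simp: growth_exponents_def)
qed

lemma growth_exponents_nonempty: "growth_exponents \<noteq> {}"
proof -
  have "norm (op 1) \<le> exp (ln (norm (op 1) + 1) * 1)" by (simp add: add_nonneg_pos)
  then show ?thesis using growth_exponentI[of 1] by auto
qed

text \<open>
  The growth bound defined by exponential estimates; \<open>growth_bound_eq_growth\<close> identifies it with the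
  one defined by spectral radii.
\<close>

definition growth :: ereal
  where "growth = (INF w\<in>growth_exponents. ereal w)"

lemma growth_less_iff: "growth < ereal c \<longleftrightarrow> (\<exists>w\<in>growth_exponents. w < c)"
  unfolding growth_def by (simp add: INF_less_iff)

lemma growth_finite: "growth < \<infinity>"
proof -
  obtain w where "w \<in> growth_exponents" using growth_exponents_nonempty by blast
  then have "growth \<le> ereal w" unfolding growth_def by (rule INF_lower)
  then show ?thesis by (rule le_less_trans) simp
qed

lemma exp_ereal_less_iff:
  assumes "w < \<infinity>" "0 < t" "0 < c"
  shows "exp_ereal (w * ereal t) < ennreal c \<longleftrightarrow> w < ereal (ln c / t)"
proof (cases w)
  case (real r)
  have "exp (r * t) < c \<longleftrightarrow> r * t < ln c"
    using assms(3) by (metis exp_less_cancel_iff exp_ln)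
  then show ?thesis using assms by (simp add: real exp_ereal_def ennreal_less_iff field_simps)
qed (use assms in \<open>auto simp: exp_ereal_def\<close>)

lemma has_inverse_beyond_growth:
  assumes t: "0 < t" and l: "growth < ereal (ln (cmod l) / t)" "l \<noteq> 0"
  shows "has_inverse (l *\<^sub>C 1 - op t)"
proof -
  obtain w M where w: "w < ln (cmod l) / t" and M: "\<And>t. 0 \<le> t \<Longrightarrow> norm (op t) \<le> M * exp (w * t)"
    using l(1) unfolding growth_less_iff by (auto simp: growth_exponents_def)
  define q where "q = exp (w * t) / cmod l"
  have "w * t < ln (cmod l)" using w t by (simp add: field_simps)
  then have "exp (w * t) < cmod l" using l(2) by (metis exp_less_cancel_iff exp_ln zero_less_norm_iff)
  then have q: "0 \<le> q" "q < 1" using l(2) by (auto simp: q_def)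
  have "norm ((inverse l *\<^sub>C op t) ^ n) \<le> M * q ^ n" for n
  proof -
    have "norm ((inverse l *\<^sub>C op t) ^ n) = (1 / cmod l) ^ n * norm (op (real n * t))"
      using t by (simp add: scaleC_power norm_scaleC norm_power norm_divide op_power inverse_eq_divide power_one_over)
    also have "\<dots> \<le> (1 / cmod l) ^ n * (M * exp (w * (real n * t)))"
      using t by (intro mult_left_mono M) auto
    also have "\<dots> = M * q ^ n"
      by (simp add: q_def power_divide exp_of_nat_mult[symmetric] mult_ac)
    finally show ?thesis .
  qed
  moreover have "summable (\<lambda>n. M * q ^ n)"
    using q by (simp add: summable_mult summable_geometric)
  ultimately have "summable (\<lambda>n. norm ((inverse l *\<^sub>C op t) ^ n))"
    using summable_comparison_test'[of "\<lambda>n. M * q ^ n" 0 "\<lambda>n. norm ((inverse l *\<^sub>C op t) ^ n)"] by simp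
  then have "has_inverse (1 - inverse l *\<^sub>C op t)" using Neumann[of "inverse l *\<^sub>C op t"] by (auto simp: has_inverse_def)
  then have "has_inverse (l *\<^sub>C (1 - inverse l *\<^sub>C op t))" using l(2) by (simp add: has_inverse_scaleC_iff)
  then show ?thesis using l(2) by (simp add: scaleC_diff_right scaleC_scaleC)
qed

lemma spectrum_op_iff: "0 \<le> t \<Longrightarrow> l \<in> spectrum (UNIV, T t) \<longleftrightarrow> \<not> has_inverse (l *\<^sub>C 1 - op t)"
  using capp_op[of t]
  by (simp add: spectrum_def resolvent_set_iff is_resolvent_bounded_iff has_inverse_def flip: capp_op)

lemma spectral_radius_le:
  assumes t: "0 < t"
  shows "spectral_radius (T t) \<le> exp_ereal (growth * ereal t)"
  unfolding spectral_radius_def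
proof (rule SUP_least)
  fix l assume l: "l \<in> spectrum (UNIV, T t)"
  show "ennreal (cmod l) \<le> exp_ereal (growth * ereal t)"
  proof (cases "l = 0")
    case False
    have "\<not> exp_ereal (growth * ereal t) < ennreal (cmod l)"
      using l t False has_inverse_beyond_growth[OF t _ False]
      by (auto simp: exp_ereal_less_iff[OF growth_finite t] spectrum_op_iff)
    then show ?thesis by simp
  qed simp
qed

text \<open>
  Otherwise the spectral radius formula gives a power of \<open>T(t)\<close> with norm below
  \<open>exp (growth \<cdot> n t)\<close>, and a single such estimate already lowers the growth bound.
\<close>

lemma spectral_radius_ge:
  assumes t: "0 < t"
  shows "exp_ereal (growth * ereal t) \<le> spectral_radius (T t)"
proof (rule ccontr)
  assume "\<not> ?thesis"
  then have lt: "spectral_radius (T t) < exp_ereal (growth * ereal t)" by simp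
  then obtain r where r: "growth = ereal r"
    using growth_finite t by (cases growth) (auto simp: exp_ereal_def)
  define \<nu> where "\<nu> = exp (r * t)"
  have \<nu>: "0 < \<nu>" by (simp add: \<nu>_def)
  have lt\<nu>: "spectral_radius (T t) < ennreal \<nu>" using lt by (simp add: r exp_ereal_def \<nu>_def)
  have inv: "has_inverse (l *\<^sub>C 1 - op t)" if l: "\<nu> \<le> cmod l" for l
  proof (rule ccontr)
    assume "\<not> has_inverse (l *\<^sub>C 1 - op t)"
    then have "l \<in> spectrum (UNIV, T t)" using t by (simp add: spectrum_op_iff)
    then have "ennreal (cmod l) \<le> spectral_radius (T t)" unfolding spectral_radius_def by (rule SUP_upper)
    also note lt\<nu>
    also have "ennreal \<nu> \<le> ennreal (cmod l)" using l by (rule ennreal_leI)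
    finally show False by simp
  qed
  have "\<exists>n\<ge>1. (1 / \<nu>) ^ n * norm (op t ^ n) < 1"
  proof (rule spectral_radius_attained)
    show "0 < 1 / \<nu>" using \<nu> by simp
  next
    fix z assume z: "cmod z \<le> 1 / \<nu>"
    show "has_inverse (1 - z *\<^sub>C op t)"
    proof (cases "z = 0")
      case False
      have "\<nu> \<le> cmod (inverse z)" using z False \<nu> by (simp add: norm_divide field_simps)
      then have "has_inverse (z *\<^sub>C (inverse z *\<^sub>C 1 - op t))" using inv False by (simp add: has_inverse_scaleC_iff)
      then show ?thesis using False by (simp add: scaleC_diff_right scaleC_scaleC)
    qed (auto simp: has_inverse_def inverses_def)
  next
    fix s assume s: "0 \<le> s" "s < 1 / \<nu>"
    show "(\<lambda>n. s ^ n * norm (op t ^ n)) \<longlonglongrightarrow> 0"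
    proof (cases "s = 0")
      case True
      then show ?thesis
        by (intro tendsto_eventually eventually_sequentiallyI[of 1]) (simp add: power_0_left)
    next
      case False
      then have s0: "0 < s" using s by simp
      have "ln s < - (r * t)"
        using s s0 \<nu> by (metis \<nu>_def exp_minus inverse_eq_divide ln_exp ln_less_cancel_iff zero_less_divide_1_iff)
      then have "r < - ln s / t" using t by (simp add: field_simps)
      then have "growth < ereal (- ln s / t)" by (simp add: r)
      then obtain w M where w: "w < - ln s / t" and M: "\<And>t. 0 \<le> t \<Longrightarrow> norm (op t) \<le> M * exp (w * t)"
        unfolding growth_less_iff by (auto simp: growth_exponents_def)
      have "w * t < - ln s" using w t by (simp add: field_simps)
      then have "exp (ln s + w * t) < 1" by simp
      then have q: "s * exp (w * t) < 1" using s0 by (simp add: exp_add)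
      have lim: "(\<lambda>n. M * (s * exp (w * t)) ^ n) \<longlonglongrightarrow> 0"
        using q s0 by (intro tendsto_mult_right_zero LIMSEQ_power_zero) simp
      show ?thesis
      proof (rule Lim_null_comparison[OF always_eventually[OF allI] lim])
        fix n
        have "s ^ n * norm (op (real n * t)) \<le> s ^ n * (M * exp (w * (real n * t)))"
          using s0 t by (intro mult_left_mono M) auto
        then show "norm (s ^ n * norm (op t ^ n)) \<le> M * (s * exp (w * t)) ^ n"
          using s0 t by (simp add: op_power power_mult_distrib exp_of_nat_mult[symmetric] mult_ac)
      qed
    qed
  qed
  then obtain n :: nat where n: "1 \<le> n" "norm (op (real n * t)) < \<nu> ^ n"
    using \<nu> t by (auto simp: op_power power_divide)
  define \<tau> where "\<tau> = real n * t"
  have \<tau>: "0 < \<tau>" using n t by (simp add: \<tau>_def)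
  \<comment> \<open>The maximum keeps the logarithm meaningful if the operator vanishes.\<close>
  define c where "c = max (norm (op \<tau>)) (exp ((r - 1) * \<tau>))"
  have "\<nu> ^ n = exp (r * \<tau>)" by (simp add: \<nu>_def \<tau>_def exp_of_nat_mult[symmetric] mult_ac)
  then have c: "c < exp (r * \<tau>)" "0 < c"
    using n(2) \<tau> by (auto simp: c_def \<tau>_def[symmetric] less_max_iff_disj)
  have "ln c / \<tau> \<in> growth_exponents"
  proof (rule growth_exponentI[OF \<tau>])
    show "norm (op \<tau>) \<le> exp (ln c / \<tau> * \<tau>)" using \<tau> c by (simp add: c_def)
  qed
  moreover have "ln c / \<tau> < r"
    using c \<tau> by (metis exp_less_cancel_iff exp_ln pos_divide_less_eq)
  ultimately have "growth < ereal r" unfolding growth_less_iff by blast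
  then show False by (simp add: r)
qed

lemma growth_bound_eq_growth: "growth_bound T = growth"
  by (rule growth_bound_eqI[OF growth_finite]) (intro antisym spectral_radius_le spectral_radius_ge)

end

subsection \<open>Riemann sums\<close>

text \<open>
  The integral of a continuous function and the integral of its norm are approximated by Riemann
  sums over one common tagged division.
\<close>

lemma common_Riemann_sums:
  fixes f :: "real \<Rightarrow> 'a::banach"
  assumes f: "continuous_on {a..b} f" and e: "0 < e"
  obtains p :: "(real \<times> real set) set" where "finite p" "\<And>x k. (x, k) \<in> p \<Longrightarrow> x \<in> {a..b}"
    "norm ((\<Sum>(x, k)\<in>p. measure lborel k *\<^sub>R f x) - integral {a..b} f) < e"
    "\<bar>(\<Sum>(x, k)\<in>p. measure lborel k * norm (f x)) - integral {a..b} (\<lambda>x. norm (f x))\<bar> < e"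
proof -
  have "(f has_integral integral {a..b} f) {a..b}"
    by (intro integrable_integral integrable_continuous_real f)
  from has_integral_real[THEN iffD1, rule_format, OF this e]
  have "\<exists>g. gauge g \<and> (\<forall>p. p tagged_division_of {a..b} \<and> g fine p \<longrightarrow>
      norm ((\<Sum>(x, k)\<in>p. measure lborel k *\<^sub>R f x) - integral {a..b} f) < e)" .
  then obtain g where g: "gauge g" "\<And>p. p tagged_division_of {a..b} \<Longrightarrow> g fine p \<Longrightarrow>
      norm ((\<Sum>(x, k)\<in>p. measure lborel k *\<^sub>R f x) - integral {a..b} f) < e"
    by (elim exE conjE) simp
  have "((\<lambda>x. norm (f x)) has_integral integral {a..b} (\<lambda>x. norm (f x))) {a..b}"
    by (intro integrable_integral integrable_continuous_real continuous_intros f)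
  from has_integral_real[THEN iffD1, rule_format, OF this e]
  have "\<exists>h. gauge h \<and> (\<forall>p. p tagged_division_of {a..b} \<and> h fine p \<longrightarrow>
      norm ((\<Sum>(x, k)\<in>p. measure lborel k *\<^sub>R norm (f x)) - integral {a..b} (\<lambda>x. norm (f x))) < e)" .
  then obtain h where h: "gauge h" "\<And>p. p tagged_division_of {a..b} \<Longrightarrow> h fine p \<Longrightarrow>
      norm ((\<Sum>(x, k)\<in>p. measure lborel k *\<^sub>R norm (f x)) - integral {a..b} (\<lambda>x. norm (f x))) < e"
    by (elim exE conjE) simp
  obtain p where p: "p tagged_division_of {a..b}" "(\<lambda>x. g x \<inter> h x) fine p"
    using fine_division_exists_real[OF gauge_Int[OF g(1) h(1)]] by blast
  show ?thesis
  proof (rule that[of p])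
    show "finite p" using p(1) by (rule tagged_division_of_finite)
    show "x \<in> {a..b}" if "(x, k) \<in> p" for x k
      using tagged_division_ofD(2,3)[OF p(1) that] by blast
  qed (use g(2)[OF p(1)] h(2)[OF p(1)] p(2) in \<open>auto simp: fine_Int real_norm_def\<close>)
qed

subsection \<open>The generator and its resolvent\<close>

lemma right_difference_quotient:
  fixes f :: "real \<Rightarrow> 'a::real_normed_vector"
  assumes "(f has_vector_derivative D) (at_right u)"
  shows "((\<lambda>h. (f (u + h) - f u) /\<^sub>R h) \<longlongrightarrow> D) (at_right 0)"
proof -
  have "((\<lambda>y. ((f y - f u) - (y - u) *\<^sub>R D) /\<^sub>R norm (y - u)) \<longlongrightarrow> 0) (at_right u)"
    using assms by (simp add: has_vector_derivative_def has_derivative_at_within)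
  then have "((\<lambda>h. ((f (u + h) - f u) - h *\<^sub>R D) /\<^sub>R norm h) \<longlongrightarrow> 0) (at_right 0)"
    by (subst (asm) at_right_to_0) (simp add: filterlim_filtermap add.commute)
  then have "((\<lambda>h. (f (u + h) - f u) /\<^sub>R h - D) \<longlongrightarrow> 0) (at_right 0)"
  proof (rule Lim_transform_eventually)
    show "\<forall>\<^sub>F h in at_right 0. ((f (u + h) - f u) - h *\<^sub>R D) /\<^sub>R norm h = (f (u + h) - f u) /\<^sub>R h - D"
      using eventually_at_right_less[of "0::real"]
      by eventually_elim (simp add: scaleR_diff_right)
  qed
  then show ?thesis by (simp add: LIM_zero_iff)
qed

context c0_semigroup
begin

text \<open>
  The semigroup generated by \<open>A - l\<close>.
\<close>

definition rescaled :: "complex \<Rightarrow> real \<Rightarrow> 'x cop"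
  where "rescaled l t = exp (- (l * t)) *\<^sub>C op t"

lemma rescaled_add: "0 \<le> s \<Longrightarrow> 0 \<le> t \<Longrightarrow> rescaled l (s + t) = rescaled l s * rescaled l t"
  by (simp add: rescaled_def op_add mult_scaleC_left mult_scaleC_right scaleC_scaleC exp_add[symmetric] algebra_simps)

lemma rescaled_zero: "rescaled l 0 = 1"
  by (simp add: rescaled_def op_zero)

lemma continuous_rescaled: "S \<subseteq> {0..} \<Longrightarrow> continuous_on S (\<lambda>t. capp (rescaled l t) x)"
proof -
  assume S: "S \<subseteq> {0..}"
  have "continuous_on S (\<lambda>t. exp (- (l * of_real t)) *\<^sub>C T t x)"
    by (intro bounded_bilinear.continuous_on[OF bounded_bilinear_scaleC] continuous_intros continuous_orbit S)
  then show ?thesis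
    by (rule continuous_on_eq) (use S in \<open>auto simp: rescaled_def capp_scaleC capp_op subset_iff\<close>)
qed

lemma integrable_rescaled: "0 \<le> a \<Longrightarrow> (\<lambda>s. capp (rescaled l s) x) integrable_on {a..b}"
  by (intro integrable_continuous_real continuous_rescaled) auto

text \<open>
  Finite Laplace integrals of the orbits.  The operator \<open>laplace l t\<close> inverts \<open>l - A\<close> up to the error
  \<open>1 - rescaled l t\<close>, on either side.
\<close>

definition laplace_raw :: "complex \<Rightarrow> real \<Rightarrow> 'x \<Rightarrow> 'x"
  where "laplace_raw l t x = integral {0..t} (\<lambda>s. capp (rescaled l s) x)"

definition laplace :: "complex \<Rightarrow> real \<Rightarrow> 'x cop"
  where "laplace l t = cop_of (laplace_raw l t)"

lemma capp_laplace: "capp (laplace l t) x = integral {0..t} (\<lambda>s. capp (rescaled l s) x)"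
proof -
  obtain M where M: "0 \<le> M" "\<And>s. 0 \<le> s \<Longrightarrow> s \<le> t \<Longrightarrow> norm (op s) \<le> M"
    using bounded_op_interval by blast
  define B where "B = exp (\<bar>Re l\<bar> * \<bar>t\<bar>) * M"
  have B: "norm (capp (rescaled l s) x) \<le> B * norm x" if "0 \<le> s" "s \<le> t" for s x
  proof -
    have "- (Re l * s) \<le> \<bar>Re l\<bar> * \<bar>t\<bar>"
      using that mult_mono[of "\<bar>Re l\<bar>" "\<bar>Re l\<bar>" s "\<bar>t\<bar>"] abs_le_D2[of "Re l * s" "\<bar>Re l\<bar> * s"] by (simp add: abs_mult)
    then have "norm (rescaled l s) \<le> B"
      unfolding rescaled_def norm_scaleC B_def using that
      by (intro mult_mono M(2)) (auto simp: norm_exp_eq_Re)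
    then show ?thesis by (rule order_trans[OF norm_capp_le mult_right_mono]) simp
  qed
  have "bounded_clinear (laplace_raw l t)"
  proof (rule bounded_clinearI)
    show "laplace_raw l t (x + y) = laplace_raw l t x + laplace_raw l t y" for x y
      by (simp add: laplace_raw_def capp_add_right integral_add integrable_rescaled)
    show "laplace_raw l t (c *\<^sub>C x) = c *\<^sub>C laplace_raw l t x" for c x
      using integral_linear[OF integrable_rescaled[of 0 l x t] bounded_linear_scaleC_right[of c]]
      by (simp add: laplace_raw_def capp_scaleC_right o_def)
    show "norm (laplace_raw l t x) \<le> norm x * (B * max 0 t)" for x
    proof (cases "0 \<le> t")
      case True
      have "norm (laplace_raw l t x) \<le> (B * norm x) * measure lborel {0..t}"
        unfolding laplace_raw_def
        by (rule has_integral_bound_real[OF _ finite.emptyI integrable_integral[OF integrable_rescaled]])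
          (use B M in \<open>auto simp: B_def\<close>)
      then show ?thesis using True by (simp add: mult_ac)
    qed (simp add: laplace_raw_def B_def M)
  qed
  then show ?thesis by (simp add: laplace_def capp_cop_of laplace_raw_def)
qed

lemma rescaled_laplace:
  assumes "0 \<le> h" "0 \<le> t"
  shows "capp (rescaled l h) (capp (laplace l t) x) = capp (laplace l (t + h)) x - capp (laplace l h) x"
    and "capp (laplace l t) (capp (rescaled l h) x) = capp (laplace l (t + h)) x - capp (laplace l h) x"
proof -
  have eq: "capp (rescaled l h) (capp (rescaled l s) x) = capp (rescaled l (h + s)) x"
    "capp (rescaled l s) (capp (rescaled l h) x) = capp (rescaled l (h + s)) x" if "0 \<le> s" for s
    using that assms rescaled_add[of h s l] rescaled_add[of s h l]
    by (simp_all only: capp_times[symmetric] add.commute[of h s])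
  have "capp (rescaled l h) (capp (laplace l t) x) = integral {0..t} (\<lambda>s. capp (rescaled l h) (capp (rescaled l s) x))"
    using integral_linear[OF integrable_rescaled[of 0 l x t] capp_bounded_linear[of "rescaled l h"]]
    by (simp add: capp_laplace o_def)
  also have "\<dots> = integral {0..t} ((\<lambda>s. capp (rescaled l s) x) \<circ> (+) h)"
    by (rule integral_cong) (simp add: eq)
  also have shift: "integral {0..t} ((\<lambda>s. capp (rescaled l s) x) \<circ> (+) h) = capp (laplace l (t + h)) x - capp (laplace l h) x"
    using Henstock_Kurzweil_Integration.integral_combine[OF _ _ integrable_rescaled[of 0 l x "t + h"], of h] assms
    by (simp add: integral_shift_Icc_real capp_laplace algebra_simps)
  finally show "capp (rescaled l h) (capp (laplace l t) x) = capp (laplace l (t + h)) x - capp (laplace l h) x" .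
  have "capp (laplace l t) (capp (rescaled l h) x) = integral {0..t} (\<lambda>s. capp (rescaled l s) (capp (rescaled l h) x))"
    by (rule capp_laplace)
  also have "\<dots> = integral {0..t} ((\<lambda>s. capp (rescaled l s) x) \<circ> (+) h)"
    by (rule integral_cong) (simp add: eq)
  finally show "capp (laplace l t) (capp (rescaled l h) x) = capp (laplace l (t + h)) x - capp (laplace l h) x"
    by (simp only: shift)
qed

text \<open>
  The difference in front is an integral over the window \<open>[h, t + h]\<close>, which \<open>rescaled_laplace\<close>
  identifies with the composition of \<open>rescaled l h\<close> and \<open>laplace l t\<close> in either order.
\<close>

lemma laplace_difference_quotient:
  assumes t: "0 \<le> t"
  shows "((\<lambda>h. ((capp (laplace l (t + h)) x - capp (laplace l h) x) - capp (laplace l t) x) /\<^sub>R h)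
    \<longlongrightarrow> capp (rescaled l t) x - x) (at_right 0)"
proof -
  have quot: "((\<lambda>h. (capp (laplace l (u + h)) x - capp (laplace l u) x) /\<^sub>R h) \<longlongrightarrow> capp (rescaled l u) x) (at_right 0)"
    if u: "0 \<le> u" for u
  proof -
    have "((\<lambda>v. integral {0..v} (\<lambda>s. capp (rescaled l s) x)) has_vector_derivative capp (rescaled l u) x)
        (at u within {0..u + 1})"
      by (rule integral_has_vector_derivative) (use u in \<open>auto intro: continuous_rescaled\<close>)
    then have "((\<lambda>v. capp (laplace l v) x) has_vector_derivative capp (rescaled l u) x) (at u within {u..u + 1})"
      unfolding capp_laplace by (rule has_vector_derivative_within_subset) (use u in auto)
    then show ?thesis
      by (intro right_difference_quotient) (simp add: at_within_Icc_at_right)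
  qed
  have "((\<lambda>h. (capp (laplace l (t + h)) x - capp (laplace l t) x) /\<^sub>R h - (capp (laplace l (0 + h)) x - capp (laplace l 0) x) /\<^sub>R h)
      \<longlongrightarrow> capp (rescaled l t) x - capp (rescaled l 0) x) (at_right 0)"
    by (intro tendsto_diff quot t order_refl)
  moreover have "capp (laplace l 0) x = 0" by (simp add: capp_laplace)
  ultimately show ?thesis
    by (simp add: rescaled_zero capp_one scaleR_diff_right[symmetric] diff_diff_eq add.commute)
qed

abbreviation dom :: "'x set" where "dom \<equiv> fst (generator T)"
abbreviation gen :: "'x \<Rightarrow> 'x" where "gen \<equiv> snd (generator T)"

lemma generatorI:
  assumes "((\<lambda>h. (T h x - x) /\<^sub>R h) \<longlongrightarrow> y) (at_right 0)"
  shows "x \<in> dom" "gen x = y"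
  using assms tendsto_Lim[OF _ assms] by (auto simp: generator_def)

lemma generatorD:
  assumes "x \<in> dom"
  shows "((\<lambda>h. (T h x - x) /\<^sub>R h) \<longlongrightarrow> gen x) (at_right 0)"
  using assms tendsto_Lim[of "at_right (0::real)" "\<lambda>h. (T h x - x) /\<^sub>R h"] by (auto simp: generator_def)

lemma exp_quotient: fixes c :: complex shows "((\<lambda>h. (exp (c * of_real h) - 1) /\<^sub>R h) \<longlongrightarrow> c) (at_right (0::real))"
proof -
  have "((\<lambda>h. exp (h *\<^sub>R c)) has_vector_derivative c) (at_right (0::real))"
    using exp_scaleR_has_vector_derivative_right[of c 0 "{0<..}"] by simp
  from right_difference_quotient[OF this] show ?thesis by (simp add: scaleR_conv_of_real mult.commute)
qed

lemma rescaled_quotient: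
  assumes "((\<lambda>h. (T h x - x) /\<^sub>R h) \<longlongrightarrow> y) (at_right 0)"
  shows "((\<lambda>h. (capp (rescaled l h) x - x) /\<^sub>R h) \<longlongrightarrow> y - l *\<^sub>C x) (at_right 0)"
proof -
  have e: "((\<lambda>h::real. exp (- (l * h))) \<longlongrightarrow> exp (- (l * of_real 0))) (at_right 0)"
    by (intro tendsto_intros)
  have "((\<lambda>h. exp (- (l * h)) *\<^sub>C ((T h x - x) /\<^sub>R h) + ((exp (- l * h) - 1) /\<^sub>R h) *\<^sub>C x)
      \<longlongrightarrow> exp (- (l * of_real 0)) *\<^sub>C y + (- l) *\<^sub>C x) (at_right 0)"
    by (intro tendsto_add tendsto_scaleC assms e exp_quotient tendsto_const)
  then have "((\<lambda>h. exp (- (l * h)) *\<^sub>C ((T h x - x) /\<^sub>R h) + ((exp (- l * h) - 1) /\<^sub>R h) *\<^sub>C x) \<longlongrightarrow> y - l *\<^sub>C x) (at_right 0)"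
    by simp
  then show ?thesis
  proof (rule Lim_transform_eventually)
    show "\<forall>\<^sub>F h in at_right 0. exp (- (l * h)) *\<^sub>C ((T h x - x) /\<^sub>R h) + ((exp (- l * h) - 1) /\<^sub>R h) *\<^sub>C x
        = (capp (rescaled l h) x - x) /\<^sub>R h"
      using eventually_at_right_less[of "0::real"]
    proof eventually_elim
      case (elim h)
      then show ?case
        by (simp add: rescaled_def capp_scaleC capp_op scaleC_scaleR_commute scaleC_diff_right
            complex_normed_scaleR scaleC_scaleC scaleC_complex_def scaleR_conv_of_real) (simp add: scaleC_diff_left right_diff_distrib mult.commute)
    qed
  qed
qed

lemma rescaled_quotientD:
  assumes "((\<lambda>h. (capp (rescaled l h) x - x) /\<^sub>R h) \<longlongrightarrow> y) (at_right 0)"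
  shows "((\<lambda>h. (T h x - x) /\<^sub>R h) \<longlongrightarrow> y + l *\<^sub>C x) (at_right 0)"
proof -
  have e: "((\<lambda>h::real. exp (l * h)) \<longlongrightarrow> exp (l * of_real 0)) (at_right 0)"
    by (intro tendsto_intros)
  have "((\<lambda>h. exp (l * h) *\<^sub>C ((capp (rescaled l h) x - x) /\<^sub>R h) + ((exp (l * h) - 1) /\<^sub>R h) *\<^sub>C x)
      \<longlongrightarrow> exp (l * of_real 0) *\<^sub>C y + l *\<^sub>C x) (at_right 0)"
    by (intro tendsto_add tendsto_scaleC assms e exp_quotient tendsto_const)
  then have "((\<lambda>h. exp (l * h) *\<^sub>C ((capp (rescaled l h) x - x) /\<^sub>R h) + ((exp (l * h) - 1) /\<^sub>R h) *\<^sub>C x) \<longlongrightarrow> y + l *\<^sub>C x) (at_right 0)"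
    by simp
  then show ?thesis
  proof (rule Lim_transform_eventually)
    show "\<forall>\<^sub>F h in at_right 0. exp (l * h) *\<^sub>C ((capp (rescaled l h) x - x) /\<^sub>R h) + ((exp (l * h) - 1) /\<^sub>R h) *\<^sub>C x
        = (T h x - x) /\<^sub>R h"
      using eventually_at_right_less[of "0::real"]
    proof eventually_elim
      case (elim h)
      have "exp (l * h) * exp (- (l * h)) = 1" by (simp add: exp_minus_inverse)
      then have "exp (l * h) *\<^sub>C (capp (rescaled l h) x) = T h x"
        using elim by (simp add: rescaled_def capp_scaleC capp_op scaleC_scaleC)
      then show ?case
        by (simp add: scaleC_scaleR_commute scaleC_diff_right) (simp add: complex_normed_scaleR scaleC_scaleC
            scaleC_complex_def scaleR_conv_of_real scaleC_diff_left right_diff_distrib mult.commute scaleC_diff_right)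
    qed
  qed
qed

lemma laplace_in_domain:
  assumes t: "0 \<le> t"
  shows "capp (laplace l t) x \<in> dom"
    and "l *\<^sub>C capp (laplace l t) x - gen (capp (laplace l t) x) = x - capp (rescaled l t) x"
proof -
  have "((\<lambda>h. (capp (rescaled l h) (capp (laplace l t) x) - capp (laplace l t) x) /\<^sub>R h)
      \<longlongrightarrow> capp (rescaled l t) x - x) (at_right 0)"
    by (rule Lim_transform_eventually[OF laplace_difference_quotient[OF t]])
      (use t in \<open>auto simp: eventually_at_right_less rescaled_laplace(1) intro!: eventually_mono[OF eventually_at_right_less[of "0::real"]]\<close>)
  from generatorI[OF rescaled_quotientD[OF this]]
  show "capp (laplace l t) x \<in> dom"
    and "l *\<^sub>C capp (laplace l t) x - gen (capp (laplace l t) x) = x - capp (rescaled l t) x"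
    by simp_all
qed

lemma laplace_on_domain:
  assumes t: "0 \<le> t" and x: "x \<in> dom"
  shows "capp (laplace l t) (l *\<^sub>C x - gen x) = x - capp (rescaled l t) x"
proof -
  have "((\<lambda>h. capp (laplace l t) ((capp (rescaled l h) x - x) /\<^sub>R h)) \<longlongrightarrow> capp (laplace l t) (gen x - l *\<^sub>C x)) (at_right 0)"
    by (intro bounded_linear.tendsto[OF capp_bounded_linear] rescaled_quotient generatorD x)
  moreover have "((\<lambda>h. capp (laplace l t) ((capp (rescaled l h) x - x) /\<^sub>R h)) \<longlongrightarrow> capp (rescaled l t) x - x) (at_right 0)"
    by (rule Lim_transform_eventually[OF laplace_difference_quotient[OF t]])
      (use t in \<open>auto simp: capp_scaleR_right capp_diff_right rescaled_laplace(2) intro!: eventually_mono[OF eventually_at_right_less[of "0::real"]]\<close>)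
  ultimately have "capp (laplace l t) (gen x - l *\<^sub>C x) = capp (rescaled l t) x - x"
    by (rule tendsto_unique[OF trivial_limit_at_right_real])
  then have "- capp (laplace l t) (gen x - l *\<^sub>C x) = x - capp (rescaled l t) x" by simp
  then show ?thesis by (simp add: capp_diff_right)
qed

lemma exists_small_rescaled:
  assumes w: "w \<in> growth_exponents" "w < Re l"
  obtains t where "0 < t" "norm (rescaled l t) < 1"
proof -
  obtain M where M: "\<And>t. 0 \<le> t \<Longrightarrow> norm (op t) \<le> M * exp (w * t)"
    using w(1) by (auto simp: growth_exponents_def)
  define d where "d = Re l - w"
  have d: "0 < d" using w by (simp add: d_def)
  have nr: "norm (rescaled l t) \<le> M * exp (- d * t)" if "0 \<le> t" for t
  proof -
    have "norm (rescaled l t) = exp (- (Re l * t)) * norm (op t)"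
      by (simp add: rescaled_def norm_scaleC norm_exp_eq_Re)
    also have "\<dots> \<le> exp (- (Re l * t)) * (M * exp (w * t))" by (intro mult_left_mono M that) auto
    also have "\<dots> = M * exp (- d * t)" by (simp add: d_def exp_add[symmetric] algebra_simps)
    finally show ?thesis .
  qed
  define t where "t = (ln (\<bar>M\<bar> + 1) + 1) / d"
  have lnM: "0 \<le> ln (\<bar>M\<bar> + 1)" by simp
  have t: "0 < t" using d lnM by (simp add: t_def add_nonneg_pos)
  have "- d * t = - 1 + - ln (\<bar>M\<bar> + 1)" using d by (simp add: t_def)
  then have "exp (- d * t) = exp (- 1) * exp (- ln (\<bar>M\<bar> + 1))" by (simp only: exp_add)
  also have "exp (- ln (\<bar>M\<bar> + 1)) = inverse (\<bar>M\<bar> + 1)"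
    unfolding exp_minus by (subst exp_ln) (auto simp: add_nonneg_pos)
  finally have "exp (- d * t) = exp (- 1) / (\<bar>M\<bar> + 1)" by (simp only: divide_inverse)
  then have "M * exp (- d * t) \<le> \<bar>M\<bar> / (\<bar>M\<bar> + 1) * exp (- 1)" by (simp add: divide_right_mono mult_right_mono)
  also have "\<dots> < 1"
  proof -
    have "\<bar>M\<bar> / (\<bar>M\<bar> + 1) \<le> 1" by simp
    then have "\<bar>M\<bar> / (\<bar>M\<bar> + 1) * exp (- 1) \<le> 1 * exp (- 1)" by (intro mult_right_mono) auto
    also have "\<dots> < (1::real)" by simp
    finally show ?thesis .
  qed
  finally show ?thesis using nr[of t] t by (intro that[of t]) auto
qed

text \<open>
  No improper integral is needed: once the error term \<open>1 - rescaled l t\<close> is invertible for a single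
  \<open>t\<close>, composing with its inverse gives the resolvent.
\<close>

lemma resolvent_from_laplace:
  assumes t: "0 < t" and inv: "inverses (1 - rescaled l t) B"
  shows "is_resolvent (generator T) l (laplace l t * B)"
proof -
  have VB: "laplace l t * (1 - rescaled l t) = (1 - rescaled l t) * laplace l t"
    using t by (intro capp_eqI) (simp add: capp_times capp_minus capp_one capp_diff_right rescaled_laplace)
  have BV: "B * laplace l t = laplace l t * B" by (rule inverses_commute[OF inv VB[symmetric]])
  have "capp (laplace l t * B) y \<in> dom \<and> l *\<^sub>C capp (laplace l t * B) y - gen (capp (laplace l t * B) y) = y" for y
  proof -
    have "capp B y - capp (rescaled l t) (capp B y) = capp ((1 - rescaled l t) * B) y"
      by (simp add: capp_times capp_minus capp_one)
    also have "\<dots> = y" using inv by (simp add: inverses_def capp_one)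
    finally show ?thesis using laplace_in_domain[of t l "capp B y"] t by (simp add: capp_times)
  qed
  moreover have "capp (laplace l t * B) (l *\<^sub>C x - gen x) = x" if x: "x \<in> dom" for x
  proof -
    have "capp (laplace l t * B) (l *\<^sub>C x - gen x) = capp B (x - capp (rescaled l t) x)"
      unfolding BV[symmetric] using laplace_on_domain[OF _ x, of t l] t by (simp add: capp_times)
    also have "\<dots> = capp (B * (1 - rescaled l t)) x" by (simp add: capp_times capp_minus capp_one)
    finally show ?thesis using inv by (simp add: inverses_def capp_one)
  qed
  ultimately show ?thesis unfolding is_resolvent_def by (simp add: case_prod_beta)
qed

lemma spectral_bound_le_growth: "spectral_bound (generator T) \<le> growth"
  unfolding spectral_bound_def
proof (rule SUP_least)
  fix l assume l: "l \<in> spectrum (generator T)"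
  show "ereal (Re l) \<le> growth"
  proof (rule ccontr)
    assume "\<not> ?thesis"
    then obtain w where w: "w \<in> growth_exponents" "w < Re l" by (auto simp: not_le growth_less_iff)
    obtain t where t: "0 < t" "norm (rescaled l t) < 1" using exists_small_rescaled[OF w] by blast
    obtain B where "inverses (1 - rescaled l t) B" using has_inverse_one_minus[OF t(2)] by (auto simp: has_inverse_def)
    from resolvent_from_laplace[OF t(1) this] have "l \<in> resolvent_set (generator T)"
      by (auto simp: resolvent_set_iff)
    with l show False by (simp add: spectrum_def)
  qed
qed

end

section \<open>Positive semigroups\<close>

text \<open>
  The properties shared by the cones of positive functionals on duals and preduals.
\<close>

locale positive_c0_semigroup = c0_semigroup T for T :: "real \<Rightarrow> 'x::complex_banach \<Rightarrow> 'x" +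
  fixes C :: "'x set"
  assumes positive_T: "positive_semigroup C T"
    and closed_C: "closed C" and zero_C: "0 \<in> C"
    and add_C: "\<And>x y. x \<in> C \<Longrightarrow> y \<in> C \<Longrightarrow> x + y \<in> C"
    and scale_C: "\<And>r x. 0 \<le> r \<Longrightarrow> x \<in> C \<Longrightarrow> r *\<^sub>R x \<in> C"
    and norm_C: "\<And>x y. x \<in> C \<Longrightarrow> y \<in> C \<Longrightarrow> norm x + norm y \<le> norm (x + y)"
    and generating: "\<And>x. \<exists>a\<in>C. \<exists>b\<in>C. \<exists>c\<in>C. \<exists>d\<in>C. x = (a - b) + \<i> *\<^sub>C (c - d)"
begin

lemma sum_C: "(\<And>i. i \<in> I \<Longrightarrow> f i \<in> C) \<Longrightarrow> sum f I \<in> C"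
  by (induction I rule: infinite_finite_induct) (auto simp: zero_C add_C)

lemma sum_norm_C: "(\<And>i. i \<in> I \<Longrightarrow> f i \<in> C) \<Longrightarrow> (\<Sum>i\<in>I. norm (f i)) \<le> norm (sum f I)"
proof (induction I rule: infinite_finite_induct)
  case (insert i I)
  then have "norm (f i) + (\<Sum>j\<in>I. norm (f j)) \<le> norm (f i) + norm (sum f I)" by simp
  also have "\<dots> \<le> norm (f i + sum f I)" using insert by (intro norm_C sum_C) auto
  finally show ?case using insert by simp
qed auto

text \<open>
  Riemann sums of a function with values in the cone lie in the cone, and on them the norm is
  additive.
\<close>

lemma integral_C:
  fixes f :: "real \<Rightarrow> 'x"
  assumes f: "continuous_on {a..b} f" "\<And>t. t \<in> {a..b} \<Longrightarrow> f t \<in> C"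
  shows "integral {a..b} f \<in> C" and "integral {a..b} (\<lambda>t. norm (f t)) \<le> norm (integral {a..b} f)"
proof -
  let ?I = "integral {a..b} f" and ?N = "integral {a..b} (\<lambda>t. norm (f t))"
  have approx: "\<exists>y\<in>C. norm (y - ?I) < e \<and> ?N - e < norm y" if e: "0 < e" for e
  proof -
    obtain p :: "(real \<times> real set) set" where p: "finite p" "\<And>x k. (x, k) \<in> p \<Longrightarrow> x \<in> {a..b}"
      "norm ((\<Sum>(x, k)\<in>p. measure lborel k *\<^sub>R f x) - ?I) < e"
      "\<bar>(\<Sum>(x, k)\<in>p. measure lborel k * norm (f x)) - ?N\<bar> < e"
      using common_Riemann_sums[OF f(1) e] by blast
    have inC: "(case i of (x, k) \<Rightarrow> measure lborel k *\<^sub>R f x) \<in> C" if "i \<in> p" for i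
      using that p(2) f(2) by (cases i) (auto intro!: scale_C)
    have "(\<Sum>(x, k)\<in>p. measure lborel k * norm (f x)) = (\<Sum>i\<in>p. norm (case i of (x, k) \<Rightarrow> measure lborel k *\<^sub>R f x))"
      by (intro sum.cong) auto
    also have "\<dots> \<le> norm (\<Sum>i\<in>p. case i of (x, k) \<Rightarrow> measure lborel k *\<^sub>R f x)"
      by (rule sum_norm_C[OF inC])
    finally show ?thesis using p(3,4) sum_C[OF inC] by (intro bexI[of _ "\<Sum>(x, k)\<in>p. measure lborel k *\<^sub>R f x"]) auto
  qed
  have "?I \<in> closure C"
    unfolding closure_approachable using approx by (auto simp: dist_norm)
  then show "?I \<in> C" using closed_C by simp
  show "?N \<le> norm ?I"
  proof (rule field_le_epsilon)
    fix e :: real assume "0 < e"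
    then obtain y where "norm (y - ?I) < e / 2" "?N - e / 2 < norm y" using approx[of "e / 2"] by auto
    moreover have "norm y \<le> norm ?I + norm (y - ?I)" by (rule norm_triangle_sub)
    ultimately show "?N \<le> norm ?I + e" by linarith
  qed
qed

definition pos_op :: "'x cop \<Rightarrow> bool"
  where "pos_op F \<longleftrightarrow> (\<forall>x\<in>C. capp F x \<in> C)"

lemma pos_op_op: "0 \<le> t \<Longrightarrow> pos_op (op t)"
  using positive_T by (auto simp: pos_op_def capp_op positive_semigroup_def)

lemma pos_op_rescaled: "0 \<le> t \<Longrightarrow> pos_op (rescaled (of_real r) t)"
proof -
  assume "0 \<le> t"
  have "rescaled (of_real r) t = exp (- (r * t)) *\<^sub>R op t"
    by (simp add: rescaled_def complex_normed_scaleR exp_of_real[symmetric])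
  then show ?thesis using pos_op_op[OF \<open>0 \<le> t\<close>] by (auto simp: pos_op_def capp_scaleR scale_C)
qed

lemma pos_op_mult: "pos_op F \<Longrightarrow> pos_op G \<Longrightarrow> pos_op (F * G)"
  by (simp add: pos_op_def capp_times)

lemma pos_op_one: "pos_op 1"
  by (simp add: pos_op_def capp_one)

lemma pos_op_power: "pos_op F \<Longrightarrow> pos_op (F ^ n)"
  by (induction n) (simp_all add: pos_op_mult pos_op_one)

lemma pos_op_Neumann:
  assumes F: "pos_op F" and s: "norm F < 1" and inv: "inverses (1 - F) B"
  shows "pos_op B"
proof -
  have "summable (\<lambda>n. norm F ^ n)" using s by (simp add: summable_geometric)
  moreover have "norm (norm (F ^ n)) \<le> norm F ^ n" if "1 \<le> n" for n
    using norm_power_Suc_le[of F "n - 1"] that by simp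
  ultimately have sm: "summable (\<lambda>n. norm (F ^ n))"
    using summable_comparison_test'[of "\<lambda>n. norm F ^ n" 1 "\<lambda>n. norm (F ^ n)"] by simp
  have B: "B = (\<Sum>n. F ^ n)" by (rule inverses_unique[OF inv Neumann[OF sm]])
  show ?thesis
    unfolding pos_op_def
  proof
    fix x assume x: "x \<in> C"
    have lim: "(\<lambda>n. capp (\<Sum>k<n. F ^ k) x) \<longlonglongrightarrow> capp B x"
      unfolding B by (intro bounded_linear.tendsto[OF bounded_linear_capp_left] summable_LIMSEQ summable_norm_cancel[OF sm])
    have inC: "capp (\<Sum>k<n. F ^ k) x \<in> C" for n
      using linear_sum[OF bounded_linear.linear[OF bounded_linear_capp_left[of x]], of "\<lambda>k. F ^ k" "{..<n}"]
        pos_op_power[OF F] x by (simp add: pos_op_def sum_C)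
    show "capp B x \<in> C" by (rule closed_sequentially[OF closed_C inC lim])
  qed
qed

lemma pos_op_laplace: "0 \<le> t \<Longrightarrow> pos_op (laplace (of_real r) t)"
  unfolding pos_op_def capp_laplace
  by (intro ballI integral_C(1) continuous_rescaled) (use pos_op_rescaled in \<open>auto simp: pos_op_def\<close>)

lemma pos_op_large_resolvent:
  assumes w: "w \<in> growth_exponents" "w < r"
  obtains R where "is_resolvent (generator T) (of_real r) R" "pos_op R"
proof -
  obtain t where t: "0 < t" "norm (rescaled (of_real r) t) < 1"
    using exists_small_rescaled[of w "of_real r"] w by auto
  obtain B where B: "inverses (1 - rescaled (of_real r) t) B"
    using has_inverse_one_minus[OF t(2)] by (auto simp: has_inverse_def)
  have "pos_op B" using t by (intro pos_op_Neumann[OF _ t(2) B] pos_op_rescaled) auto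
  then show ?thesis
    using that[OF resolvent_from_laplace[OF t(1) B] pos_op_mult[OF pos_op_laplace]] t by simp
qed

text \<open>
  With \<open>F = (b - a) R\<close> the resolvent identity reads \<open>(1 - F) S = R\<close>, and the Neumann series of
  \<open>1 - F\<close> has positive terms.
\<close>

lemma pos_op_resolvent_step:
  assumes R: "is_resolvent (generator T) (of_real b) R" "pos_op R"
    and S: "is_resolvent (generator T) (of_real a) S"
    and ab: "a \<le> b" "(b - a) * norm R < 1"
  shows "pos_op S"
proof -
  define F where "F = (b - a) *\<^sub>R R"
  have F: "norm F < 1" "pos_op F" using ab R(2) by (auto simp: F_def pos_op_def capp_scaleR scale_C)
  obtain B where B: "inverses (1 - F) B" using has_inverse_one_minus[OF F(1)] by (auto simp: has_inverse_def)
  have "S = R + F * S"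
    using resolvent_identity[OF R(1) S]
    by (simp add: F_def complex_normed_scaleR mult_scaleC_left)
  then have "(1 - F) * S = R" by (simp add: algebra_simps)
  then have "B * R = (B * (1 - F)) * S" by (simp only: mult.assoc)
  then have "S = B * R" using B by (simp add: inverses_def)
  then show ?thesis using pos_op_mult[OF pos_op_Neumann[OF F(2,1) B] R(2)] by simp
qed

text \<open>
  Positivity of the resolvent spreads downwards along a real half-line in the resolvent set: near
  each point the Neumann series expresses the resolvent by the one a little further up.
\<close>

lemma pos_op_resolvent:
  assumes rs: "\<And>r. m \<le> r \<Longrightarrow> of_real r \<in> resolvent_set (generator T)"
    and S: "is_resolvent (generator T) (of_real m) S"
  shows "pos_op S"
proof -
  obtain w where w: "w \<in> growth_exponents" using growth_exponents_nonempty by blast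
  define b where "b = max m w + 1"
  have b: "m \<le> b" "w < b" by (auto simp: b_def)
  define Q where "Q y \<longleftrightarrow> (\<forall>R. is_resolvent (generator T) (of_real y) R \<longrightarrow> pos_op R)" for y :: real
  define P where "P x y \<longleftrightarrow> m \<le> x \<longrightarrow> Q y \<longrightarrow> Q x" for x y :: real
  have "P m b"
    using b(1)
  proof (induction rule: Bolzano)
    case (trans x y z)
    have "m \<le> x \<Longrightarrow> m \<le> y" using trans by simp
    then show ?case using trans(1,2) unfolding P_def by blast
  next
    case (local x)
    obtain R where R: "is_resolvent (generator T) (of_real x) R"
      using rs[of x] local by (auto simp: resolvent_set_iff)
    define d where "d = (1/4) / (norm R + 1)"
    have R1: "0 < norm R + 1" by (simp add: add_nonneg_pos)
    then have d: "0 < d" by (simp add: d_def)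
    have "d * norm R \<le> d * (norm R + 1)" using d by (intro mult_left_mono) auto
    also have "\<dots> = 1/4" using R1 by (simp add: d_def)
    finally have dR: "d * norm R \<le> 1/4" .
    have "P a c" if ac: "a \<le> x" "x \<le> c" "c - a < d" for a c
      unfolding P_def Q_def[of a]
    proof (intro impI allI)
      fix S assume m: "m \<le> a" and pos: "Q c"
        and S: "is_resolvent (generator T) (of_real a) S"
      obtain U where U: "is_resolvent (generator T) (of_real c) U"
        using rs[of c] m ac by (auto simp: resolvent_set_iff)
      have "norm U \<le> norm R + (c - x) * (norm R * norm U)"
      proof -
        have "norm U = norm (R + (of_real x - of_real c) *\<^sub>C (R * U))" using resolvent_identity[OF R U] by simp
        also have "\<dots> \<le> norm R + norm ((of_real x - of_real c) *\<^sub>C (R * U))" by (rule norm_triangle_ineq)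
        also have "norm ((of_real x - of_real c) *\<^sub>C (R * U)) = (c - x) * norm (R * U)"
          using ac by (simp add: norm_scaleC flip: of_real_diff)
        also have "\<dots> \<le> (c - x) * (norm R * norm U)" using ac by (intro mult_left_mono norm_mult_ineq) auto
        finally show ?thesis by simp
      qed
      also have "(c - x) * (norm R * norm U) \<le> d * (norm R * norm U)"
        using ac by (intro mult_right_mono) auto
      also have "\<dots> \<le> 1/4 * norm U"
        using mult_right_mono[OF dR norm_ge_zero[of U]] by (simp add: mult.assoc)
      finally have "norm U \<le> 2 * norm R" using norm_ge_zero[of U] by linarith
      then have "(c - a) * norm U \<le> d * (2 * norm R)" using ac d by (intro mult_mono) auto
      also have "\<dots> < 1" using dR by simp
      finally show "pos_op S" using U S pos ac by (intro pos_op_resolvent_step[of c U a S]) (auto simp: Q_def)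
    qed
    then show ?case using d by blast
  qed
  moreover have "Q b"
  proof -
    obtain R where R: "is_resolvent (generator T) (of_real b) R" "pos_op R"
      using pos_op_large_resolvent[OF w b(2)] by blast
    have "R' = R" if "is_resolvent (generator T) (of_real b) R'" for R'
      using resolvent_identity[OF R(1) that] by simp
    with R(2) show ?thesis unfolding Q_def by blast
  qed
  ultimately have "Q m" by (simp add: P_def)
  with S show ?thesis unfolding Q_def by blast
qed

text \<open>
  The Laplace integrals of a positive orbit are dominated by the resolvent.  Additivity of the norm
  turns this into a bound for the integrals of the norm, and thus for the orbit itself.
\<close>

lemma growth_exponent_if_resolvent:
  assumes rs: "\<And>r. m \<le> r \<Longrightarrow> of_real r \<in> resolvent_set (generator T)"
  shows "m \<in> growth_exponents"
proof -
  let ?U = "rescaled (of_real m)"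
  obtain R where R: "is_resolvent (generator T) (of_real m) R"
    using rs[of m] by (auto simp: resolvent_set_iff)
  have pR: "pos_op R" by (rule pos_op_resolvent[OF rs R])
  have lap: "norm (capp (laplace (of_real m) t) x) \<le> norm (capp R x)" if x: "x \<in> C" and t: "0 \<le> t" for x t
  proof -
    let ?v = "capp (laplace (of_real m) t) x"
    have "?v = capp R (of_real m *\<^sub>C ?v - gen ?v)"
      using R laplace_in_domain(1)[OF t] by (simp add: is_resolvent_def case_prod_beta)
    also have "\<dots> = capp R x - capp R (capp (?U t) x)"
      by (simp add: laplace_in_domain(2)[OF t] capp_diff_right)
    finally have eq: "capp R x = ?v + capp R (capp (?U t) x)" by simp
    have "?v \<in> C" "capp R (capp (?U t) x) \<in> C"
      using pos_op_laplace[OF t] pR pos_op_rescaled[OF t] x by (auto simp: pos_op_def)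
    then have "norm ?v + norm (capp R (capp (?U t) x)) \<le> norm (capp R x)"
      unfolding eq by (rule norm_C)
    then show ?thesis using norm_ge_zero[of "capp R (capp (?U t) x)"] by linarith
  qed
  obtain M where M: "0 \<le> M" "\<And>t. 0 \<le> t \<Longrightarrow> t \<le> 1 \<Longrightarrow> norm (op t) \<le> M"
    using bounded_op_interval by blast
  define K where "K = exp \<bar>m\<bar> * M"
  have K: "0 \<le> K" using M by (simp add: K_def)
  have UK: "norm (?U t) \<le> K" if "0 \<le> t" "t \<le> 1" for t
  proof -
    have "- (m * t) \<le> \<bar>m\<bar>"
      using that mult_left_mono[of t 1 "\<bar>m\<bar>"] abs_ge_minus_self[of "m * t"] by (simp add: abs_mult)
    then show ?thesis
      unfolding rescaled_def norm_scaleC K_def using that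
      by (intro mult_mono M(2)) (auto simp: norm_exp_eq_Re)
  qed
  \<comment> \<open>An orbit at time \<open>t\<close> is controlled by the mean of its norm over the preceding unit interval.\<close>
  have large: "norm (capp (?U t) x) \<le> K * norm (capp R x)" if x: "x \<in> C" and t: "1 \<le> t" for x t
  proof -
    have C: "capp (?U s) x \<in> C" if "0 \<le> s" for s using pos_op_rescaled[OF that] x by (simp add: pos_op_def)
    have int: "(\<lambda>s. norm (capp (?U s) x)) integrable_on {a..b}" if "0 \<le> a" for a b
      using that by (intro integrable_continuous_real continuous_on_norm continuous_rescaled) auto
    have le: "norm (capp (?U t) x) \<le> K * norm (capp (?U s) x)" if s: "s \<in> {t - 1..t}" for s
    proof -
      have "?U t = ?U (t - s) * ?U s" using rescaled_add[of "t - s" s "of_real m"] s t by simp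
      then have "norm (capp (?U t) x) \<le> norm (?U (t - s)) * norm (capp (?U s) x)"
        by (simp add: capp_times norm_capp_le)
      also have "\<dots> \<le> K * norm (capp (?U s) x)" using s by (intro mult_right_mono UK) auto
      finally show ?thesis .
    qed
    have "norm (capp (?U t) x) = integral {t - 1..t} (\<lambda>s. norm (capp (?U t) x))" by simp
    also have "\<dots> \<le> integral {t - 1..t} (\<lambda>s. K * norm (capp (?U s) x))"
    proof (rule integral_le)
      show "(\<lambda>s. K * norm (capp (?U s) x)) integrable_on {t - 1..t}"
        using t by (intro integrable_continuous_real continuous_on_mult continuous_on_const
            continuous_on_norm continuous_rescaled) auto
    qed (use le in auto)
    also have "\<dots> = K * integral {t - 1..t} (\<lambda>s. norm (capp (?U s) x))" by simp
    also have "\<dots> \<le> K * integral {0..t} (\<lambda>s. norm (capp (?U s) x))"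
      using t K by (intro mult_left_mono integral_subset_le int) auto
    also have "\<dots> \<le> K * norm (integral {0..t} (\<lambda>s. capp (?U s) x))"
      using K C by (intro mult_left_mono integral_C(2) continuous_rescaled) auto
    also have "\<dots> \<le> K * norm (capp R x)"
      using lap[OF x, of t] t K by (intro mult_left_mono) (auto simp: capp_laplace)
    finally show ?thesis .
  qed
  have "\<exists>B. \<forall>t\<ge>0. norm (capp (?U t) x) \<le> B" if x: "x \<in> C" for x
  proof (intro exI allI impI)
    fix t :: real assume t: "0 \<le> t"
    show "norm (capp (?U t) x) \<le> K * norm (capp R x) + K * norm x"
    proof (cases "1 \<le> t")
      case True
      have "0 \<le> K * norm x" using K by simp
      then show ?thesis using large[OF x True] by linarith
    next
      case False
      have "norm (capp (?U t) x) \<le> norm (?U t) * norm x" by (rule norm_capp_le)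
      also have "\<dots> \<le> K * norm x" using False t by (intro mult_right_mono UK) auto
      also have "\<dots> \<le> K * norm (capp R x) + K * norm x" using K by simp
      finally show ?thesis .
    qed
  qed
  then obtain B where B: "\<And>x t. x \<in> C \<Longrightarrow> 0 \<le> t \<Longrightarrow> norm (capp (?U t) x) \<le> B x" by metis
  have "\<exists>M. \<forall>f\<in>(\<lambda>t. capp (?U t)) ` {0..}. onorm f \<le> M"
  proof (rule uniform_boundedness)
    fix x
    obtain a b c d where abcd: "a \<in> C" "b \<in> C" "c \<in> C" "d \<in> C" "x = (a - b) + \<i> *\<^sub>C (c - d)"
      using generating[of x] by blast
    have "norm (capp (?U t) x) \<le> (B a + B b) + (B c + B d)" if t: "0 \<le> t" for t
    proof -
      have "capp (?U t) x = (capp (?U t) a - capp (?U t) b) + \<i> *\<^sub>C (capp (?U t) c - capp (?U t) d)"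
        by (simp add: abcd(5) capp_add_right capp_diff_right capp_scaleC_right)
      also have "norm \<dots> \<le> norm (capp (?U t) a - capp (?U t) b) + norm (capp (?U t) c - capp (?U t) d)"
        by (rule order_trans[OF norm_triangle_ineq]) (simp add: norm_scaleC)
      also have "\<dots> \<le> (norm (capp (?U t) a) + norm (capp (?U t) b)) + (norm (capp (?U t) c) + norm (capp (?U t) d))"
        by (intro add_mono norm_triangle_ineq4)
      also have "\<dots> \<le> (B a + B b) + (B c + B d)" using abcd t by (intro add_mono B)
      finally show ?thesis .
    qed
    then show "\<exists>B. \<forall>f\<in>(\<lambda>t. capp (?U t)) ` {0..}. norm (f x) \<le> B" by auto
  qed (use capp_bounded_linear in auto)
  then obtain N where N: "\<And>t. 0 \<le> t \<Longrightarrow> norm (?U t) \<le> N" by (auto simp: norm_cop_eq)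
  have "norm (op t) \<le> N * exp (m * t)" if t: "0 \<le> t" for t
  proof -
    have "exp (- (m * t)) * norm (op t) \<le> N"
      using N[OF t] by (simp add: rescaled_def norm_scaleC norm_exp_eq_Re)
    then have "exp (m * t) * (exp (- (m * t)) * norm (op t)) \<le> exp (m * t) * N" by (intro mult_left_mono) auto
    also have "exp (m * t) * (exp (- (m * t)) * norm (op t)) = norm (op t)"
      unfolding mult.assoc[symmetric] exp_add[symmetric] by simp
    finally show ?thesis by (simp only: mult.commute)
  qed
  then show ?thesis by (auto simp: growth_exponents_def)
qed

theorem spectral_bound_eq_growth_bound: "spectral_bound (generator T) = growth_bound T"
  unfolding growth_bound_eq_growth
proof (rule antisym[OF spectral_bound_le_growth])
  show "growth \<le> spectral_bound (generator T)"
  proof (rule ccontr)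
    assume "\<not> ?thesis"
    then have "spectral_bound (generator T) < growth" by simp
    then obtain m where m: "spectral_bound (generator T) < ereal m" "ereal m < growth"
      using ereal_dense2 by blast
    have "of_real r \<in> resolvent_set (generator T)" if r: "m \<le> r" for r
    proof (rule ccontr)
      assume "of_real r \<notin> resolvent_set (generator T)"
      then have "complex_of_real r \<in> spectrum (generator T)" by (simp add: spectrum_def)
      then have "ereal (Re (of_real r)) \<le> spectral_bound (generator T)"
        unfolding spectral_bound_def by (rule SUP_upper)
      then have "ereal m < ereal m" using m(1) r by (metis Re_complex_of_real ereal_less_eq(3) leD le_less_trans order_trans)
      then show False by simp
    qed
    then have "m \<in> growth_exponents" by (rule growth_exponent_if_resolvent)
    then have "growth \<le> ereal m" unfolding growth_def by (rule INF_lower)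
    with m(2) show False by simp
  qed
qed

end

theorem proposition3p6:
  fixes \<iota> :: "'a::cstar_algebra \<Rightarrow> 'p::complex_banach cdual"
    and T :: "real \<Rightarrow> 'p \<Rightarrow> 'p"
    and S :: "real \<Rightarrow> 'b::cstar_algebra cdual \<Rightarrow> 'b cdual"
  shows "(is_predual \<iota> \<and> C0_semigroup T \<and> positive_semigroup (predual_cone \<iota>) T \<longrightarrow>
            spectral_bound (generator T) = growth_bound T) \<and>
         (C0_semigroup S \<and> positive_semigroup dual_cone S \<longrightarrow>
            spectral_bound (generator S) = growth_bound S)"
proof (intro conjI impI)
  assume "is_predual \<iota> \<and> C0_semigroup T \<and> positive_semigroup (predual_cone \<iota>) T"
  then interpret predual \<iota> by unfold_locales simp
  interpret positive_c0_semigroup T "predual_cone \<iota>"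
  proof unfold_locales
    fix x
    show "\<exists>a\<in>predual_cone \<iota>. \<exists>b\<in>predual_cone \<iota>. \<exists>c\<in>predual_cone \<iota>. \<exists>d\<in>predual_cone \<iota>.
        x = (a - b) + \<i> *\<^sub>C (c - d)"
      by (rule predual_cone_generating[of x]) blast
  qed (use \<open>is_predual \<iota> \<and> C0_semigroup T \<and> positive_semigroup (predual_cone \<iota>) T\<close> in
      \<open>auto intro: closed_predual_cone zero_in_predual_cone predual_cone_add predual_cone_scaleR
        norm_additive_on_predual_cone\<close>)
  show "spectral_bound (generator T) = growth_bound T" by (rule spectral_bound_eq_growth_bound)
next
  assume "C0_semigroup S \<and> positive_semigroup dual_cone S"
  then interpret positive_c0_semigroup S dual_cone
  proof (unfold_locales, goal_cases)
    case (8 x)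
    show ?case by (rule dual_cone_generating[of x]) blast
  qed (auto intro: closed_dual_cone zero_in_dual_cone dual_cone_convex_cone norm_additive_on_dual_cone)
  show "spectral_bound (generator S) = growth_bound S" by (rule spectral_bound_eq_growth_bound)
qed

end
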